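(* Let $p$ be an odd prime and let $\gamma$ be either the trivial character of $(\mathbb Z/p\mathbb Z)^\times$ or the quadratic character $\left(\frac{\cdot}{p}\right)$. The genuine Iwahori Hecke algebra $H(\overline{K_0^p(p)},\gamma)$ is generated as a $\mathbb C$-algebra by $\mathcal U_0$ and $\mathcal U_1$ with the defining relations $$\mathcal U_0^2=\begin{cases}(p-1)\,\mathcal U_0+p & \text{if }\gamma\text{ is trivial}\\ \left(\frac{-1}{p}\right)p&\text{if }\gamma=\left(\frac{\cdot}{p}\right),\end{cases}\qquad \mathcal U_1^2=\begin{cases}p & \text{if }\gamma\text{ is trivial}\\ \varepsilon_p(p-1)\,\mathcal U_1+\left(\frac{-1}{p}\right)p&\text{if }\gamma=\left(\frac{\cdot}{p}\right).\end{cases}$$ That is, the algebra is generated by $\mathcal U_0,\mathcal U_1$, and is isomorphic to the unital associative algebra on two generators subject only to these two relations.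
   Context: Let $(\cdot,\cdot)_p$ be the Hilbert symbol on $\mathbb Q_p$. For $g=\begin{pmatrix}a&b\\c&d\end{pmatrix}\in \mathrm{SL}_2(\mathbb Q_p)$ let $\tau(g)=c$ if $c\neq0$ and $\tau(g)=d$ if $c=0$; let $s_p(g)=(c,d)_p$ if $cd\ne0$ and $\mathrm{ord}_p(c)$ is odd, and $s_p(g)=1$ otherwise. Put $\sigma_p(g,h)=(\tau(gh)\tau(g),\tau(gh)\tau(h))_p\,s_p(g)s_p(h)s_p(gh)$. The double cover $\widetilde{\mathrm{SL}}_2(\mathbb Q_p)$ is the set $\mathrm{SL}_2(\mathbb Q_p)\times\{\pm1\}$ with $(g,\epsilon_1)(h,\epsilon_2)=(gh,\epsilon_1\epsilon_2\sigma_p(g,h))$. $K_0^p(p)=\{\begin{pmatrix}a&b\\c&d\end{pmatrix}\in \mathrm{SL}_2(\mathbb Z_p): c\in p\mathbb Z_p\}$ and $\overline{K_0^p(p)}$ is its full inverse image in the double cover, which equals $K_0^p(p)\times\{\pm1\}$ as a group since $p$ is odd. A character $\gamma$ of $(\mathbb Z/p\mathbb Z)^\times$ gives a genuine character of $\overline{K_0^p(p)}$ by $\gamma(A,\epsilon)=\epsilon\,\gamma(d \bmod p)$, $A=\begin{pmatrix}a&b\\c&d\end{pmatrix}$. $H(\overline{K_0^p(p)},\gamma)$ is the algebra of locally constant compactly supported $f:\widetilde{\mathrm{SL}}_2(\mathbb Q_p)\to\mathbb C$ with $f(\tilde k\tilde g\tilde k')=\overline{\gamma}(\tilde k)\overline{\gamma}(\tilde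 k')f(\tilde g)$ for $\tilde k,\tilde k'\in\overline{K_0^p(p)}$, under convolution $f_1*f_2(\tilde h)=\int f_1(\tilde g)f_2(\tilde g^{-1}\tilde h)\,d\tilde g$, the Haar measure giving $\overline{K_0^p(p)}$ measure $1$. Constants in relations mean multiples of the identity element. Let $w(t)=\begin{pmatrix}0&t\\-t^{-1}&0\end{pmatrix}$, and $\varepsilon_p=1$ if $p\equiv1\pmod4$, $\varepsilon_p=i$ if $p\equiv 3\pmod 4$. $\mathcal U_n$ is the element supported on the double coset of $(w(p^{-n}),1)$ with $\mathcal U_n(\tilde k(w(p^{-n}),1)\tilde k')=\overline\gamma(\tilde k)\,\overline{d_n}\,\overline\gamma(\tilde k')$, where $d_n=1$ for $n$ even and $d_n=\varepsilon_p\left(\frac{-1}{p}\right)$ for $n$ odd. *)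

theory Defs
  imports
    "HOL-Analysis.Analysis"
    "HOL-Algebra.QuotRing"
    "HOL-Algebra.Module"
    "HOL-Computational_Algebra.Fraction_Field"
    "HOL-Number_Theory.Residues"
    "HOL-Library.Poly_Mapping"
    "Berlekamp_Zassenhaus.Finite_Field"
begin

section \<open>The p-adic numbers\<close>

text \<open>
  The prime \<open>p\<close> is \<open>CARD('p)\<close> for a type \<open>'p\<close> of class \<^class>\<open>prime_card\<close>.
  The ring of p-adic integers is the inverse limit of the rings \<open>\<int>/p\<^sup>n\<int>\<close>: the residue
  modulo \<open>p\<^sup>n\<close> is represented by the integer \<open>x n\<close> with \<open>0 \<le> x n < p\<^sup>n\<close> (the bounds follow
  from the compatibility condition). The field of p-adic numbers is its field of fractions.
\<close>

typedef ('p::prime_card) padic_int =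
  "{x :: nat \<Rightarrow> int. \<forall>n. x (Suc n) mod int CARD('p) ^ n = x n}"
  by (rule exI[of _ "\<lambda>_. 0"]) simp

setup_lifting type_definition_padic_int

lemma mod_power_Suc_mod_power: "(a::int) mod q ^ Suc n mod q ^ n = a mod q ^ n"
  by (rule mod_mod_cancel) (simp add: le_imp_power_dvd)

lemma padic_int_residue_mod:
  fixes x :: "nat \<Rightarrow> int"
  assumes "\<And>n. x (Suc n) mod q ^ n = x n"
  shows "x (n + k) mod q ^ n = x n"
proof (induction k)
  case 0
  show ?case using assms[of n] by (metis add_0_right mod_mod_trivial)
next
  case (Suc k)
  have "x (n + Suc k) mod q ^ n = x (Suc (n + k)) mod q ^ (n + k) mod q ^ n"
    by (simp add: mod_mod_cancel le_imp_power_dvd)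
  then show ?case using assms Suc.IH by simp
qed

instantiation padic_int :: (prime_card) comm_ring_1
begin

lift_definition zero_padic_int :: "'a padic_int" is "\<lambda>n. 0" by simp

lift_definition one_padic_int :: "'a padic_int" is "\<lambda>n. 1 mod int CARD('a) ^ n"
  by (simp only: mod_power_Suc_mod_power simp_thms)

lift_definition plus_padic_int :: "'a padic_int \<Rightarrow> 'a padic_int \<Rightarrow> 'a padic_int"
  is "\<lambda>x y n. (x n + y n) mod int CARD('a) ^ n"
  by (metis mod_add_eq mod_power_Suc_mod_power)

lift_definition uminus_padic_int :: "'a padic_int \<Rightarrow> 'a padic_int"
  is "\<lambda>x n. (- x n) mod int CARD('a) ^ n"
  by (metis mod_minus_eq mod_power_Suc_mod_power)

lift_definition minus_padic_int :: "'a padic_int \<Rightarrow> 'a padic_int \<Rightarrow> 'a padic_int"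
  is "\<lambda>x y n. (x n - y n) mod int CARD('a) ^ n"
  by (metis mod_diff_eq mod_power_Suc_mod_power)

lift_definition times_padic_int :: "'a padic_int \<Rightarrow> 'a padic_int \<Rightarrow> 'a padic_int"
  is "\<lambda>x y n. (x n * y n) mod int CARD('a) ^ n"
  by (metis mod_mult_eq mod_power_Suc_mod_power)

instance
proof
  fix a b c :: "'a padic_int"
  show "a + b + c = a + (b + c)"
    by transfer (simp add: mod_simps algebra_simps)
  show "a + b = b + a"
    by transfer (simp add: algebra_simps)
  show "0 + a = a"
    by transfer (rule ext, use padic_int_residue_mod[where k = 0] in auto)
  show "- a + a = 0"
    by transfer (simp add: mod_simps)
  show "a - b = a + - b"
    by transfer (simp add: mod_simps)
  show "a * b * c = a * (b * c)"
    by transfer (simp add: mod_simps algebra_simps)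
  show "a * b = b * a"
    by transfer (simp add: algebra_simps)
  show "1 * a = a"
    by transfer (rule ext, use padic_int_residue_mod[where k = 0] in \<open>auto simp: mod_mult_left_eq\<close>)
  show "(a + b) * c = a * c + b * c"
    by transfer (simp add: mod_simps algebra_simps)
  have "1 < CARD('a)"
    using prime_card[where 'a = 'a] by (rule prime_gt_1_nat)
  then show "(0::'a padic_int) \<noteq> 1"
    by transfer (auto simp: fun_eq_iff intro!: exI[of _ 1])
qed

end

instance padic_int :: (prime_card) idom
proof
  fix a b :: "'a padic_int"
  assume "a \<noteq> 0" "b \<noteq> 0"
  then show "a * b \<noteq> 0"
  proof transfer
    fix x y :: "nat \<Rightarrow> int"
    let ?p = "int CARD('a)"
    assume x: "\<forall>n. x (Suc n) mod ?p ^ n = x n" and y: "\<forall>n. y (Suc n) mod ?p ^ n = y n"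
      and "x \<noteq> (\<lambda>n. 0)" "y \<noteq> (\<lambda>n. 0)"
    then obtain n m where nm: "x n \<noteq> 0" "y m \<noteq> 0" by (meson ext)
    have p: "prime ?p" using prime_card[where 'a = 'a] by simp
    have nx: "\<not> ?p ^ n dvd x (n + m)"
      using padic_int_residue_mod[of x ?p n m] x nm by (auto simp: dvd_eq_mod_eq_0)
    have ny: "\<not> ?p ^ m dvd y (n + m)"
      using padic_int_residue_mod[of y ?p m n] y nm by (auto simp: dvd_eq_mod_eq_0 add.commute)
    have "\<not> ?p ^ (n + m) dvd x (n + m) * y (n + m)"
    proof
      assume dvd: "?p ^ (n + m) dvd x (n + m) * y (n + m)"
      let ?X = "x (n + m)" and ?Y = "y (n + m)"
      have nz: "?X \<noteq> 0" "?Y \<noteq> 0" using nx ny by auto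
      have "n + m \<le> multiplicity ?p (?X * ?Y)"
        using dvd nz p by (intro multiplicity_geI) auto
      also have "\<dots> = multiplicity ?p ?X + multiplicity ?p ?Y"
        using nz p by (intro prime_elem_multiplicity_mult_distrib) auto
      finally have "n \<le> multiplicity ?p ?X \<or> m \<le> multiplicity ?p ?Y" by linarith
      then show False using nx ny multiplicity_dvd' by blast
    qed
    then have "(x (n + m) * y (n + m)) mod ?p ^ (n + m) \<noteq> 0"
      by (simp add: dvd_eq_mod_eq_0)
    then show "(\<lambda>n. (x n * y n) mod ?p ^ n) \<noteq> (\<lambda>n. 0)"
      by (auto simp: fun_eq_iff)
  qed
qed

type_synonym 'p padic = "'p padic_int fract"

definition padic_integers :: "'p::prime_card padic set"
  where "padic_integers = range (\<lambda>z. Fract z 1)"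

definition padic_units :: "'p::prime_card padic set"
  where "padic_units = {u \<in> padic_integers. u \<noteq> 0 \<and> inverse u \<in> padic_integers}"

definition padic_ideal :: "nat \<Rightarrow> 'p::prime_card padic set"
  where "padic_ideal n = (\<lambda>z. of_nat CARD('p) ^ n * z) ` padic_integers"

text \<open>Only meaningful for \<open>x \<noteq> 0\<close>.\<close>
definition padic_ord :: "'p::prime_card padic \<Rightarrow> int"
  where "padic_ord x = (THE k. \<exists>u\<in>padic_units. x = of_nat CARD('p) powi k * u)"

text \<open>The representative in \<open>{0..<p}\<close> of the class of a p-adic integer modulo \<open>p\<close>.\<close>
definition padic_residue :: "'p::prime_card padic \<Rightarrow> int"
  where "padic_residue x = (THE r. 0 \<le> r \<and> r < int CARD('p) \<and> x - of_int r \<in> padic_ideal 1)"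

definition hilbert_symbol :: "'p::prime_card padic \<Rightarrow> 'p padic \<Rightarrow> int"
  where "hilbert_symbol a b =
    (if \<exists>x y z. (x, y, z) \<noteq> (0, 0, 0) \<and> z ^ 2 = a * x ^ 2 + b * y ^ 2 then 1 else - 1)"


section \<open>The metaplectic double cover of SL(2)\<close>

definition kubota_tau :: "'p::prime_card padic ^ 2 ^ 2 \<Rightarrow> 'p padic"
  where "kubota_tau g = (if g $ 2 $ 1 \<noteq> 0 then g $ 2 $ 1 else g $ 2 $ 2)"

definition kubota_s :: "'p::prime_card padic ^ 2 ^ 2 \<Rightarrow> int"
  where "kubota_s g =
    (if g $ 2 $ 1 * g $ 2 $ 2 \<noteq> 0 \<and> odd (padic_ord (g $ 2 $ 1))
     then hilbert_symbol (g $ 2 $ 1) (g $ 2 $ 2) else 1)"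

definition kubota_cocycle :: "'p::prime_card padic ^ 2 ^ 2 \<Rightarrow> 'p padic ^ 2 ^ 2 \<Rightarrow> int"
  where "kubota_cocycle g h =
    hilbert_symbol (kubota_tau (g ** h) * kubota_tau g) (kubota_tau (g ** h) * kubota_tau h)
      * kubota_s g * kubota_s h * kubota_s (g ** h)"

lemma hilbert_symbol_cases: "hilbert_symbol a b = 1 \<or> hilbert_symbol a b = - 1"
  by (simp add: hilbert_symbol_def)

lemma sign_mult_cases:
  fixes a b :: int
  assumes "a = 1 \<or> a = - 1" and "b = 1 \<or> b = - 1"
  shows "a * b = 1 \<or> a * b = - 1"
  using assms by auto

lemma kubota_s_cases: "kubota_s g = 1 \<or> kubota_s g = - 1"
  using hilbert_symbol_cases[of "g $ 2 $ 1" "g $ 2 $ 2"] by (simp add: kubota_s_def)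

lemma kubota_cocycle_cases: "kubota_cocycle g h = 1 \<or> kubota_cocycle g h = - 1"
  unfolding kubota_cocycle_def
  by (intro sign_mult_cases hilbert_symbol_cases kubota_s_cases)

typedef ('p::prime_card) metaplectic =
  "{(A :: 'p padic ^ 2 ^ 2, e :: int). det A = 1 \<and> e \<in> {1, - 1}}"
  by (rule exI[of _ "(mat 1, 1)"]) simp

setup_lifting type_definition_metaplectic

definition mp_matrix :: "'p::prime_card metaplectic \<Rightarrow> 'p padic ^ 2 ^ 2"
  where "mp_matrix x = fst (Rep_metaplectic x)"

definition mp_sign :: "'p::prime_card metaplectic \<Rightarrow> int"
  where "mp_sign x = snd (Rep_metaplectic x)"

text \<open>The element \<open>(A, 1)\<close>, for \<open>A\<close> of determinant 1.\<close>
definition mp_section :: "'p::prime_card padic ^ 2 ^ 2 \<Rightarrow> 'p metaplectic"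
  where "mp_section A = Abs_metaplectic (A, 1)"

lift_definition mp_mult ::
    "'p::prime_card metaplectic \<Rightarrow> 'p metaplectic \<Rightarrow> 'p metaplectic"
  is "\<lambda>(g, e1) (h, e2). (g ** h, e1 * e2 * kubota_cocycle g h)"
proof goal_cases
  case (1 x y)
  then show ?case
    using kubota_cocycle_cases[of "fst x" "fst y"]
    by (auto simp: det_mul split: prod.splits)
qed

definition mp_group :: "'p::prime_card metaplectic monoid"
  where "mp_group = \<lparr>carrier = UNIV, monoid.mult = mp_mult, one = mp_section (mat 1)\<rparr>"

definition principal_congruence :: "nat \<Rightarrow> ('p::prime_card padic ^ 2 ^ 2) set"
  where "principal_congruence n =
    {A. det A = 1 \<and> (\<forall>i j. A $ i $ j - mat 1 $ i $ j \<in> padic_ideal n)}"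

text \<open>
  The topology of the double cover as a topological group: for odd \<open>p\<close> the cocycle is trivial
  on the principal congruence subgroups \<open>\<Gamma>(p\<^sup>n)\<close>, \<open>n \<ge> 1\<close>, and the sets \<open>x (\<Gamma>(p\<^sup>n) \<times> {1})\<close>
  form a neighbourhood basis at \<open>x\<close>. This is not the product topology on the underlying
  set \<open>SL\<^sub>2(\<rat>\<^sub>p) \<times> {\<plusminus>1}\<close>, because the cocycle is not locally constant.
\<close>
instantiation metaplectic :: (prime_card) topological_space
begin

definition open_metaplectic :: "'a metaplectic set \<Rightarrow> bool"
  where "open_metaplectic U \<longleftrightarrow>
    (\<forall>x\<in>U. \<exists>n. \<forall>A\<in>principal_congruence n. mp_mult x (mp_section A) \<in> U)"

instance
proof -
  have ideal_mono: "(padic_ideal n :: 'a padic set) \<subseteq> padic_ideal m" if "m \<le> n" for m n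
  proof
    fix x :: "'a padic" assume "x \<in> padic_ideal n"
    then obtain z where x: "x = of_nat CARD('a) ^ n * Fract z 1"
      by (auto simp: padic_ideal_def padic_integers_def)
    have nat: "(of_nat k :: 'a padic) = Fract (of_nat k) 1" for k
      by (rule of_nat_fract)
    have pow: "(Fract a 1 :: 'a padic) ^ k = Fract (a ^ k) 1" for a :: "'a padic_int" and k
      by (induction k) (simp_all add: One_fract_def)
    have "x = of_nat CARD('a) ^ m * Fract (of_nat CARD('a) ^ (n - m) * z) 1"
      using that unfolding x nat pow by (simp flip: power_add mult.assoc)
    then show "x \<in> padic_ideal m"
      by (auto simp: padic_ideal_def padic_integers_def)
  qed
  have mono: "(principal_congruence n :: ('a padic ^ 2 ^ 2) set) \<subseteq> principal_congruence m"
    if "m \<le> n" for m n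
    using ideal_mono[OF that] by (auto simp: principal_congruence_def)
  show "OFCLASS('a metaplectic, topological_space_class)"
  proof
    show "open (UNIV :: 'a metaplectic set)"
      by (simp add: open_metaplectic_def)
  next
    fix S T :: "'a metaplectic set"
    assume S: "open S" and T: "open T"
    show "open (S \<inter> T)"
      unfolding open_metaplectic_def
    proof
      fix x assume "x \<in> S \<inter> T"
      then obtain m n where
        "\<forall>A\<in>principal_congruence m. mp_mult x (mp_section A) \<in> S"
        "\<forall>A\<in>principal_congruence n. mp_mult x (mp_section A) \<in> T"
        using S T unfolding open_metaplectic_def by blast
      then show "\<exists>n. \<forall>A\<in>principal_congruence n. mp_mult x (mp_section A) \<in> S \<inter> T"
        using mono[of m "max m n"] mono[of n "max m n"] by (intro exI[of _ "max m n"]) auto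
    qed
  next
    fix K :: "'a metaplectic set set"
    assume "\<forall>S\<in>K. open S"
    then show "open (\<Union> K)"
      unfolding open_metaplectic_def by (meson UnionE UnionI)
  qed
qed

end

text \<open>
  Regularity need not be demanded: the group is locally compact and second countable.
\<close>
definition haar_measure :: "'p::prime_card metaplectic measure \<Rightarrow> bool"
  where "haar_measure \<mu> \<longleftrightarrow>
    sets \<mu> = sets borel \<and>
    (\<forall>x. \<forall>A\<in>sets borel. emeasure \<mu> ((\<lambda>g. x \<otimes>\<^bsub>mp_group\<^esub> g) ` A) = emeasure \<mu> A) \<and>
    (\<forall>K. compact K \<longrightarrow> emeasure \<mu> K < \<infinity>) \<and>
    (\<forall>U. open U \<longrightarrow> U \<noteq> {} \<longrightarrow> 0 < emeasure \<mu> U)"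


section \<open>The genuine Iwahori Hecke algebra\<close>

definition K0 :: "('p::prime_card padic ^ 2 ^ 2) set"
  where "K0 = {A. det A = 1 \<and> (\<forall>i j. A $ i $ j \<in> padic_integers) \<and> A $ 2 $ 1 \<in> padic_ideal 1}"

definition K0_cover :: "'p::prime_card metaplectic set"
  where "K0_cover = {x. mp_matrix x \<in> K0}"

text \<open>
  A character of \<open>(\<int>/p\<int>)\<^sup>\<times>\<close> is given as a function of integer representatives.
\<close>
definition genuine_char :: "(int \<Rightarrow> complex) \<Rightarrow> 'p::prime_card metaplectic \<Rightarrow> complex"
  where "genuine_char \<gamma> k = of_int (mp_sign k) * \<gamma> (padic_residue (mp_matrix k $ 2 $ 2))"

definition hecke_functions :: "(int \<Rightarrow> complex) \<Rightarrow> ('p::prime_card metaplectic \<Rightarrow> complex) set"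
  where "hecke_functions \<gamma> =
    {f. (\<forall>x. \<exists>U. open U \<and> x \<in> U \<and> (\<forall>y\<in>U. f y = f x)) \<and>
        compact (closure {x. f x \<noteq> 0}) \<and>
        (\<forall>k\<in>K0_cover. \<forall>k'\<in>K0_cover. \<forall>g.
           f (k \<otimes>\<^bsub>mp_group\<^esub> g \<otimes>\<^bsub>mp_group\<^esub> k') =
             cnj (genuine_char \<gamma> k) * cnj (genuine_char \<gamma> k') * f g)}"

definition convolution ::
    "'p::prime_card metaplectic measure \<Rightarrow> ('p metaplectic \<Rightarrow> complex) \<Rightarrow>
     ('p metaplectic \<Rightarrow> complex) \<Rightarrow> 'p metaplectic \<Rightarrow> complex"
  where "convolution \<mu> f1 f2 h =
    (\<integral>g. f1 g * f2 (inv\<^bsub>mp_group\<^esub> g \<otimes>\<^bsub>mp_group\<^esub> h) \<partial>\<mu>)"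

text \<open>The identity element refers to \<open>\<mu>\<close> normalised to give \<open>K0_cover\<close> measure 1.\<close>
definition hecke_algebra ::
    "'p::prime_card metaplectic measure \<Rightarrow> (int \<Rightarrow> complex) \<Rightarrow>
     (complex, 'p metaplectic \<Rightarrow> complex) module"
  where "hecke_algebra \<mu> \<gamma> =
    \<lparr>carrier = hecke_functions \<gamma>,
     monoid.mult = convolution \<mu>,
     one = (\<lambda>x. if x \<in> K0_cover then cnj (genuine_char \<gamma> x) else 0),
     zero = (\<lambda>x. 0),
     add = (\<lambda>f g x. f x + g x),
     smult = (\<lambda>c f x. c * f x)\<rparr>"

definition weyl :: "'p::prime_card padic \<Rightarrow> 'p padic ^ 2 ^ 2"
  where "weyl t = vector [vector [0, t], vector [- inverse t, 0]]"

definition eps :: "nat \<Rightarrow> complex"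
  where "eps p = (if p mod 4 = 1 then 1 else \<i>)"

definition hecke_d :: "nat \<Rightarrow> int \<Rightarrow> complex"
  where "hecke_d p n = (if even n then 1 else eps p * of_int (Legendre (- 1) (int p)))"

definition hecke_U :: "(int \<Rightarrow> complex) \<Rightarrow> int \<Rightarrow> 'p::prime_card metaplectic \<Rightarrow> complex"
  where "hecke_U \<gamma> n =
    (let w = mp_section (weyl (of_nat CARD('p) powi (- n))) in
     THE f.
       (\<forall>k\<in>K0_cover. \<forall>k'\<in>K0_cover.
          f (k \<otimes>\<^bsub>mp_group\<^esub> w \<otimes>\<^bsub>mp_group\<^esub> k') =
            cnj (genuine_char \<gamma> k) * cnj (hecke_d CARD('p) n) * cnj (genuine_char \<gamma> k')) \<and>
       (\<forall>x. (\<nexists>k k'. k \<in> K0_cover \<and> k' \<in> K0_cover \<and>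
                x = k \<otimes>\<^bsub>mp_group\<^esub> w \<otimes>\<^bsub>mp_group\<^esub> k') \<longrightarrow> f x = 0))"


section \<open>Algebras given by generators and relations\<close>

text \<open>The free monoid, written additively as the exponent type of a monoid algebra.\<close>
datatype 'x free_word = Word (letters: "'x list")

instantiation free_word :: (type) monoid_add
begin

definition zero_free_word :: "'a free_word"
  where "0 = Word []"

definition plus_free_word :: "'a free_word \<Rightarrow> 'a free_word \<Rightarrow> 'a free_word"
  where "v + w = Word (letters v @ letters w)"

instance
  by standard (simp_all add: zero_free_word_def plus_free_word_def)

end

definition free_const :: "complex \<Rightarrow> 'x free_word \<Rightarrow>\<^sub>0 complex"
  where "free_const c = Poly_Mapping.single 0 c"

definition free_gen :: "'x \<Rightarrow> 'x free_word \<Rightarrow>\<^sub>0 complex"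
  where "free_gen x = Poly_Mapping.single (Word [x]) 1"

definition free_algebra :: "(complex, 'x free_word \<Rightarrow>\<^sub>0 complex) module"
  where "free_algebra =
    \<lparr>carrier = UNIV, monoid.mult = (*), one = 1, zero = 0, add = (+),
     smult = (\<lambda>c P. free_const c * P)\<rparr>"

text \<open>
  \<open>A\<close> is isomorphic, as a unital complex algebra, to the quotient of the free algebra by the
  two-sided ideal generated by \<open>R\<close>, by an isomorphism taking the class of \<open>x\<close> to \<open>u x\<close>.
\<close>
definition presented_by ::
    "(complex, 'a) module \<Rightarrow> ('x \<Rightarrow> 'a) \<Rightarrow> ('x free_word \<Rightarrow>\<^sub>0 complex) set \<Rightarrow> bool"
  where "presented_by A u R \<longleftrightarrow>
    (let F = free_algebra; I = genideal F R in
     \<exists>\<phi> \<in> ring_iso (F Quot I) A.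
       (\<forall>c P. \<phi> (I +>\<^bsub>F\<^esub> (c \<odot>\<^bsub>F\<^esub> P)) = c \<odot>\<^bsub>A\<^esub> \<phi> (I +>\<^bsub>F\<^esub> P)) \<and>
       (\<forall>x. \<phi> (I +>\<^bsub>F\<^esub> free_gen x) = u x))"

inductive_set generated_algebra :: "(complex, 'a) module \<Rightarrow> 'a set \<Rightarrow> 'a set"
  for A :: "(complex, 'a) module" and G :: "'a set"
  where
    gen: "a \<in> G \<Longrightarrow> a \<in> generated_algebra A G"
  | one: "\<one>\<^bsub>A\<^esub> \<in> generated_algebra A G"
  | smult: "a \<in> generated_algebra A G \<Longrightarrow> c \<odot>\<^bsub>A\<^esub> a \<in> generated_algebra A G"
  | add: "a \<in> generated_algebra A G \<Longrightarrow> b \<in> generated_algebra A G \<Longrightarrow>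
      a \<oplus>\<^bsub>A\<^esub> b \<in> generated_algebra A G"
  | mult: "a \<in> generated_algebra A G \<Longrightarrow> b \<in> generated_algebra A G \<Longrightarrow>
      a \<otimes>\<^bsub>A\<^esub> b \<in> generated_algebra A G"

datatype hecke_gen = X0 | X1

end

theory Submission
  imports Defs "HOL-Number_Theory.Euler_Criterion"
begin

text \<open>
  The tame formula for the Hilbert symbol makes the cocycle computable. It shows that the cover
  splits over \<open>K0\<close>, and that the lifts \<open>s\<^sub>0\<close>, \<open>s\<^sub>1\<close> of the two affine reflections together with \<open>K0\<close>
  behave like an Iwahori--Matsumoto system whose Weyl group is infinite dihedral. Since \<open>\<gamma>\<close> is
  invariant under conjugation by the reflections, each double coset of an alternating word in
  \<open>s\<^sub>0\<close>, \<open>s\<^sub>1\<close> carries a nonzero function, namely the product of the corresponding generators.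
  These products form a basis. Counting the \<open>p\<close> cosets in \<open>K0 s\<^sub>i K0\<close> expresses the square of a
  generator through a character sum over \<open>b mod p\<close>, which is \<open>p - 1\<close> for one reflection and
  0 for the other; \<open>\<gamma>\<close> decides which is which. In the abstract algebra the quadratic relations already
  reduce everything to alternating words, so there are no further relations.
\<close>

section \<open>The ring of p-adic integers\<close>

text \<open>What separates the two reflections is one Hilbert symbol. They are the lifts of w(t)
  with t = 1 and t = 1/p. Writing a big cell element as k s_i k' pulls a unit a out of w(a t), and
  the cocycle then contributes (-1/(a^2 t), 1/(a t^2)). For t = 1 both entries are units and the
  symbol is 1, so the sum runs over \<gamma>(-b). For t = 1/p the first entry has odd order, the
  symbol is the quadratic character of a, and the sum runs over (b/p) \<gamma>(b). For either
  \<gamma> exactly one of these is identically 1. The constant terms come from s_i^2, which is -1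
  with sign (1/t, 1/t). This sign is (-1/p) for t = 1/p, and the square of \<open>eps\<close>
  cancels it, leaving p \<gamma>(-1) in both relations. The analysis is kept apart from the algebra:
  the integrand of a convolution is constant on left cosets g K0, so each integral is a finite sum
  and the Haar measure enters only through the measure 1 of a coset. Topology serves to identify the
  locally constant, compactly supported functions with those supported on finitely many
  cosets.\<close>

lift_definition padic_res :: "'p::prime_card padic_int \<Rightarrow> nat \<Rightarrow> int" is "\<lambda>x. x" .

lemma prime_int_CARD: "prime (int CARD('p::prime_card))"
  using prime_card[where 'a = 'p] by simp

lemma CARD_gt_1: "1 < int CARD('p::prime_card)"
  using prime_int_CARD[where 'p = 'p] prime_gt_1_int by blast

lemma padic_res_mod: "padic_res (x :: 'p::prime_card padic_int) (n + k) mod int CARD('p) ^ n = padic_res x n"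
  by transfer (rule padic_int_residue_mod, simp)

lemma padic_res_mod_le:
  "m \<le> n \<Longrightarrow> padic_res (x :: 'p::prime_card padic_int) n mod int CARD('p) ^ m = padic_res x m"
  using padic_res_mod[of x m "n - m"] by simp

lemma padic_res_mod_same [simp]:
  "padic_res (x :: 'p::prime_card padic_int) n mod int CARD('p) ^ n = padic_res x n"
  using padic_res_mod[of x n 0] by simp

lemma padic_res_ge_0 [simp]: "0 \<le> padic_res (x :: 'p::prime_card padic_int) n"
  and padic_res_less: "padic_res (x :: 'p padic_int) n < int CARD('p) ^ n"
proof -
  have "0 < int CARD('p) ^ n" using CARD_gt_1[where 'p = 'p] by simp
  then show "0 \<le> padic_res x n" "padic_res x n < int CARD('p) ^ n"
    by (metis padic_res_mod_same pos_mod_sign, metis padic_res_mod_same pos_mod_bound)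
qed

lemma padic_res_at_0 [simp]: "padic_res (x :: 'p::prime_card padic_int) 0 = 0"
  using padic_res_mod_same[of x 0] by (simp del: padic_res_mod_same)

lemma padic_res_0 [simp]: "padic_res (0 :: 'p::prime_card padic_int) n = 0"
  and padic_res_1: "padic_res (1 :: 'p padic_int) n = 1 mod int CARD('p) ^ n"
  and padic_res_add: "padic_res (x + y :: 'p padic_int) n = (padic_res x n + padic_res y n) mod int CARD('p) ^ n"
  and padic_res_diff: "padic_res (x - y :: 'p padic_int) n = (padic_res x n - padic_res y n) mod int CARD('p) ^ n"
  and padic_res_minus: "padic_res (- x :: 'p padic_int) n = (- padic_res x n) mod int CARD('p) ^ n"
  and padic_res_mult: "padic_res (x * y :: 'p padic_int) n = (padic_res x n * padic_res y n) mod int CARD('p) ^ n"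
  by (transfer, simp)+

lemmas padic_res_simps = padic_res_1 padic_res_add padic_res_diff padic_res_minus padic_res_mult

lemma padic_int_eqI: "(\<And>n. padic_res x n = padic_res y n) \<Longrightarrow> x = y"
  by transfer auto

lemma padic_res_of_nat: "padic_res (of_nat k :: 'p::prime_card padic_int) n = int k mod int CARD('p) ^ n"
  by (induction k) (simp_all only: of_nat_Suc of_nat_0 padic_res_0 padic_res_1 padic_res_add mod_simps mod_0)

lemma padic_res_of_int: "padic_res (of_int k :: 'p::prime_card padic_int) n = k mod int CARD('p) ^ n"
  by (cases k rule: int_cases2) (simp_all add: padic_res_minus padic_res_of_nat mod_simps)

lemma padic_int_exists:
  assumes "\<And>n. f (Suc n) mod int CARD('p::prime_card) ^ n = f n"
  obtains x :: "'p::prime_card padic_int" where "\<And>n. padic_res x n = f n"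
proof -
  have "\<exists>x :: 'p padic_int. \<forall>n. padic_res x n = f n"
    using assms by transfer auto
  then show ?thesis using that by blast
qed

lemma padic_res_power_CARD:
  "padic_res (of_nat CARD('p) ^ k :: 'p::prime_card padic_int) n = int CARD('p) ^ k mod int CARD('p) ^ n"
  using padic_res_of_nat[where 'p = 'p, of "CARD('p) ^ k" n] by simp

text \<open>The quotient by p^k is built from shifted residues: division by p^k costs k levels of
  precision, so its residue modulo p^n is read off from the residue of \<open>x\<close> modulo
  p^(k+n).\<close>

lemma power_CARD_dvd_iff_res:
  "of_nat CARD('p::prime_card) ^ k dvd (x :: 'p padic_int) \<longleftrightarrow> padic_res x k = 0"
proof
  let ?p = "int CARD('p)"
  assume "of_nat CARD('p) ^ k dvd x"
  then obtain y where "x = of_nat CARD('p) ^ k * y" by blast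
  then show "padic_res x k = 0" by (simp add: padic_res_mult padic_res_power_CARD)
next
  let ?p = "int CARD('p)"
  assume 0: "padic_res x k = 0"
  have p: "?p > 0" using CARD_gt_1[where 'p = 'p] by simp
  have dvd: "?p ^ k dvd padic_res x (k + n)" for n
    using padic_res_mod[of x k n] 0 by (auto simp: dvd_eq_mod_eq_0)
  have "(padic_res x (k + Suc n) div ?p ^ k) mod ?p ^ n = padic_res x (k + n) div ?p ^ k" for n
  proof -
    have "padic_res x (k + n) = padic_res x (k + Suc n) mod ?p ^ (k + n)"
      using padic_res_mod_le[of "k + n" "k + Suc n" x] by simp
    also have "\<dots> = ?p ^ k * ((padic_res x (k + Suc n) div ?p ^ k) mod ?p ^ n)"
      using dvd[of "Suc n"] by (auto simp: power_add mult_mod_right)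
    finally show ?thesis using p by simp
  qed
  then obtain y :: "'p padic_int" where y: "\<And>n. padic_res y n = padic_res x (k + n) div ?p ^ k"
    using padic_int_exists[of "\<lambda>n. padic_res x (k + n) div ?p ^ k"] by auto
  have "x = of_nat CARD('p) ^ k * y"
  proof (rule padic_int_eqI)
    fix n
    have "padic_res (of_nat CARD('p) ^ k * y) n = (?p ^ k * (padic_res x (k + n) div ?p ^ k)) mod ?p ^ n"
      by (simp add: padic_res_mult padic_res_power_CARD y mod_simps)
    also have "\<dots> = padic_res x (n + k) mod ?p ^ n"
      using dvd[of n] by (simp add: add.commute)
    finally show "padic_res x n = padic_res (of_nat CARD('p) ^ k * y) n"
      by (simp add: padic_res_mod)
  qed
  then show "of_nat CARD('p) ^ k dvd x" by simp
qed

lemma coprime_padic_res: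
  assumes "padic_res (x :: 'p::prime_card padic_int) 1 \<noteq> 0"
  shows "coprime (padic_res x n) (int CARD('p) ^ n)"
proof (cases n)
  case (Suc m)
  have "\<not> int CARD('p) dvd padic_res x n"
    using assms padic_res_mod[of x 1 m] Suc by (auto simp: dvd_eq_mod_eq_0)
  then have "coprime (int CARD('p)) (padic_res x n)"
    using prime_int_CARD prime_imp_coprime by blast
  then show ?thesis by (simp add: coprime_commute)
qed simp

text \<open>Inverses exist modulo every p^n. They fit together without further choice, because an
  inverse modulo p^n is unique.\<close>

lemma padic_int_unit_iff:
  "(x :: 'p::prime_card padic_int) dvd 1 \<longleftrightarrow> padic_res x 1 \<noteq> 0"
proof
  assume "x dvd 1"
  then obtain y where "1 = x * y" by blast
  then have "1 mod int CARD('p) = (padic_res x 1 * padic_res y 1) mod int CARD('p)"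
    by (metis padic_res_1 padic_res_mult power_one_right)
  then show "padic_res x 1 \<noteq> 0" using CARD_gt_1[where 'p = 'p] by auto
next
  let ?p = "int CARD('p)"
  assume 1: "padic_res x 1 \<noteq> 0"
  have "\<exists>y. (padic_res x n * y) mod ?p ^ n = 1 mod ?p ^ n" for n
    using cong_solve_coprime_int[OF coprime_padic_res[OF 1, of n]] by (simp add: cong_def)
  then obtain g where g: "\<And>n. (padic_res x n * g n) mod ?p ^ n = 1 mod ?p ^ n" by metis
  define f where "f n = g n mod ?p ^ n" for n
  have f: "[padic_res x n * f n = 1] (mod ?p ^ n)" for n
    using g[of n] by (simp add: f_def cong_def mod_simps)
  have "f (Suc n) mod ?p ^ n = f n" for n
  proof -
    have "[padic_res x (Suc n) * f (Suc n) = 1] (mod ?p ^ n)"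
      using f[of "Suc n"] by (rule cong_dvd_modulus) (simp add: le_imp_power_dvd)
    moreover have "[padic_res x (Suc n) = padic_res x n] (mod ?p ^ n)"
      using padic_res_mod[of x n 1] by (simp add: cong_def)
    ultimately have "[padic_res x n * f (Suc n) = 1] (mod ?p ^ n)"
      by (metis cong_scalar_right cong_sym cong_trans)
    then have "[padic_res x n * f (Suc n) = padic_res x n * f n] (mod ?p ^ n)"
      using f[of n] cong_sym cong_trans by blast
    then have "[f (Suc n) = f n] (mod ?p ^ n)"
      using cong_mult_lcancel coprime_padic_res[OF 1] by blast
    then show ?thesis by (simp add: cong_def f_def)
  qed
  then obtain y :: "'p padic_int" where y: "\<And>n. padic_res y n = f n"
    using padic_int_exists by blast
  have "x * y = 1"
    using f by (intro padic_int_eqI) (simp add: padic_res_mult padic_res_1 y cong_def)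
  then show "x dvd 1" by (metis dvd_triv_left)
qed

lemma padic_int_factor:
  assumes "(x :: 'p::prime_card padic_int) \<noteq> 0"
  obtains n u where "x = of_nat CARD('p) ^ n * u" "u dvd 1"
proof -
  have "\<exists>k. padic_res x k \<noteq> 0" using assms padic_int_eqI[of x 0] by auto
  define k where "k = (LEAST k. padic_res x k \<noteq> 0)"
  have k: "padic_res x k \<noteq> 0" "\<And>m. m < k \<Longrightarrow> padic_res x m = 0"
    unfolding k_def using \<open>\<exists>k. padic_res x k \<noteq> 0\<close> by (rule LeastI_ex, use not_less_Least in blast)
  \<comment> \<open>Residues modulo p^0 vanish, so the first level with a nonzero residue is a
    successor; its predecessor is the exponent of p in \<open>x\<close>.\<close>
  have "padic_res x 0 = 0" using padic_res_less[of x 0] padic_res_ge_0[of x 0] by simp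
  with k obtain n where n: "k = Suc n" by (cases k) auto
  have "padic_res x n = 0" using k n by simp
  then obtain u where u: "x = of_nat CARD('p) ^ n * u"
    using power_CARD_dvd_iff_res by blast
  have "padic_res u 1 \<noteq> 0"
  proof
    assume "padic_res u 1 = 0"
    then have "of_nat CARD('p) ^ 1 dvd u" using power_CARD_dvd_iff_res by blast
    then have "of_nat CARD('p) ^ k dvd x" unfolding u n by (auto simp: dvd_def)
    then show False using k power_CARD_dvd_iff_res by blast
  qed
  then show ?thesis using that u padic_int_unit_iff by blast
qed

text \<open>In y^p - 1 = (y - 1)(1 + y + ... + y^(p-1)) the second factor is a sum of p terms
  congruent to 1, hence divisible by p. Each p-th power thus gains a factor p.\<close>

lemma power_cong_1_mod_prime_power:
  fixes x p :: int
  assumes "[x = 1] (mod p)" "p > 0"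
  shows "[x ^ (nat p ^ n) = 1] (mod p ^ Suc n)"
proof (induction n)
  case 0
  show ?case using assms by simp
next
  case (Suc n)
  let ?y = "x ^ (nat p ^ n)"
  have "[(\<Sum>j<nat p. ?y ^ j) = (\<Sum>j<nat p. 1 ^ j)] (mod p)"
    using cong_dvd_modulus[OF Suc, of p] by (intro cong_sum cong_pow) simp
  then have "p dvd (\<Sum>j<nat p. ?y ^ j)"
    using assms(2) by (simp add: cong_def dvd_eq_mod_eq_0)
  moreover have "p ^ Suc n dvd ?y - 1" using Suc by (simp add: cong_iff_dvd_diff)
  ultimately have "p ^ Suc n * p dvd (?y - 1) * (\<Sum>j<nat p. ?y ^ j)" by (intro mult_dvd_mono)
  also have "(?y - 1) * (\<Sum>j<nat p. ?y ^ j) = ?y ^ nat p - 1"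
    using power_diff_1_eq[of ?y "nat p"] by simp
  finally show ?case
    by (simp add: cong_iff_dvd_diff mult.commute flip: power_mult)
qed

text \<open>The group of residues congruent to 1 modulo \<open>p\<close> has odd order \<open>p\<^sup>n\<close> modulo \<open>p\<^sup>n\<^sup>+\<^sup>1\<close>, so its
  elements \<open>x\<close> have the explicit square roots \<open>x\<close> to the power \<open>(p\<^sup>n + 1) / 2\<close>.\<close>
lemma padic_int_square_if_res_1:
  assumes odd: "odd CARD('p::prime_card)" and 1: "padic_res (x :: 'p padic_int) 1 = 1"
  obtains y where "x = y ^ 2"
proof -
  let ?p = "int CARD('p)"
  define e where "e n = (CARD('p) ^ n + 1) div 2" for n :: nat
  have e: "2 * e n = CARD('p) ^ n + 1" for n
    using odd by (simp add: e_def)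
  have x1: "[padic_res x (Suc n) = 1] (mod ?p)" for n
    using padic_res_mod[of x 1 n] 1 CARD_gt_1[where 'p = 'p] by (simp add: cong_def)
  have ord: "[padic_res x k ^ (CARD('p) ^ n) = 1] (mod ?p ^ Suc n)" if "k > 0" for n k
    using power_cong_1_mod_prime_power[of "padic_res x k" ?p n] CARD_gt_1[where 'p = 'p] x1[of "k - 1"] that
    by simp
  define f where "f n = padic_res x n ^ e n mod ?p ^ n" for n
  have "f (Suc n) mod ?p ^ n = f n" for n
  proof (cases n)
    case (Suc m)
    \<comment> \<open>Consecutive exponents differ by a multiple of p^m with n = m + 1, and the
      p^m-th power of a residue congruent to 1 modulo p is 1 modulo p^n. This makes the approximate
      roots compatible.\<close>
    have "e (Suc n) = e n + CARD('p) ^ m * (CARD('p) * ((CARD('p) - 1) div 2))"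
    proof -
      have "2 * e (Suc n) = 2 * e n + CARD('p) ^ n * (CARD('p) - 1)"
        unfolding e by (simp add: algebra_simps)
      also have "CARD('p) - 1 = 2 * ((CARD('p) - 1) div 2)" using odd by simp
      finally have "2 * e (Suc n) = 2 * (e n + CARD('p) ^ m * (CARD('p) * ((CARD('p) - 1) div 2)))"
        unfolding Suc power_Suc by (simp only: distrib_left mult_ac)
      then show ?thesis by simp
    qed
    then have "f (Suc n) mod ?p ^ n =
      (padic_res x (Suc n) ^ e n * (padic_res x (Suc n) ^ CARD('p) ^ m) ^ (CARD('p) * ((CARD('p) - 1) div 2))) mod ?p ^ n"
      by (simp add: f_def mod_mod_cancel le_imp_power_dvd power_add power_mult)
    also have "\<dots> = (padic_res x (Suc n) ^ e n * 1 ^ (CARD('p) * ((CARD('p) - 1) div 2))) mod ?p ^ n"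
      using ord[of "Suc n" m] unfolding cong_def[symmetric] Suc by (intro cong_mult cong_pow) auto
    also have "\<dots> = padic_res x n ^ e n mod ?p ^ n"
      using padic_res_mod[of x n 1] by (metis mult.right_neutral power_mod power_one Suc_eq_plus1)
    finally show ?thesis by (simp add: f_def)
  qed (simp add: f_def)
  then obtain y :: "'p padic_int" where y: "\<And>n. padic_res y n = f n"
    using padic_int_exists by blast
  have "x = y * y"
  proof (rule padic_int_eqI)
    fix n
    show "padic_res x n = padic_res (y * y) n"
    proof (cases n)
      case (Suc m)
      have "padic_res (y * y) n = (padic_res x n ^ (2 * e n)) mod ?p ^ n"
        unfolding mult_2 by (simp add: padic_res_mult y f_def mod_simps power_add)
      also have "\<dots> = (padic_res x n * (padic_res x n ^ CARD('p) ^ m) ^ CARD('p)) mod ?p ^ n"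
        unfolding e by (simp add: Suc mult.commute flip: power_mult)
      also have "\<dots> = (padic_res x n * 1 ^ CARD('p)) mod ?p ^ n"
        using ord[of n m] unfolding cong_def[symmetric] Suc by (intro cong_mult cong_pow) auto
      finally show ?thesis by simp
    qed simp
  qed
  then show ?thesis using that by (simp add: power2_eq_square)
qed

section \<open>The field of p-adic numbers\<close>

abbreviation uniformizer :: "'p::prime_card padic"  (\<open>\<varpi>\<close>)
  where "\<varpi> \<equiv> of_nat CARD('p)"

definition padic_of :: "'p::prime_card padic_int \<Rightarrow> 'p padic"
  where "padic_of z = Fract z 1"

lemma padic_integers_eq: "padic_integers = range padic_of"
  by (simp add: padic_integers_def padic_of_def)

lemma padic_of_simps:
  "padic_of 0 = 0" "padic_of 1 = 1"
  "padic_of (x + y) = padic_of x + padic_of y"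
  "padic_of (x - y) = padic_of x - padic_of y"
  "padic_of (- x) = - padic_of x"
  "padic_of (x * y) = padic_of x * padic_of y"
  "padic_of (of_nat k) = of_nat k"
  by (simp_all add: padic_of_def Zero_fract_def One_fract_def of_nat_fract)

declare padic_of_simps(1,2) [simp]

lemma padic_of_power: "padic_of (x ^ k) = padic_of x ^ k"
  by (induction k) (simp_all add: padic_of_simps)

lemma padic_of_int: "padic_of (of_int k) = of_int k"
  by (cases k rule: int_cases2) (simp_all add: padic_of_simps)

lemma padic_of_eq_iff [simp]: "padic_of x = padic_of y \<longleftrightarrow> x = y"
  by (simp add: padic_of_def eq_fract)

lemma padic_of_eq_0_iff [simp]: "padic_of x = 0 \<longleftrightarrow> x = 0"
  by (simp add: padic_of_def eq_fract Zero_fract_def)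

lemma uniformizer_nonzero [simp]: "(\<varpi> :: 'p::prime_card padic) \<noteq> 0"
proof
  assume "(\<varpi> :: 'p padic) = 0"
  then have "(of_nat CARD('p) :: 'p padic_int) = 0"
    by (metis padic_of_eq_0_iff padic_of_simps(7))
  then have "int CARD('p) mod int CARD('p) ^ 2 = 0"
    by (metis padic_res_0 padic_res_of_nat)
  then show False
    using CARD_gt_1[where 'p = 'p] by (simp add: power2_eq_square mod_eq_0_iff_dvd)
qed

lemma padic_integersI [intro]: "padic_of z \<in> padic_integers"
  by (simp add: padic_integers_eq)

lemma padic_integersE:
  assumes "x \<in> padic_integers"
  obtains z where "x = padic_of z"
  using assms by (auto simp: padic_integers_eq)

lemma padic_integers_closed [simp, intro]:
  "0 \<in> padic_integers" "1 \<in> padic_integers" "of_nat k \<in> padic_integers" "of_int j \<in> padic_integers"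
  "x \<in> padic_integers \<Longrightarrow> y \<in> padic_integers \<Longrightarrow> x + y \<in> padic_integers"
  "x \<in> padic_integers \<Longrightarrow> y \<in> padic_integers \<Longrightarrow> x - y \<in> padic_integers"
  "x \<in> padic_integers \<Longrightarrow> y \<in> padic_integers \<Longrightarrow> x * y \<in> padic_integers"
  "x \<in> padic_integers \<Longrightarrow> - x \<in> padic_integers"
  "x \<in> padic_integers \<Longrightarrow> x ^ k \<in> padic_integers"
  unfolding padic_integers_eq image_iff
  by (metis padic_of_simps padic_of_int padic_of_power rangeI UNIV_I)+

lemma padic_idealI: "z \<in> padic_integers \<Longrightarrow> \<varpi> ^ n * z \<in> padic_ideal n"
  by (simp add: padic_ideal_def)

lemma padic_ideal_iff: "x \<in> padic_ideal n \<longleftrightarrow> x / \<varpi> ^ n \<in> padic_integers"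
proof
  assume "x / \<varpi> ^ n \<in> padic_integers"
  then have "\<varpi> ^ n * (x / \<varpi> ^ n) \<in> padic_ideal n" by (rule padic_idealI)
  then show "x \<in> padic_ideal n" by simp
qed (auto simp: padic_ideal_def)

lemma padic_ideal_closed [simp, intro]:
  "0 \<in> padic_ideal n"
  "x \<in> padic_ideal n \<Longrightarrow> y \<in> padic_ideal n \<Longrightarrow> x + y \<in> padic_ideal n"
  "x \<in> padic_ideal n \<Longrightarrow> y \<in> padic_ideal n \<Longrightarrow> x - y \<in> padic_ideal n"
  "x \<in> padic_ideal n \<Longrightarrow> - x \<in> padic_ideal n"
  "x \<in> padic_ideal n \<Longrightarrow> y \<in> padic_integers \<Longrightarrow> x * y \<in> padic_ideal n"
  "x \<in> padic_integers \<Longrightarrow> y \<in> padic_ideal n \<Longrightarrow> x * y \<in> padic_ideal n"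
  using padic_integers_closed(5-8)[of "x / \<varpi> ^ n"]
    padic_integers_closed(7)[of x "y / \<varpi> ^ n"]
  by (auto simp: padic_ideal_iff add_divide_distrib diff_divide_distrib)

lemma padic_ideal_0 [simp]: "padic_ideal 0 = padic_integers"
  by (auto simp: padic_ideal_iff)

lemma padic_ideal_antimono: "m \<le> n \<Longrightarrow> x \<in> padic_ideal n \<Longrightarrow> x \<in> padic_ideal m"
proof -
  assume "m \<le> n" "x \<in> padic_ideal n"
  then have "\<varpi> ^ (n - m) * (x / \<varpi> ^ n) \<in> padic_integers"
    unfolding padic_ideal_iff by blast
  also have "\<varpi> ^ (n - m) * (x / \<varpi> ^ n) = x / \<varpi> ^ m"
    using \<open>m \<le> n\<close> by (simp add: power_diff)
  finally show ?thesis by (simp add: padic_ideal_iff)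
qed

lemma padic_ideal_subset_integers: "x \<in> padic_ideal n \<Longrightarrow> x \<in> padic_integers"
  using padic_ideal_antimono[of 0 n x] by simp

lemma padic_of_in_ideal_iff: "padic_of z \<in> padic_ideal n \<longleftrightarrow> padic_res z n = 0"
proof -
  have "padic_of z \<in> padic_ideal n \<longleftrightarrow> (\<exists>y. padic_of z = padic_of (of_nat CARD('a) ^ n * y))"
    unfolding padic_ideal_def padic_integers_eq image_image padic_of_simps padic_of_power by auto
  also have "\<dots> \<longleftrightarrow> of_nat CARD('a) ^ n dvd z" by (auto simp: dvd_def)
  finally show ?thesis by (simp add: power_CARD_dvd_iff_res)
qed

lemma padic_units_iff: "x \<in> padic_units \<longleftrightarrow> (\<exists>u. x = padic_of u \<and> u dvd 1)"
proof
  assume "x \<in> padic_units"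
  then obtain u v where *: "x = padic_of u" "inverse x = padic_of v" "x \<noteq> 0"
    by (auto simp: padic_units_def padic_integers_eq)
  then have "padic_of (u * v) = padic_of 1"
    unfolding padic_of_simps by (metis right_inverse)
  then show "\<exists>u. x = padic_of u \<and> u dvd 1"
    using * by (metis dvd_triv_left padic_of_eq_iff)
next
  assume "\<exists>u. x = padic_of u \<and> u dvd 1"
  then obtain u v where x: "x = padic_of u" and "u * v = 1" by (metis dvdE)
  then have "padic_of u * padic_of v = 1" by (metis padic_of_simps(2,6))
  then have "x \<noteq> 0" "inverse x = padic_of v"
    unfolding x by (auto intro: inverse_unique)
  then show "x \<in> padic_units" unfolding padic_units_def x by auto
qed

lemma padic_units_in_integers: "u \<in> padic_units \<Longrightarrow> u \<in> padic_integers"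
  and padic_units_nonzero: "u \<in> padic_units \<Longrightarrow> u \<noteq> 0"
  and padic_units_inverse: "u \<in> padic_units \<Longrightarrow> inverse u \<in> padic_units"
  and padic_units_mult: "u \<in> padic_units \<Longrightarrow> v \<in> padic_units \<Longrightarrow> u * v \<in> padic_units"
  and padic_units_minus: "u \<in> padic_units \<Longrightarrow> - u \<in> padic_units"
  and padic_units_1: "1 \<in> padic_units"
  by (auto simp: padic_units_def)

lemma uniformizer_power_not_unit: "n > 0 \<Longrightarrow> \<varpi> ^ n \<notin> (padic_units :: 'p::prime_card padic set)"
proof
  assume n: "n > 0" and "\<varpi> ^ n \<in> (padic_units :: 'p padic set)"
  then obtain u :: "'p padic_int" where "\<varpi> ^ n = padic_of u" "padic_res u 1 \<noteq> 0"
    by (auto simp: padic_units_iff padic_int_unit_iff)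
  moreover have "\<varpi> ^ n = padic_of (of_nat CARD('p) ^ n :: 'p padic_int)"
    by (simp only: padic_of_power padic_of_simps)
  ultimately have "padic_res (of_nat CARD('p) ^ n :: 'p padic_int) 1 \<noteq> 0" by simp
  then show False using n by (simp add: padic_res_power_CARD)
qed

lemma padic_decomp:
  assumes "(x :: 'p::prime_card padic) \<noteq> 0"
  obtains k u where "x = \<varpi> powi k * u" "u \<in> padic_units"
proof -
  obtain a b where x: "x = Fract a b" "a \<noteq> 0" "b \<noteq> 0"
    using assms by (cases x rule: Fract_cases_nonzero) auto
  obtain m u where a: "a = of_nat CARD('p) ^ m * u" "u dvd 1" using padic_int_factor[OF x(2)] .
  obtain n v where b: "b = of_nat CARD('p) ^ n * v" "v dvd 1" using padic_int_factor[OF x(3)] .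
  have u: "padic_of u \<in> padic_units" "padic_of v \<in> padic_units"
    using a b padic_units_iff by blast+
  have "x = padic_of a / padic_of b" using x by (simp add: padic_of_def)
  also have "\<dots> = (\<varpi> ^ m * padic_of u) / (\<varpi> ^ n * padic_of v)"
    unfolding a b padic_of_simps padic_of_power ..
  also have "\<dots> = \<varpi> powi (int m - int n) * (padic_of u * inverse (padic_of v))"
    by (simp add: power_int_diff field_simps)
  finally show ?thesis using u that by (blast intro: padic_units_mult padic_units_inverse)
qed

lemma padic_ord_unique:
  assumes "\<varpi> powi k * u = \<varpi> powi l * v" and u: "u \<in> padic_units" "v \<in> padic_units"
  shows "k = l"
proof -
  have False if eq: "\<varpi> powi k * u = \<varpi> powi l * v" and "k < l" and u: "u \<in> padic_units" "v \<in> padic_units"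
    for k l and u v :: "'a padic"
  proof -
    have "u = \<varpi> powi (l - k) * v"
      using eq by (simp add: power_int_diff field_simps)
    then have "\<varpi> powi (l - k) = u * inverse v" using padic_units_nonzero[OF u(2)] by simp
    then have "\<varpi> ^ nat (l - k) \<in> (padic_units :: 'a padic set)"
      using u \<open>k < l\<close> by (auto simp: power_int_def intro: padic_units_mult padic_units_inverse)
    then show False using uniformizer_power_not_unit[where 'p = 'a, of "nat (l - k)"] \<open>k < l\<close> by simp
  qed
  from this[OF assms(1) _ u] this[OF assms(1)[symmetric] _ u(2,1)] show ?thesis
    by (meson linorder_neqE_linordered_idom)
qed

lemma padic_ord_eqI:
  assumes "x = \<varpi> powi k * u" "u \<in> padic_units"
  shows "padic_ord x = k"
  unfolding padic_ord_def using assms by (intro the_equality) (auto dest: padic_ord_unique)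

lemma padic_ord_decomp:
  assumes "x \<noteq> 0"
  shows "x * \<varpi> powi (- padic_ord x) \<in> padic_units"
proof -
  obtain k u where *: "x = \<varpi> powi k * u" "u \<in> padic_units" using padic_decomp[OF assms] .
  have "x * \<varpi> powi (- k) = u" unfolding *(1) by (simp add: power_int_minus)
  then show ?thesis using *(2) padic_ord_eqI[OF *] by metis
qed

lemma padic_ord_mult: "x \<noteq> 0 \<Longrightarrow> y \<noteq> 0 \<Longrightarrow> padic_ord (x * y) = padic_ord x + padic_ord y"
proof -
  assume "x \<noteq> 0" "y \<noteq> 0"
  obtain k u where x: "x = \<varpi> powi k * u" "u \<in> padic_units" using padic_decomp[OF \<open>x \<noteq> 0\<close>] .
  obtain l v where y: "y = \<varpi> powi l * v" "v \<in> padic_units" using padic_decomp[OF \<open>y \<noteq> 0\<close>] .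
  have "x * y = \<varpi> powi (k + l) * (u * v)" by (simp add: x y power_int_add)
  then have "padic_ord (x * y) = k + l"
    using x(2) y(2) by (blast intro: padic_ord_eqI padic_units_mult)
  then show ?thesis by (simp add: padic_ord_eqI[OF x] padic_ord_eqI[OF y])
qed

lemma padic_ord_unit [simp]: "u \<in> padic_units \<Longrightarrow> padic_ord u = 0"
  by (rule padic_ord_eqI[of _ _ u]) simp_all

lemma padic_ord_uniformizer [simp]: "padic_ord \<varpi> = 1"
  by (rule padic_ord_eqI[of _ _ 1]) (simp_all add: padic_units_1)

lemma padic_ord_1 [simp]: "padic_ord 1 = 0"
  by (simp add: padic_units_1)

lemma padic_ord_minus: "(x :: 'p::prime_card padic) \<noteq> 0 \<Longrightarrow> padic_ord (- x) = padic_ord x"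
proof -
  assume "x \<noteq> 0"
  have "(- 1 :: 'p padic) \<in> padic_units" by (intro padic_units_minus padic_units_1)
  then have "padic_ord (- 1 :: 'p padic) = 0" by (rule padic_ord_unit)
  then show ?thesis using padic_ord_mult[of "- 1" x] \<open>x \<noteq> 0\<close> by simp
qed

lemma padic_ord_inverse: "x \<noteq> 0 \<Longrightarrow> padic_ord (inverse x) = - padic_ord x"
  using padic_ord_mult[of x "inverse x"] by simp

lemma padic_ord_divide: "x \<noteq> 0 \<Longrightarrow> y \<noteq> 0 \<Longrightarrow> padic_ord (x / y) = padic_ord x - padic_ord y"
  by (simp add: divide_inverse padic_ord_mult padic_ord_inverse)

lemma padic_ord_power: "x \<noteq> 0 \<Longrightarrow> padic_ord (x ^ n) = int n * padic_ord x"
  by (induction n) (simp_all add: padic_ord_mult algebra_simps)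

lemma padic_integers_iff_ord: "x \<noteq> 0 \<Longrightarrow> x \<in> padic_integers \<longleftrightarrow> padic_ord x \<ge> 0"
proof
  assume "x \<noteq> 0" "padic_ord x \<ge> 0"
  then have "(x * \<varpi> powi (- padic_ord x)) * \<varpi> ^ nat (padic_ord x) \<in> padic_integers"
    using padic_ord_decomp padic_units_in_integers by blast
  moreover have "\<varpi> ^ nat (padic_ord x) = (\<varpi> :: 'a padic) powi padic_ord x"
    using \<open>padic_ord x \<ge> 0\<close> by (simp add: power_int_def)
  ultimately show "x \<in> padic_integers"
    by (simp add: power_int_minus mult.assoc)
next
  assume "x \<noteq> 0" "x \<in> padic_integers"
  then obtain z where z: "x = padic_of z" "z \<noteq> 0" by (auto elim: padic_integersE)
  obtain n u where u: "z = of_nat CARD('a) ^ n * u" "u dvd 1" using padic_int_factor[OF z(2)] .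
  have "x = \<varpi> powi int n * padic_of u"
    unfolding z u padic_of_simps padic_of_power power_int_of_nat ..
  then have "padic_ord x = int n" using u padic_units_iff padic_ord_eqI by blast
  then show "padic_ord x \<ge> 0" by simp
qed

lemma padic_ideal_iff_ord: "x \<noteq> 0 \<Longrightarrow> x \<in> padic_ideal n \<longleftrightarrow> padic_ord x \<ge> int n"
  by (simp add: padic_ideal_iff padic_integers_iff_ord padic_ord_divide padic_ord_power)

lemma padic_units_iff_ord: "x \<in> padic_units \<longleftrightarrow> x \<noteq> 0 \<and> padic_ord x = 0"
proof
  assume "x \<noteq> 0 \<and> padic_ord x = 0"
  then show "x \<in> padic_units"
    unfolding padic_units_def by (simp add: padic_integers_iff_ord padic_ord_inverse)
qed (simp add: padic_units_nonzero)

lemma padic_units_iff_ideal: "x \<in> padic_integers \<Longrightarrow> x \<in> padic_units \<longleftrightarrow> x \<notin> padic_ideal 1"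
  by (cases "x = 0") (auto simp: padic_units_iff_ord padic_ideal_iff_ord padic_integers_iff_ord)

lemma padic_units_add_ideal:
  assumes "x \<in> padic_units" "y \<in> padic_ideal 1"
  shows "x + y \<in> padic_units"
proof -
  have "x + y \<in> padic_ideal 1 \<Longrightarrow> x \<in> padic_ideal 1"
    using assms(2) padic_ideal_closed(3)[of "x + y" 1 y] by simp
  then show ?thesis
    using assms padic_units_iff_ideal padic_units_in_integers padic_ideal_subset_integers
    by (metis padic_integers_closed(5))
qed

subsection \<open>Residues and squares\<close>

lemma padic_residue_padic_of: "padic_residue (padic_of z) = padic_res z 1"
proof -
  have "padic_of z - of_int r \<in> padic_ideal 1 \<longleftrightarrow> (padic_res z 1 - r) mod int CARD('a) = 0" for r
    unfolding padic_of_int[symmetric] padic_of_simps(4)[symmetric] padic_of_in_ideal_iff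
    by (simp add: padic_res_diff padic_res_of_int mod_simps)
  then have *: "padic_of z - of_int r \<in> padic_ideal 1 \<longleftrightarrow> padic_res z 1 mod int CARD('a) = r mod int CARD('a)" for r
    by (simp add: mod_eq_dvd_iff mod_eq_0_iff_dvd)
  have "0 \<le> padic_res z 1" "padic_res z 1 < int CARD('a)"
    using padic_res_less[of z 1] by simp_all
  then show ?thesis
    unfolding padic_residue_def * by (intro the_equality) auto
qed

lemma padic_residue_bounds:
  assumes "x \<in> padic_integers"
  shows "0 \<le> padic_residue x" "padic_residue (x :: 'p::prime_card padic) < int CARD('p)"
  using assms padic_res_less[where 'p = 'p and n = 1] by (auto simp: padic_residue_padic_of elim!: padic_integersE)

lemma padic_residue_mult:
  "x \<in> padic_integers \<Longrightarrow> y \<in> padic_integers \<Longrightarrow>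
   padic_residue (x * y :: 'p::prime_card padic) = (padic_residue x * padic_residue y) mod int CARD('p)"
  by (elim padic_integersE) (simp add: padic_residue_padic_of padic_res_mult flip: padic_of_simps(6))

lemma padic_residue_add:
  "x \<in> padic_integers \<Longrightarrow> y \<in> padic_integers \<Longrightarrow>
   padic_residue (x + y :: 'p::prime_card padic) = (padic_residue x + padic_residue y) mod int CARD('p)"
  by (elim padic_integersE) (simp add: padic_residue_padic_of padic_res_add flip: padic_of_simps(3))

lemma padic_residue_of_int: "padic_residue (of_int k :: 'p::prime_card padic) = k mod int CARD('p)"
  by (simp add: padic_residue_padic_of padic_res_of_int flip: padic_of_int)

lemma padic_residue_1 [simp]: "padic_residue (1 :: 'p::prime_card padic) = 1"
  using padic_residue_of_int[where 'p = 'p, of 1] CARD_gt_1[where 'p = 'p] by simp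

lemma padic_residue_eq_0_iff: "x \<in> padic_integers \<Longrightarrow> padic_residue x = 0 \<longleftrightarrow> x \<in> padic_ideal 1"
  by (elim padic_integersE) (simp add: padic_residue_padic_of padic_of_in_ideal_iff)

lemma padic_residue_eq_iff:
  "x \<in> padic_integers \<Longrightarrow> y \<in> padic_integers \<Longrightarrow> padic_residue x = padic_residue y \<longleftrightarrow> x - y \<in> padic_ideal 1"
  by (elim padic_integersE)
    (simp add: padic_residue_padic_of padic_of_in_ideal_iff padic_res_diff mod_eq_0_iff_dvd
      mod_eq_dvd_iff[symmetric] padic_res_mod_same[of _ 1, simplified] flip: padic_of_simps(4))

lemma padic_unit_iff_residue: "x \<in> padic_integers \<Longrightarrow> x \<in> padic_units \<longleftrightarrow> padic_residue x \<noteq> 0"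
  by (simp add: padic_residue_eq_0_iff padic_units_iff_ideal)

lemma of_int_in_padic_units_iff: "(of_int k :: 'p::prime_card padic) \<in> padic_units \<longleftrightarrow> \<not> int CARD('p) dvd k"
  by (simp add: padic_unit_iff_residue padic_residue_of_int dvd_eq_mod_eq_0)

lemma padic_square_if_residue_1:
  assumes odd: "odd CARD('p::prime_card)" and "x \<in> padic_integers" "padic_residue (x :: 'p padic) = 1"
  obtains y where "x = y ^ 2"
proof -
  from assms obtain z where z: "x = padic_of z" "padic_res z 1 = 1"
    by (auto elim: padic_integersE simp: padic_residue_padic_of)
  obtain y where "z = y ^ 2" using padic_int_square_if_res_1[OF odd z(2)] .
  then have "x = padic_of y ^ 2" by (simp only: z padic_of_power)
  then show ?thesis using that by blast
qed

section \<open>Legendre symbols and a conic modulo p\<close>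

lemma int_dvd_abs_less_imp_0: "(p :: int) dvd x \<Longrightarrow> \<bar>x\<bar> < p \<Longrightarrow> x = 0"
  using dvd_imp_le_int[of x p] by linarith

lemma Legendre_mod: "Legendre (a mod p) p = Legendre a p"
  by (simp add: Legendre_def QuadRes_def cong_def)

lemma Legendre_eq_1_or_minus_1: "\<not> p dvd a \<Longrightarrow> Legendre a p = 1 \<or> Legendre a p = - 1"
  by (auto simp: Legendre_def cong_0_iff)

text \<open>Euler's criterion gives the congruence modulo p. Both sides lie in {-1, 0, 1}, so they
  differ by at most 2 < p and must agree.\<close>

lemma Legendre_mult:
  assumes "prime p" "2 < p"
  shows "Legendre (a * b) (int p) = Legendre a (int p) * Legendre b (int p)"
proof -
  have "[Legendre (a * b) p = a ^ ((p - 1) div 2) * b ^ ((p - 1) div 2)] (mod p)"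
    using euler_criterion[OF assms, of "a * b"] by (simp add: power_mult_distrib)
  also have "[a ^ ((p - 1) div 2) * b ^ ((p - 1) div 2) = Legendre a p * Legendre b p] (mod p)"
    by (intro cong_mult cong_sym[OF euler_criterion[OF assms]])
  finally have "int p dvd Legendre (a * b) p - Legendre a p * Legendre b p"
    unfolding cong_iff_dvd_diff .
  moreover have vals: "Legendre c p = - 1 \<or> Legendre c p = 0 \<or> Legendre c p = 1" for c
    by (metis Legendre_def)
  have "\<bar>Legendre (a * b) p - Legendre a p * Legendre b p\<bar> < int p"
    using assms(2) vals[of "a * b"] vals[of a] vals[of b] by (elim disjE) simp_all
  ultimately have "Legendre (a * b) p - Legendre a p * Legendre b p = 0"
    by (rule int_dvd_abs_less_imp_0)
  then show ?thesis by simp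
qed

text \<open>On the lower half of the residues x + y stays below p, so equal squares cannot come from
  opposite signs. This supplies the counts for the pigeonhole argument on conics.\<close>

lemma inj_on_square_mod_half:
  fixes p :: int
  assumes "prime p" "odd p" "\<not> p dvd u"
  shows "inj_on (\<lambda>x. (u * x ^ 2 + v) mod p) {0..(p - 1) div 2}"
proof (rule inj_onI)
  fix x y assume xy: "x \<in> {0..(p - 1) div 2}" "y \<in> {0..(p - 1) div 2}"
    "(u * x ^ 2 + v) mod p = (u * y ^ 2 + v) mod p"
  then have "p dvd u * ((x - y) * (x + y))"
    by (simp add: mod_eq_dvd_iff algebra_simps power2_eq_square)
  then have "p dvd x - y \<or> p dvd x + y"
    using assms prime_dvd_mult_iff by blast
  moreover have "\<bar>x - y\<bar> < p" "\<bar>x + y\<bar> < p" using xy assms prime_gt_1_int[of p] by auto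
  ultimately have "x - y = 0 \<or> x + y = 0" using int_dvd_abs_less_imp_0 by blast
  then show "x = y" using xy by auto
qed

text \<open>Pigeonhole: u x^2 and 1 - v y^2 each take (p + 1)/2 values modulo p, and two sets of
  that size must meet.\<close>

lemma conic_mod_prime:
  fixes p :: int
  assumes p: "prime p" "odd p" and uv: "\<not> p dvd u" "\<not> p dvd v"
  obtains x y where "[u * x ^ 2 + v * y ^ 2 = 1] (mod p)"
proof -
  define D where "D = {0..(p - 1) div 2}"
  define A where "A = (\<lambda>x. (u * x ^ 2 + 0) mod p) ` D"
  define B where "B = (\<lambda>y. ((- v) * y ^ 2 + 1) mod p) ` D"
  have "p > 1" using p prime_gt_1_int by blast
  have fin: "finite A" "finite B" by (simp_all add: A_def B_def D_def)
  have D: "int (card D) = (p - 1) div 2 + 1" using \<open>p > 1\<close> by (simp add: D_def)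
  have AB: "card A = card D" "card B = card D"
    unfolding A_def B_def
    using inj_on_square_mod_half[OF p uv(1), of 0] inj_on_square_mod_half[OF p, of "- v" 1] uv(2)
    by (simp_all only: card_image D_def dvd_minus_iff not_False_eq_True)
  have "A \<inter> B \<noteq> {}"
  proof
    assume "A \<inter> B = {}"
    then have "card (A \<union> B) = 2 * card D"
      using AB card_Un_disjoint[OF fin] by simp
    moreover have "A \<union> B \<subseteq> {0..<p}" unfolding A_def B_def using \<open>p > 1\<close> by auto
    then have "card (A \<union> B) \<le> nat p" using card_mono[of "{0..<p}" "A \<union> B"] by simp
    ultimately have "2 * int (card D) \<le> p" using \<open>p > 1\<close> by linarith
    then show False using D p(2) by presburger
  qed
  then obtain z where z: "z \<in> A" "z \<in> B" by blast
  from z(1) obtain x where x: "z = (u * x ^ 2 + 0) mod p" unfolding A_def by (rule imageE)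
  from z(2) obtain y where y: "z = ((- v) * y ^ 2 + 1) mod p" unfolding B_def by (rule imageE)
  from x y have "(u * x ^ 2 + 0) mod p = ((- v) * y ^ 2 + 1) mod p" by (rule trans[OF sym])
  then have "p dvd (u * x ^ 2 + 0) - ((- v) * y ^ 2 + 1)"
    by (rule mod_eq_dvd_iff[THEN iffD1])
  moreover have "(u * x ^ 2 + 0) - ((- v) * y ^ 2 + 1) = u * x ^ 2 + v * y ^ 2 - 1"
    by (simp add: algebra_simps)
  ultimately have "[u * x ^ 2 + v * y ^ 2 = 1] (mod p)"
    by (simp only: cong_iff_dvd_diff)
  then show ?thesis by (rule that)
qed

text \<open>The Legendre symbol of the unit part. Discarding the powers of p extends the symbol to
  all nonzero elements, with value 1 at p.\<close>

definition quad_char :: "'p::prime_card padic \<Rightarrow> int"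
  where "quad_char x = Legendre (padic_residue (x * \<varpi> powi (- padic_ord x))) (int CARD('p))"

lemma quad_char_cases: "x \<noteq> 0 \<Longrightarrow> quad_char x = 1 \<or> quad_char x = - 1"
proof -
  assume "x \<noteq> 0"
  then have u: "x * \<varpi> powi (- padic_ord x) \<in> padic_units" by (rule padic_ord_decomp)
  then have "padic_residue (x * \<varpi> powi (- padic_ord x)) \<noteq> 0"
    using padic_unit_iff_residue padic_units_in_integers by blast
  then have "\<not> int CARD('a) dvd padic_residue (x * \<varpi> powi (- padic_ord x))"
    using padic_residue_bounds[OF padic_units_in_integers[OF u]] zdvd_not_zless by fastforce
  then show ?thesis unfolding quad_char_def by (rule Legendre_eq_1_or_minus_1)
qed

lemma quad_char_self [simp]: "x \<noteq> 0 \<Longrightarrow> quad_char x * quad_char x = 1"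
  using quad_char_cases[of x] by auto

lemma quad_char_unit:
  "u \<in> padic_units \<Longrightarrow> quad_char (u :: 'p::prime_card padic) = Legendre (padic_residue u) (int CARD('p))"
  by (simp add: quad_char_def)

lemma quad_char_1 [simp]: "quad_char 1 = 1"
proof -
  have "QuadRes (int CARD('a)) 1" unfolding QuadRes_def by (rule exI[of _ 1]) simp
  then have "Legendre 1 (int CARD('a)) = 1"
    using CARD_gt_1[where 'p = 'a] by (simp add: Legendre_def cong_def)
  then show ?thesis by (simp add: quad_char_unit padic_units_1)
qed

lemma quad_char_uniformizer [simp]: "quad_char (\<varpi> :: 'p::prime_card padic) = 1"
  using quad_char_1[where 'a = 'p] unfolding quad_char_def by simp

locale odd_prime =
  fixes ty :: "'p::prime_card itself"
  assumes odd_CARD: "odd CARD('p)"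
begin

lemma CARD_gt_2: "2 < CARD('p)"
  using CARD_gt_1[where 'p = 'p] odd_CARD by (cases "CARD('p) = 2") auto

lemma quad_char_mult:
  assumes "(x :: 'p padic) \<noteq> 0" "y \<noteq> 0"
  shows "quad_char (x * y) = quad_char x * quad_char y"
proof -
  have u: "x * \<varpi> powi (- padic_ord x) \<in> padic_units" "y * \<varpi> powi (- padic_ord y) \<in> padic_units"
    using padic_ord_decomp[OF assms(1)] padic_ord_decomp[OF assms(2)] by simp_all
  have eq: "x * y * \<varpi> powi (- padic_ord (x * y)) = (x * \<varpi> powi (- padic_ord x)) * (y * \<varpi> powi (- padic_ord y))"
    using assms by (simp add: padic_ord_mult power_int_diff power_int_minus field_simps)
  then show ?thesis
    unfolding quad_char_def eq
    using u by (simp add: padic_units_in_integers padic_residue_mult Legendre_mod Legendre_mult prime_card CARD_gt_2)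
qed

lemma quad_char_square: "(x :: 'p padic) \<noteq> 0 \<Longrightarrow> quad_char (x ^ 2) = 1"
  by (simp add: power2_eq_square quad_char_mult)

text \<open>If r^2 matches \<open>u\<close> modulo p, then u / r^2 has residue 1 and therefore is a
  square; this is the only use of Hensel lifting needed for square classes.\<close>

lemma padic_unit_square_iff:
  assumes "(u :: 'p padic) \<in> padic_units"
  shows "quad_char u = 1 \<longleftrightarrow> (\<exists>y. u = y ^ 2)"
proof
  assume "quad_char u = 1"
  then obtain r where r: "[r ^ 2 = padic_residue u] (mod int CARD('p))" "\<not> int CARD('p) dvd padic_residue u"
    unfolding quad_char_unit[OF assms] by (auto simp: Legendre_def QuadRes_def cong_0_iff split: if_splits)
  then have "\<not> int CARD('p) dvd r ^ 2" using cong_dvd_iff by blast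
  then have ru: "(of_int r :: 'p padic) \<in> padic_units"
    unfolding of_int_in_padic_units_iff by (auto simp: power2_eq_square)
  then have inv: "inverse (of_int r :: 'p padic) \<in> padic_units" by (rule padic_units_inverse)
  have "u - of_int r ^ 2 \<in> padic_ideal 1"
    using r(1) padic_residue_bounds[OF padic_units_in_integers[OF assms]] assms
    by (subst padic_residue_eq_iff[symmetric])
      (simp_all add: padic_units_in_integers padic_residue_of_int cong_def flip: of_int_power)
  then have "(u - of_int r ^ 2) * inverse (of_int r) ^ 2 \<in> padic_ideal 1"
    using inv padic_units_in_integers by blast
  then have "u * inverse (of_int r) ^ 2 - 1 \<in> padic_ideal 1"
    using padic_units_nonzero[OF ru] by (simp add: algebra_simps power_inverse)
  moreover have "u * inverse (of_int r) ^ 2 \<in> padic_integers"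
    using assms inv padic_units_in_integers by blast
  ultimately have "padic_residue (u * inverse (of_int r) ^ 2) = 1"
    using padic_residue_eq_iff[of "u * inverse (of_int r) ^ 2" 1] by simp
  then obtain y where "u * inverse (of_int r) ^ 2 = y ^ 2"
    using padic_square_if_residue_1[OF odd_CARD \<open>u * inverse (of_int r) ^ 2 \<in> padic_integers\<close>] by blast
  then have "u = (y * of_int r) ^ 2"
    using padic_units_nonzero[OF ru] by (simp add: field_simps)
  then show "\<exists>y. u = y ^ 2" by blast
next
  assume "\<exists>y. u = y ^ 2"
  then show "quad_char u = 1"
    using quad_char_square padic_units_nonzero[OF assms] by auto
qed

end

section \<open>The Hilbert symbol\<close>

lemma hilbert_symbolI:
  "z ^ 2 = a * x ^ 2 + b * y ^ 2 \<Longrightarrow> (x, y, z) \<noteq> (0, 0, 0) \<Longrightarrow> hilbert_symbol a b = 1"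
  unfolding hilbert_symbol_def by auto

lemma hilbert_symbolE:
  assumes "hilbert_symbol a b = 1"
  obtains x y z where "z ^ 2 = a * x ^ 2 + b * y ^ 2" "(x, y, z) \<noteq> (0, 0, 0)"
  using assms unfolding hilbert_symbol_def by (metis neg_equal_iff_equal one_neq_neg_one)

lemma hilbert_symbol_eqI:
  "(hilbert_symbol a b = 1 \<longleftrightarrow> hilbert_symbol c d = 1) \<Longrightarrow> hilbert_symbol a b = hilbert_symbol c d"
  using hilbert_symbol_cases by metis

lemma hilbert_symbol_commute: "hilbert_symbol a b = hilbert_symbol b a"
proof -
  have "hilbert_symbol b a = 1" if "hilbert_symbol a b = 1" for a b :: "'a padic"
  proof -
    from that obtain x y z where "z ^ 2 = a * x ^ 2 + b * y ^ 2" "(x, y, z) \<noteq> (0, 0, 0)"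
      by (rule hilbert_symbolE)
    then show ?thesis by (intro hilbert_symbolI[of z b y a x]) auto
  qed
  then show ?thesis by (blast intro: hilbert_symbol_eqI)
qed

lemma hilbert_symbol_square_mult:
  assumes "c \<noteq> 0"
  shows "hilbert_symbol (c ^ 2 * a) b = hilbert_symbol a b"
proof (rule hilbert_symbol_eqI, standard)
  assume "hilbert_symbol (c ^ 2 * a) b = 1"
  then obtain x y z where "z ^ 2 = c ^ 2 * a * x ^ 2 + b * y ^ 2" "(x, y, z) \<noteq> (0, 0, 0)"
    by (rule hilbert_symbolE)
  then show "hilbert_symbol a b = 1"
    using assms by (intro hilbert_symbolI[of z a "c * x" b y]) (auto simp: power_mult_distrib)
next
  assume "hilbert_symbol a b = 1"
  then obtain x y z where "z ^ 2 = a * x ^ 2 + b * y ^ 2" "(x, y, z) \<noteq> (0, 0, 0)"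
    by (rule hilbert_symbolE)
  then show "hilbert_symbol (c ^ 2 * a) b = 1"
    using assms by (intro hilbert_symbolI[of z _ "x / c" b y]) (auto simp: power_divide)
qed

text \<open>Dividing z^2 = a x^2 - a b y^2 by a and moving the y-term across exchanges the roles of
  x and z. The identity thus holds before bilinearity is known.\<close>

lemma hilbert_symbol_neg_mult:
  assumes "a \<noteq> 0"
  shows "hilbert_symbol a (- (a * b)) = hilbert_symbol a b"
proof (rule hilbert_symbol_eqI, standard)
  assume "hilbert_symbol a (- (a * b)) = 1"
  then obtain x y z where "z ^ 2 = a * x ^ 2 + - (a * b) * y ^ 2" "(x, y, z) \<noteq> (0, 0, 0)"
    by (rule hilbert_symbolE)
  then show "hilbert_symbol a b = 1"
    using assms by (intro hilbert_symbolI[of x a "z / a" b y]) (auto simp: field_simps power2_eq_square)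
next
  assume "hilbert_symbol a b = 1"
  then obtain x y z where "z ^ 2 = a * x ^ 2 + b * y ^ 2" "(x, y, z) \<noteq> (0, 0, 0)"
    by (rule hilbert_symbolE)
  then show "hilbert_symbol a (- (a * b)) = 1"
    using assms by (intro hilbert_symbolI[of "a * x" a z _ y]) (auto simp: algebra_simps power2_eq_square)
qed

context odd_prime
begin

text \<open>A solution of u x^2 + v y^2 = 1 modulo p lifts, since a p-adic integer of residue 1 is a
  square; x and y themselves stay unchanged.\<close>

lemma hilbert_symbol_units:
  assumes u: "(u :: 'p padic) \<in> padic_units" "v \<in> padic_units"
  shows "hilbert_symbol u v = 1"
proof -
  note int = u[THEN padic_units_in_integers]
  have nd: "\<not> int CARD('p) dvd padic_residue u" "\<not> int CARD('p) dvd padic_residue v"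
    using u int padic_unit_iff_residue padic_residue_bounds zdvd_not_zless
    by (metis order_le_less)+
  obtain x y where xy: "[padic_residue u * x ^ 2 + padic_residue v * y ^ 2 = 1] (mod int CARD('p))"
    using conic_mod_prime[OF prime_int_CARD[where 'p = 'p] _ nd] odd_CARD by auto
  let ?w = "u * of_int (x ^ 2) + v * of_int (y ^ 2)"
  have "padic_residue ?w = 1"
    using xy CARD_gt_1[where 'p = 'p] int
    by (simp only: padic_residue_add padic_residue_mult padic_integers_closed padic_residue_of_int)
      (simp add: cong_def mod_simps)
  moreover have "?w \<in> padic_integers" using int by blast
  ultimately obtain z where z: "?w = z ^ 2" using padic_square_if_residue_1[OF odd_CARD] by blast
  then have "z \<noteq> 0" using \<open>padic_residue ?w = 1\<close> padic_residue_of_int[where 'p = 'p, of 0] by auto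
  then show ?thesis using z by (intro hilbert_symbolI[of z u "of_int x" v "of_int y"]) auto
qed

text \<open>For a non-square unit \<open>u\<close> the extension by \<open>\<surd>u\<close> is unramified, so norms have even order.\<close>
lemma nonsquare_norm_even_ord:
  assumes u: "(u :: 'p padic) \<in> padic_units" "quad_char u \<noteq> 1" and "(x, z) \<noteq> (0, 0)"
  shows "z ^ 2 - u * x ^ 2 \<noteq> 0 \<and> even (padic_ord (z ^ 2 - u * x ^ 2))"
proof (cases "x = 0")
  case True
  then show ?thesis using assms(3) by (simp add: padic_ord_power)
next
  case False
  define t where "t = z / x"
  have nsq: "t ^ 2 \<noteq> u" for t
  proof
    assume "t ^ 2 = u"
    then have "\<exists>y. u = y ^ 2" by (intro exI[of _ t]) (rule sym)
    then show False using u(2) unfolding padic_unit_square_iff[OF u(1)] by contradiction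
  qed
  \<comment> \<open>For integral t a non-unit t^2 - u would make the residue of u a nonzero square.
    For non-integral t the term t^2 dominates and the order is twice that of t.\<close>
  have "even (padic_ord (t ^ 2 - u))"
  proof (cases "t \<in> padic_integers")
    case True
    note ui = padic_units_in_integers[OF u(1)]
    from True have ti: "t ^ 2 \<in> padic_integers" by (rule padic_integers_closed)
    have "t ^ 2 - u \<in> padic_units"
    proof (rule ccontr)
      assume "t ^ 2 - u \<notin> padic_units"
      then have "t ^ 2 - u \<in> padic_ideal 1"
        using padic_units_iff_ideal[OF padic_integers_closed(6)[OF ti ui]] by simp
      then have eq: "padic_residue (t ^ 2) = padic_residue u"
        using padic_residue_eq_iff[OF ti ui] by simp
      then have tu: "t ^ 2 \<in> padic_units"
        using u(1) padic_unit_iff_residue[OF ti] padic_unit_iff_residue[OF ui] by simp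
      then have "quad_char u = quad_char (t ^ 2)" using u eq by (simp add: quad_char_unit)
      also have "\<dots> = 1" using padic_units_nonzero[OF tu] by (intro quad_char_square) auto
      finally show False using u by simp
    qed
    then show ?thesis by simp
  next
    case False
    then have t0: "t \<noteq> 0" by (metis padic_integers_closed(1))
    then have t: "t \<noteq> 0" "padic_ord t < 0" using padic_integers_iff_ord[OF t0] False by simp_all
    have "1 + - (u / t ^ 2) \<in> padic_units"
    proof (intro padic_units_add_ideal padic_units_1 padic_ideal_closed(4))
      show "u / t ^ 2 \<in> padic_ideal 1"
        using u t by (simp add: padic_ideal_iff_ord padic_units_nonzero padic_ord_divide padic_ord_power)
    qed
    moreover have "t ^ 2 - u = t ^ 2 * (1 + - (u / t ^ 2))" using t by (simp add: field_simps)
    ultimately show ?thesis using t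
      by (metis padic_ord_mult padic_units_nonzero padic_ord_unit padic_ord_power add_0_right
          even_mult_iff even_numeral of_nat_numeral power_not_zero)
  qed
  moreover have "z ^ 2 - u * x ^ 2 = x ^ 2 * (t ^ 2 - u)"
    using False by (simp add: t_def field_simps)
  ultimately show ?thesis using False nsq[of t] by (simp add: padic_ord_mult padic_ord_power)
qed

text \<open>If u is a square, y = 0 gives a solution. Otherwise z^2 - u x^2 has even order whereas p
  v y^2 has odd order.\<close>

lemma hilbert_symbol_unit_uniformizer:
  assumes u: "(u :: 'p padic) \<in> padic_units" and v: "v \<in> padic_units"
  shows "hilbert_symbol u (\<varpi> * v) = quad_char u"
proof (cases "quad_char u = 1")
  case True
  then obtain y where "u = y ^ 2" using padic_unit_square_iff[OF u] by metis
  then have "hilbert_symbol u (\<varpi> * v) = 1"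
    by (intro hilbert_symbolI[of y _ 1 _ 0]) auto
  then show ?thesis using True by simp
next
  case False
  have "hilbert_symbol u (\<varpi> * v) \<noteq> 1"
  proof
    assume "hilbert_symbol u (\<varpi> * v) = 1"
    then obtain x y z where eq: "z ^ 2 = u * x ^ 2 + (\<varpi> * v) * y ^ 2" and xyz: "(x, y, z) \<noteq> (0, 0, 0)"
      by (rule hilbert_symbolE)
    then have eq': "z ^ 2 - u * x ^ 2 = (\<varpi> * v) * y ^ 2" by simp
    show False
    proof (cases "(x, z) = (0, 0)")
      case True
      then show ?thesis using eq xyz padic_units_nonzero[OF v] by simp
    next
      case F: False
      note n = nonsquare_norm_even_ord[OF u False F, unfolded eq']
      then have "padic_ord (\<varpi> * v * y ^ 2) = 1 + 2 * padic_ord y"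
        using v by (simp add: padic_ord_mult padic_ord_power padic_units_nonzero)
      then show False using n by simp
    qed
  qed
  then show ?thesis
    using False quad_char_cases[OF padic_units_nonzero[OF u]] hilbert_symbol_cases[of u "\<varpi> * v"] by auto
qed

end

context odd_prime
begin

text \<open>The symbol depends only on square classes, so this reduces its computation to the
  entries u and p u with u a unit.\<close>

lemma padic_square_class:
  assumes "(a :: 'p padic) \<noteq> 0"
  obtains c u where "c \<noteq> 0" "u \<in> padic_units" "quad_char a = quad_char u"
    "a = c ^ 2 * (if odd (padic_ord a) then \<varpi> * u else u)"
proof -
  let ?k = "padic_ord a"
  define u where "u = a * \<varpi> powi (- ?k)"
  define c :: "'p padic" where "c = \<varpi> powi (?k div 2)"
  have u: "u \<in> padic_units" unfolding u_def using padic_ord_decomp[OF assms] .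
  have q: "quad_char a = quad_char u"
    unfolding quad_char_unit[OF u] by (simp add: quad_char_def u_def)
  have e1: "a = \<varpi> powi ?k * u" by (simp add: u_def power_int_minus)
  have e2: "\<varpi> powi ?k = c ^ 2 * (if odd ?k then \<varpi> else 1)"
  proof -
    have c2: "c ^ 2 = \<varpi> powi (?k div 2 + ?k div 2)"
      unfolding c_def power2_eq_square by (rule power_int_add[symmetric]) simp
    show ?thesis
    proof (cases "odd ?k")
      case True
      then have "?k = ?k div 2 + ?k div 2 + 1" by presburger
      then have "\<varpi> powi ?k = (\<varpi> :: 'p padic) powi (?k div 2 + ?k div 2 + 1)" by (rule arg_cong)
      also have "\<dots> = c ^ 2 * \<varpi>"
        unfolding c2 by (rule power_int_add_1) simp
      finally show ?thesis using True by (simp only: if_True not_False_eq_True)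
    next
      case False
      then have "?k = ?k div 2 + ?k div 2" by presburger
      then have "\<varpi> powi ?k = (\<varpi> :: 'p padic) powi (?k div 2 + ?k div 2)" by (rule arg_cong)
      also have "\<dots> = c ^ 2 * 1" by (simp only: c2 mult_1_right)
      finally show ?thesis using False by (simp only: if_False)
    qed
  qed
  have "a = c ^ 2 * (if odd ?k then \<varpi> else 1) * u" using e1 unfolding e2 .
  then have e3: "a = c ^ 2 * (if odd ?k then \<varpi> * u else u)" by (rule trans) simp
  have "c \<noteq> 0" by (simp add: c_def)
  then show ?thesis using u q e3 by (rule that)
qed

text \<open>Up to squares each entry is a unit or p times a unit. When both orders are odd, (a, b) =
  (a, -ab) replaces the second entry by one of even order, which is where the factor at -1 comes
  from.\<close>

lemma hilbert_symbol_tame: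
  assumes "(a :: 'p padic) \<noteq> 0" "b \<noteq> 0"
  shows "hilbert_symbol a b =
    (if odd (padic_ord b) then quad_char a else 1) * (if odd (padic_ord a) then quad_char b else 1) *
    (if odd (padic_ord a) \<and> odd (padic_ord b) then quad_char (- 1 :: 'p padic) else 1)"
proof -
  obtain c u where a: "c \<noteq> 0" "u \<in> padic_units" "quad_char a = quad_char u"
    "a = c ^ 2 * (if odd (padic_ord a) then \<varpi> * u else u)" using padic_square_class[OF assms(1)] .
  obtain d v where b: "d \<noteq> 0" "v \<in> padic_units" "quad_char b = quad_char v"
    "b = d ^ 2 * (if odd (padic_ord b) then \<varpi> * v else v)" using padic_square_class[OF assms(2)] .
  let ?a = "if odd (padic_ord a) then \<varpi> * u else u" and ?b = "if odd (padic_ord b) then \<varpi> * v else v"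
  have "hilbert_symbol a b = hilbert_symbol ?a ?b"
  proof -
    have "hilbert_symbol a b = hilbert_symbol (c ^ 2 * ?a) (d ^ 2 * ?b)"
      by (rule arg_cong2[OF a(4) b(4)])
    also have "\<dots> = hilbert_symbol ?a (d ^ 2 * ?b)" by (rule hilbert_symbol_square_mult[OF a(1)])
    also have "\<dots> = hilbert_symbol (d ^ 2 * ?b) ?a" by (rule hilbert_symbol_commute)
    also have "\<dots> = hilbert_symbol ?b ?a" by (rule hilbert_symbol_square_mult[OF b(1)])
    also have "\<dots> = hilbert_symbol ?a ?b" by (rule hilbert_symbol_commute)
    finally show ?thesis .
  qed
  moreover have "hilbert_symbol (\<varpi> * u) (\<varpi> * v) = quad_char (- (u * v))"
  proof -
    have "hilbert_symbol (\<varpi> * u) (\<varpi> * v) = hilbert_symbol (\<varpi> * u) (\<varpi> ^ 2 * (- (u * v)))"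
      using hilbert_symbol_neg_mult[of "\<varpi> * u" "\<varpi> * v"] a(2) b(2)
      by (simp add: padic_units_nonzero power2_eq_square mult_ac)
    also have "\<dots> = hilbert_symbol (- (u * v)) (\<varpi> * u)"
      using hilbert_symbol_square_mult[of \<varpi> "- (u * v)" "\<varpi> * u"]
        hilbert_symbol_commute[of "\<varpi> * u" "\<varpi> ^ 2 * (- (u * v))"] by simp
    also have "\<dots> = quad_char (- (u * v))"
      using a(2) b(2) by (intro hilbert_symbol_unit_uniformizer padic_units_minus padic_units_mult)
    finally show ?thesis .
  qed
  moreover have "quad_char (- (u * v)) = quad_char (- 1 :: 'p padic) * (quad_char u * quad_char v)"
    using quad_char_mult[of "- 1" "u * v"] a(2) b(2) by (simp add: quad_char_mult padic_units_nonzero)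
  ultimately show ?thesis
    using hilbert_symbol_units[OF a(2) b(2)] hilbert_symbol_unit_uniformizer[OF a(2) b(2)]
      hilbert_symbol_unit_uniformizer[OF b(2) a(2)] hilbert_symbol_commute[of "\<varpi> * u" v] a(3) b(3)
    by simp
qed

text \<open>Solvability of the conic does not show bilinearity; it is read off from the tame
  formula, which involves only multiplicative characters and parities of orders.\<close>

lemma hilbert_symbol_mult_right:
  assumes "(a :: 'p padic) \<noteq> 0" "b \<noteq> 0" "c \<noteq> 0"
  shows "hilbert_symbol a (b * c) = hilbert_symbol a b * hilbert_symbol a c"
proof -
  have "quad_char (- 1 :: 'p padic) = 1 \<or> quad_char (- 1 :: 'p padic) = - 1"
    by (rule quad_char_cases) simp
  then show ?thesis
    using quad_char_cases[OF assms(1)] assms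
    by (elim disjE) (simp_all add: hilbert_symbol_tame padic_ord_mult quad_char_mult)
qed

lemma hilbert_symbol_mult_left:
  assumes "(a :: 'p padic) \<noteq> 0" "b \<noteq> 0" "c \<noteq> 0"
  shows "hilbert_symbol (b * c) a = hilbert_symbol b a * hilbert_symbol c a"
  using hilbert_symbol_mult_right[OF assms] by (simp add: hilbert_symbol_commute)

end

section \<open>The Kubota cocycle\<close>

definition mat2 :: "'a::zero \<Rightarrow> 'a \<Rightarrow> 'a \<Rightarrow> 'a \<Rightarrow> 'a ^ 2 ^ 2"
  where "mat2 a b c d = vector [vector [a, b], vector [c, d]]"

lemma mat2_nth [simp]:
  "mat2 a b c d $ 1 $ 1 = a" "mat2 a b c d $ 1 $ 2 = b" "mat2 a b c d $ 2 $ 1 = c" "mat2 a b c d $ 2 $ 2 = d"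
  by (simp_all add: mat2_def)

lemma mat2_eq_iff: "A = B \<longleftrightarrow> A $ 1 $ 1 = B $ 1 $ 1 \<and> A $ 1 $ 2 = B $ 1 $ 2 \<and>
    A $ 2 $ 1 = B $ 2 $ 1 \<and> A $ 2 $ 2 = (B :: 'a ^ 2 ^ 2) $ 2 $ 2"
  by (auto simp: vec_eq_iff forall_2)

lemma matrix_mult_nth_2 [simp]:
  "(A ** B) $ i $ j = A $ i $ 1 * B $ 1 $ j + A $ i $ 2 * (B :: 'a::comm_ring_1 ^ 2 ^ 2) $ 2 $ j"
  by (simp add: matrix_matrix_mult_def sum_2)

lemma mat_1_nth_2 [simp]:
  "(mat 1 :: 'a::comm_ring_1 ^ 2 ^ 2) $ 1 $ 1 = 1" "(mat 1 :: 'a ^ 2 ^ 2) $ 1 $ 2 = 0"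
  "(mat 1 :: 'a ^ 2 ^ 2) $ 2 $ 1 = 0" "(mat 1 :: 'a ^ 2 ^ 2) $ 2 $ 2 = 1"
  by (simp_all add: mat_def)

lemma det_mat2 [simp]: "det (mat2 a b c d) = a * d - b * (c :: 'a::comm_ring_1)"
  by (simp add: det_2)

lemma kubota_tau_nonzero: "det A = 1 \<Longrightarrow> kubota_tau A \<noteq> 0"
  by (auto simp: kubota_tau_def det_2)

lemma kubota_s_self [simp]: "kubota_s g * kubota_s g = 1"
  using kubota_s_cases[of g] by auto

lemma hilbert_symbol_self [simp]: "hilbert_symbol a b * hilbert_symbol a b = 1"
  "hilbert_symbol a b * (hilbert_symbol a b * j) = j"
  using hilbert_symbol_cases[of a b] by auto

lemma hilbert_symbol_1 [simp]: "hilbert_symbol 1 b = 1" "hilbert_symbol b 1 = 1"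
proof -
  show "hilbert_symbol 1 b = 1" by (rule hilbert_symbolI[of 1 _ 1 _ 0]) auto
  then show "hilbert_symbol b 1 = 1" by (simp add: hilbert_symbol_commute[of b])
qed

lemma hilbert_symbol_square [simp]: "c \<noteq> 0 \<Longrightarrow> hilbert_symbol (c * c) b = 1"
  "c \<noteq> 0 \<Longrightarrow> hilbert_symbol b (c * c) = 1"
  using hilbert_symbol_square_mult[of c 1 b] hilbert_symbol_commute[of b "c * c"]
  by (simp_all add: power2_eq_square)

lemma hilbert_symbol_square_mult_eq:
  "c \<noteq> 0 \<Longrightarrow> a' = c ^ 2 * a \<Longrightarrow> hilbert_symbol a' b = hilbert_symbol a b"
  using hilbert_symbol_square_mult by blast

lemma hilbert_symbol_neg_self: "x \<noteq> 0 \<Longrightarrow> hilbert_symbol x (- x) = 1"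
  using hilbert_symbol_neg_mult[of x 1] by simp

context odd_prime
begin

lemma hilbert_symbol_diag: "(x :: 'p padic) \<noteq> 0 \<Longrightarrow> hilbert_symbol x x = hilbert_symbol x (- 1)"
proof -
  assume "x \<noteq> 0"
  then have "hilbert_symbol x (- x) = hilbert_symbol x (- 1) * hilbert_symbol x x"
    using hilbert_symbol_mult_right[of x "- 1" x] by simp
  then show ?thesis
    using hilbert_symbol_neg_self[OF \<open>x \<noteq> 0\<close>] hilbert_symbol_cases[of x x] by auto
qed

lemma hilbert_symbol_minus_right:
  "(x :: 'p padic) \<noteq> 0 \<Longrightarrow> y \<noteq> 0 \<Longrightarrow> hilbert_symbol x (- y) = hilbert_symbol x (- 1) * hilbert_symbol x y"
  using hilbert_symbol_mult_right[of x "- 1" y] by simp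

lemmas hilbert_expand = hilbert_symbol_mult_right hilbert_symbol_mult_left hilbert_symbol_diag
  mult.commute mult.left_commute hilbert_symbol_commute

lemma sign_eq_iff_mult_1: "(x = 1 \<or> x = - 1) \<Longrightarrow> (y = 1 \<or> y = - 1) \<Longrightarrow> x = y \<longleftrightarrow> x * y = (1 :: int)"
  by auto

text \<open>Division by P gives 1 = Q/P + m/P, so the symbol of the two summands is 1. Clearing
  squares turns it into (m P, Q P) = 1, and bilinearity with (P, P) = (P, -1) gives the stated
  form.\<close>

lemma steinberg_sum:
  assumes "P = Q + m" "(P :: 'p padic) \<noteq> 0" "Q \<noteq> 0" "m \<noteq> 0"
  shows "hilbert_symbol P (- (m * Q)) * hilbert_symbol Q m = 1"
proof -
  have "hilbert_symbol (Q / P) (m / P) = 1"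
    using assms by (intro hilbert_symbolI[of 1 _ 1 _ 1]) (auto simp flip: add_divide_distrib)
  moreover have "hilbert_symbol (Q / P) (m / P) = hilbert_symbol (Q * P) (m / P)"
    using assms(2) by (intro hilbert_symbol_square_mult_eq[of "inverse P"]) (auto simp: field_simps power2_eq_square)
  moreover have "hilbert_symbol (m / P) (Q * P) = hilbert_symbol (m * P) (Q * P)"
    using assms(2) by (intro hilbert_symbol_square_mult_eq[of "inverse P"]) (auto simp: field_simps power2_eq_square)
  ultimately have "hilbert_symbol (m * P) (Q * P) = 1" by (metis hilbert_symbol_commute)
  then show ?thesis
    using assms(2-) hilbert_symbol_minus_right[of P "m * Q"] by (simp add: hilbert_expand)
qed

text \<open>The degenerate counterparts of \<open>steinberg_sum\<close>: when a lower left entry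
  vanishes, \<open>kubota_tau\<close> falls back on the diagonal, the additive relation is lost, and
  one of these equalities takes its place.\<close>

lemma steinberg_eq:
  assumes "(P :: 'p padic) \<noteq> 0" "Q \<noteq> 0" "m \<noteq> 0" "c \<noteq> 0"
  shows "m = c ^ 2 * P \<Longrightarrow> hilbert_symbol P (- (m * Q)) * hilbert_symbol Q m = 1"
    and "P = Q \<Longrightarrow> hilbert_symbol P (- (m * Q)) * hilbert_symbol Q m = 1"
    and "m = - Q \<Longrightarrow> hilbert_symbol P (- (m * Q)) * hilbert_symbol Q m = 1"
proof -
  have neg: "hilbert_symbol X (- (X * Y)) = hilbert_symbol X Y" if "X \<noteq> 0" for X Y :: "'p padic"
    using hilbert_symbol_neg_mult[OF that] .
  have sq: "hilbert_symbol X (c ^ 2 * Y) = hilbert_symbol X Y" for X Y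
    using hilbert_symbol_square_mult[OF assms(4), of Y X] by (simp add: hilbert_symbol_commute)
  { assume m: "m = c ^ 2 * P"
    have "hilbert_symbol P (- (m * Q)) = hilbert_symbol P (c ^ 2 * (- (P * Q)))" by (simp add: m mult_ac)
    then show "hilbert_symbol P (- (m * Q)) * hilbert_symbol Q m = 1"
      unfolding sq neg[OF assms(1)] by (simp add: m sq hilbert_symbol_commute[of Q P])
  }
  { assume "P = Q"
    then show "hilbert_symbol P (- (m * Q)) * hilbert_symbol Q m = 1"
      using neg[OF assms(2), of m] by (simp add: mult.commute)
  }
  { assume "m = - Q"
    then show "hilbert_symbol P (- (m * Q)) * hilbert_symbol Q m = 1"
      using assms hilbert_symbol_neg_self by simp
  }
qed

text \<open>Here a, b, c stand for \<tau> of g, h, k, while x, y, z stand for \<tau> of gh, hk, ghk.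
  Expanding the product of the two sides leaves one relation between xy, ac and bz; since both sides
  are signs, product 1 means equality.\<close>

lemma cocycle_from_steinberg:
  assumes nz: "(a :: 'p padic) \<noteq> 0" "b \<noteq> 0" "c \<noteq> 0" "x \<noteq> 0" "y \<noteq> 0" "z \<noteq> 0"
    and st: "hilbert_symbol (x * y) (- ((b * z) * (a * c))) * hilbert_symbol (a * c) (b * z) = 1"
  shows "hilbert_symbol (x * a) (x * b) * hilbert_symbol (z * x) (z * c) =
    hilbert_symbol (z * a) (z * y) * hilbert_symbol (y * b) (y * c)" (is "?L = ?R")
proof -
  have "?L * ?R = hilbert_symbol (x * y) (- ((b * z) * (a * c))) * hilbert_symbol (a * c) (b * z)"
    using nz hilbert_symbol_minus_right[of "x * y" "(b * z) * (a * c)"]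
    by (simp add: hilbert_expand)
  moreover have "?L = 1 \<or> ?L = - 1" "?R = 1 \<or> ?R = - 1"
    by (intro sign_mult_cases hilbert_symbol_cases)+
  ultimately show ?thesis
    using st sign_eq_iff_mult_1 by metis
qed

text \<open>With \<open>c(g)\<close> the lower left entry, the Pluecker relation
  \<open>c(gh) c(hk) = c(g) c(k) + c(h) c(ghk)\<close> turns the generic case into the Steinberg relation
  \<open>(u, 1 - u) = 1\<close>.\<close>
lemma kubota_cocycle_assoc:
  assumes det: "det (g :: 'p padic ^ 2 ^ 2) = 1" "det h = 1" "det k = 1"
  shows "kubota_cocycle g h * kubota_cocycle (g ** h) k =
    kubota_cocycle g (h ** k) * kubota_cocycle h k"
proof -
  let ?t = kubota_tau
  have nz: "?t g \<noteq> 0" "?t h \<noteq> 0" "?t k \<noteq> 0" "?t (g ** h) \<noteq> 0" "?t (h ** k) \<noteq> 0" "?t (g ** h ** k) \<noteq> 0"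
    using det by (simp_all add: kubota_tau_nonzero det_mul)
  note d = det[unfolded det_2]
  define P where "P = ?t (g ** h) * ?t (h ** k)"
  define Q where "Q = ?t g * ?t k"
  define m where "m = ?t h * ?t (g ** h ** k)"
  have PQm: "P \<noteq> 0" "Q \<noteq> 0" "m \<noteq> 0" using nz by (simp_all add: P_def Q_def m_def)
  \<comment> \<open>The factors \<open>kubota_s\<close> form a coboundary and cancel in the cocycle
    identity, so everything rests on this relation. The cases with a vanishing entry lead to
    \<open>steinberg_eq\<close>.\<close>
  have "hilbert_symbol P (- (m * Q)) * hilbert_symbol Q m = 1"
  proof (cases "g $ 2 $ 1 = 0")
    case True
    then have g: "g $ 2 $ 2 \<noteq> 0" using d(1) by auto
    have "?t (g ** A) = ?t g * ?t A" for A using True g by (simp add: kubota_tau_def)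
    then have "?t (g ** h) = ?t g * ?t h" "?t (g ** h ** k) = ?t g * ?t (h ** k)"
      by (simp_all flip: matrix_mul_assoc)
    then have "m = 1 ^ 2 * P" by (simp add: P_def m_def)
    then show ?thesis using steinberg_eq(1)[OF PQm, of 1] by simp
  next
    case g: False
    show ?thesis
    proof (cases "h $ 2 $ 1 = 0")
      case True
      then have h: "h $ 2 $ 2 \<noteq> 0" "h $ 1 $ 1 * h $ 2 $ 2 = 1" "h $ 1 $ 1 \<noteq> 0" using d(2) by auto
      have "?t (g ** h) * ?t h = ?t g" "?t (h ** k) = ?t h * ?t k"
        using True g h by (auto simp: kubota_tau_def mult.assoc)
      then have "P = Q" unfolding P_def Q_def by (metis mult.assoc)
      then show ?thesis by (rule steinberg_eq(2)[OF PQm one_neq_zero])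
    next
      case h: False
      show ?thesis
      proof (cases "k $ 2 $ 1 = 0")
        case True
        then have k: "k $ 2 $ 2 \<noteq> 0" "k $ 1 $ 1 * k $ 2 $ 2 = 1" "k $ 1 $ 1 \<noteq> 0" using d(3) by auto
        then have k1: "k $ 1 $ 1 = inverse (k $ 2 $ 2)" by (simp add: field_simps)
        have tk: "?t (A ** k) = (if A $ 2 $ 1 \<noteq> 0 then ?t A / ?t k else ?t A * ?t k)" for A
          using k(1,3) by (simp add: kubota_tau_def True k1 divide_inverse)
        have hk: "?t (h ** k) = ?t h / ?t k" using h by (simp add: tk)
        have "?t (g ** h ** k) = ?t (g ** h) / ?t k \<or> ?t (g ** h ** k) = ?t (g ** h) * ?t k"
          unfolding tk[of "g ** h"] by (simp del: matrix_mult_nth_2)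
        then show ?thesis
        proof
          assume "?t (g ** h ** k) = ?t (g ** h) / ?t k"
          then have "m = 1 ^ 2 * P" by (simp add: P_def m_def hk)
          then show ?thesis using steinberg_eq(1)[OF PQm, of 1] by simp
        next
          assume "?t (g ** h ** k) = ?t (g ** h) * ?t k"
          then have "m = ?t k ^ 2 * P" using nz by (simp add: P_def m_def hk power2_eq_square)
          then show ?thesis using steinberg_eq(1)[OF PQm nz(3)] by simp
        qed
      next
        case k: False
        define x y z where xyz: "x = (g ** h) $ 2 $ 1" "y = (h ** k) $ 2 $ 1" "z = (g ** h ** k) $ 2 $ 1"
        have "x * y - h $ 2 $ 1 * z =
            g $ 2 $ 1 * k $ 2 $ 1 * (h $ 1 $ 1 * h $ 2 $ 2 - h $ 1 $ 2 * h $ 2 $ 1)"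
          by (simp add: xyz algebra_simps)
        then have pl: "x * y = g $ 2 $ 1 * k $ 2 $ 1 + h $ 2 $ 1 * z"
          unfolding d by (simp add: algebra_simps)
        have gk: "g $ 2 $ 1 * k $ 2 $ 1 \<noteq> 0" using g k by simp
        have Q: "Q = g $ 2 $ 1 * k $ 2 $ 1" using g k by (simp add: Q_def kubota_tau_def)
        have m: "m = h $ 2 $ 1 * z" if "z \<noteq> 0"
          using h that by (simp add: m_def kubota_tau_def xyz del: matrix_mult_nth_2)
        have P: "P = x * y" if "x * y \<noteq> 0"
          using that by (simp add: P_def kubota_tau_def xyz del: matrix_mult_nth_2)
        show ?thesis
        proof (cases "z = 0")
          case True
          then have "P = Q" using P pl Q gk by simp
          then show ?thesis by (rule steinberg_eq(2)[OF PQm one_neq_zero])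
        next
          case z: False
          show ?thesis
          proof (cases "x * y = 0")
            case True
            then have "m = - Q" using pl m[OF z] Q by (simp add: eq_neg_iff_add_eq_0 add.commute)
            then show ?thesis by (rule steinberg_eq(3)[OF PQm one_neq_zero])
          next
            case False
            then have "P = Q + m" using pl m[OF z] P[OF False] Q by simp
            then show ?thesis by (rule steinberg_sum[OF _ PQm])
          qed
        qed
      qed
    qed
  qed
  then have "hilbert_symbol (?t (g ** h) * ?t g) (?t (g ** h) * ?t h) *
      hilbert_symbol (?t (g ** h ** k) * ?t (g ** h)) (?t (g ** h ** k) * ?t k) =
    hilbert_symbol (?t (g ** h ** k) * ?t g) (?t (g ** h ** k) * ?t (h ** k)) *
      hilbert_symbol (?t (h ** k) * ?t h) (?t (h ** k) * ?t k)"
    using nz unfolding P_def Q_def m_def by (intro cocycle_from_steinberg)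
  moreover have "kubota_s g * (kubota_s g * j) = j" for g :: "'p padic ^ 2 ^ 2" and j
    using kubota_s_self[of g] by (simp flip: mult.assoc)
  ultimately show ?thesis
    unfolding kubota_cocycle_def by (simp add: matrix_mul_assoc mult_ac)
qed

end

lemma matrix_adjugate_2:
  fixes A :: "'a::comm_ring_1 ^ 2 ^ 2"
  assumes "det A = 1"
  shows "mat2 (A $ 2 $ 2) (- A $ 1 $ 2) (- A $ 2 $ 1) (A $ 1 $ 1) ** A = mat 1"
    and "A ** mat2 (A $ 2 $ 2) (- A $ 1 $ 2) (- A $ 2 $ 1) (A $ 1 $ 1) = mat 1"
proof -
  have e: "A $ 1 $ 1 * A $ 2 $ 2 = 1 + A $ 1 $ 2 * A $ 2 $ 1"
    using assms by (simp add: det_2 diff_eq_eq)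
  have e': "A $ 2 $ 2 * A $ 1 $ 1 = 1 + A $ 2 $ 1 * A $ 1 $ 2"
    using e by (simp only: mult.commute)
  show "mat2 (A $ 2 $ 2) (- A $ 1 $ 2) (- A $ 2 $ 1) (A $ 1 $ 1) ** A = mat 1"
    by (intro mat2_eq_iff[THEN iffD2] conjI) (simp_all add: e e' mult.commute[of "A $ 2 $ 2" "A $ 1 $ 2"]
      mult.commute[of "A $ 2 $ 1" "A $ 1 $ 1"] mult.commute[of "A $ 2 $ 1" "A $ 1 $ 2"])
  show "A ** mat2 (A $ 2 $ 2) (- A $ 1 $ 2) (- A $ 2 $ 1) (A $ 1 $ 1) = mat 1"
    by (intro mat2_eq_iff[THEN iffD2] conjI) (simp_all add: e e' mult.commute[of "A $ 1 $ 2" "A $ 1 $ 1"]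
      mult.commute[of "A $ 2 $ 2" "A $ 2 $ 1"] mult.commute[of "A $ 2 $ 1" "A $ 1 $ 2"])
qed

lemma K0_iff:
  "A \<in> K0 \<longleftrightarrow> det A = 1 \<and> A $ 1 $ 1 \<in> padic_integers \<and> A $ 1 $ 2 \<in> padic_integers \<and>
    A $ 2 $ 1 \<in> padic_ideal 1 \<and> A $ 2 $ 2 \<in> padic_integers"
  by (auto simp: K0_def forall_2 dest: padic_ideal_subset_integers)

lemma K0_units:
  fixes A :: "'p::prime_card padic ^ 2 ^ 2"
  assumes "A \<in> K0"
  shows "A $ 1 $ 1 \<in> padic_units" "A $ 2 $ 2 \<in> padic_units"
    and "padic_residue (A $ 1 $ 1) * padic_residue (A $ 2 $ 2) mod int CARD('p) = (1 :: int)"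
proof -
  have A: "det A = 1" "A $ 1 $ 1 \<in> padic_integers" "A $ 2 $ 2 \<in> padic_integers"
    "A $ 1 $ 2 * A $ 2 $ 1 \<in> padic_ideal 1"
    using assms unfolding K0_iff by (simp_all add: padic_ideal_closed(6))
  have "A $ 1 $ 1 * A $ 2 $ 2 - 1 \<in> padic_ideal 1"
    using A(1,4) by (simp add: det_2 algebra_simps)
  then have "padic_residue (A $ 1 $ 1 * A $ 2 $ 2) = 1"
    using A padic_residue_eq_iff[of "A $ 1 $ 1 * A $ 2 $ 2" 1] by simp
  then show "padic_residue (A $ 1 $ 1) * padic_residue (A $ 2 $ 2) mod int CARD('p) = 1"
    using A by (simp add: padic_residue_mult)
  then show "A $ 1 $ 1 \<in> padic_units" "A $ 2 $ 2 \<in> padic_units"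
    using A by (auto simp: padic_unit_iff_residue)
qed

lemma K0_mult:
  assumes "A \<in> K0" "B \<in> K0"
  shows "A ** B \<in> K0"
proof -
  have "A $ i $ j \<in> padic_integers" "B $ i $ j \<in> padic_integers" for i j
    using assms by (auto simp: K0_def)
  then show ?thesis
    using assms by (simp add: K0_iff det_mul)
qed

lemma K0_1: "mat 1 \<in> K0"
  unfolding K0_iff by simp

lemma K0_adjugate: "A \<in> K0 \<Longrightarrow> mat2 (A $ 2 $ 2) (- A $ 1 $ 2) (- A $ 2 $ 1) (A $ 1 $ 1) \<in> K0"
  unfolding K0_iff by (simp add: det_2 mult.commute)

lemma K0_mult_residue:
  fixes A B :: "'p::prime_card padic ^ 2 ^ 2"
  assumes "A \<in> K0" "B \<in> K0"
  shows "padic_residue ((A ** B) $ 2 $ 2) =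
    padic_residue (A $ 2 $ 2) * padic_residue (B $ 2 $ 2) mod int CARD('p)"
proof -
  have i: "A $ 2 $ 2 \<in> padic_integers" "B $ 2 $ 2 \<in> padic_integers" "A $ 2 $ 1 * B $ 1 $ 2 \<in> padic_ideal 1"
    using assms by (simp_all add: K0_iff)
  then have "padic_residue ((A ** B) $ 2 $ 2) = padic_residue (A $ 2 $ 2 * B $ 2 $ 2)"
    by (subst padic_residue_eq_iff) (simp_all add: padic_ideal_subset_integers)
  then show ?thesis using i by (simp add: padic_residue_mult)
qed

section \<open>The group structure of the double cover\<close>

lemma mp_cases:
  obtains A e where "x = Abs_metaplectic (A, e)" "det A = 1" "e = 1 \<or> e = - 1"
  by (cases x) auto

lemma mp_matrix_Abs [simp]: "det A = 1 \<Longrightarrow> e = 1 \<or> e = - 1 \<Longrightarrow> mp_matrix (Abs_metaplectic (A, e)) = A"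
  and mp_sign_Abs [simp]: "det A = 1 \<Longrightarrow> e = 1 \<or> e = - 1 \<Longrightarrow> mp_sign (Abs_metaplectic (A, e)) = e"
  by (simp_all add: mp_matrix_def mp_sign_def Abs_metaplectic_inverse)

lemma det_mp_matrix [simp]: "det (mp_matrix x) = 1"
  and mp_sign_cases: "mp_sign x = 1 \<or> mp_sign x = - 1"
  by (cases x rule: mp_cases; simp)+

lemma mp_sign_self [simp]: "mp_sign x * mp_sign x = 1"
  using mp_sign_cases[of x] by auto

lemma mp_eqI: "mp_matrix x = mp_matrix y \<Longrightarrow> mp_sign x = mp_sign y \<Longrightarrow> x = y"
  by (simp add: mp_matrix_def mp_sign_def Rep_metaplectic_inject[symmetric] prod_eq_iff)

lemma mp_mult_matrix [simp]: "mp_matrix (mp_mult x y) = mp_matrix x ** mp_matrix y"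
  and mp_mult_sign [simp]: "mp_sign (mp_mult x y) = mp_sign x * mp_sign y * kubota_cocycle (mp_matrix x) (mp_matrix y)"
  by (simp_all add: mp_matrix_def mp_sign_def mp_mult.rep_eq split: prod.splits)

lemma mp_section_matrix [simp]: "det A = 1 \<Longrightarrow> mp_matrix (mp_section A) = A"
  and mp_section_sign [simp]: "det A = 1 \<Longrightarrow> mp_sign (mp_section A) = 1"
  by (simp_all add: mp_section_def)

lemma kubota_cocycle_1: "det g = 1 \<Longrightarrow> kubota_cocycle (mat 1) g = 1"
proof -
  assume "det g = 1"
  then have "kubota_tau g \<noteq> 0" by (rule kubota_tau_nonzero)
  then show ?thesis
    by (simp add: kubota_cocycle_def kubota_tau_def kubota_s_def[of "mat 1"] hilbert_symbol_commute)
qed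

context odd_prime
begin

lemma group_mp_group: "group (mp_group :: 'p metaplectic monoid)"
proof (rule groupI)
  fix x y z :: "'p metaplectic"
  have "mp_mult (mp_mult x y) z = mp_mult x (mp_mult y z)"
    using kubota_cocycle_assoc[of "mp_matrix x" "mp_matrix y" "mp_matrix z"]
    by (intro mp_eqI) (simp_all add: matrix_mul_assoc mult_ac)
  then show "x \<otimes>\<^bsub>mp_group\<^esub> y \<otimes>\<^bsub>mp_group\<^esub> z = x \<otimes>\<^bsub>mp_group\<^esub> (y \<otimes>\<^bsub>mp_group\<^esub> z)"
    by (simp add: mp_group_def)
  show "\<one>\<^bsub>mp_group\<^esub> \<otimes>\<^bsub>mp_group\<^esub> x = x"
    by (simp add: mp_group_def) (intro mp_eqI, simp_all add: kubota_cocycle_1)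
  let ?M = "mp_matrix x"
  let ?A = "mat2 (?M $ 2 $ 2) (- ?M $ 1 $ 2) (- ?M $ 2 $ 1) (?M $ 1 $ 1)"
  \<comment> \<open>The sign is chosen to cancel the cocycle between the adjugate and the matrix of
    \<open>x\<close>.\<close>
  let ?y = "Abs_metaplectic (?A, mp_sign x * kubota_cocycle ?A ?M)"
  have d: "det ?A = 1" using det_mp_matrix[of x] by (simp add: det_2 mult.commute)
  have e: "mp_sign x * kubota_cocycle ?A ?M = 1 \<or> mp_sign x * kubota_cocycle ?A ?M = - 1"
    by (intro sign_mult_cases mp_sign_cases kubota_cocycle_cases)
  have "mp_mult ?y x = mp_section (mat 1)"
  proof (rule mp_eqI)
    show "mp_matrix (mp_mult ?y x) = mp_matrix (mp_section (mat 1))"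
      using d e matrix_adjugate_2(1)[of ?M] by simp
    have "kubota_cocycle ?A ?M * kubota_cocycle ?A ?M = 1"
      using kubota_cocycle_cases[of ?A ?M] by auto
    then have "mp_sign x * kubota_cocycle ?A ?M * mp_sign x * kubota_cocycle ?A ?M = 1"
      using mp_sign_self[of x] by (simp add: mult.assoc mult.left_commute)
    then show "mp_sign (mp_mult ?y x) = mp_sign (mp_section (mat 1))"
      using d e by simp
  qed
  then show "\<exists>y\<in>carrier mp_group. y \<otimes>\<^bsub>mp_group\<^esub> x = \<one>\<^bsub>mp_group\<^esub>"
    by (auto simp: mp_group_def)
qed (simp_all add: mp_group_def)

subsection \<open>The splitting over the Iwahori subgroup\<close>

text \<open>A unit enters the tame formula only through its quadratic character, hence only through
  its residue. Diagonal entries of elements of \<open>K0\<close> may therefore be replaced by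
  congruent ones inside symbols.\<close>

lemma hilbert_symbol_unit_cong:
  assumes "(u :: 'p padic) \<in> padic_units" "v \<in> padic_units" "quad_char u = quad_char v" "w \<noteq> 0"
  shows "hilbert_symbol u w = hilbert_symbol v w"
  using assms by (simp add: hilbert_symbol_tame padic_units_nonzero)

lemma kubota_s_K0:
  assumes "(g :: 'p padic ^ 2 ^ 2) \<in> K0"
  shows "kubota_s g = (if g $ 2 $ 1 = 0 then 1 else hilbert_symbol (g $ 2 $ 1) (g $ 2 $ 2))"
  using K0_units(2)[OF assms] by (simp add: kubota_s_def hilbert_symbol_tame padic_units_nonzero)

text \<open>Modulo p the lower right entry of gh is d d', and a' d' = 1, so symbols with D and a'
  reduce to symbols with d and d'; units pair trivially. What then remains of the cocycle is the
  Steinberg relation for C = c a' + d c', or a direct computation when one of c, c', C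
  vanishes.\<close>

lemma kubota_cocycle_K0:
  assumes g: "(g :: 'p padic ^ 2 ^ 2) \<in> K0" and h: "h \<in> K0"
  shows "kubota_cocycle g h = 1"
proof -
  let ?h = hilbert_symbol
  note gh = K0_mult[OF g h]
  define c d c' a' d' C D where defs: "c = g $ 2 $ 1" "d = g $ 2 $ 2" "c' = h $ 2 $ 1" "a' = h $ 1 $ 1"
    "d' = h $ 2 $ 2" "C = (g ** h) $ 2 $ 1" "D = (g ** h) $ 2 $ 2"
  have u: "d \<in> padic_units" "a' \<in> padic_units" "d' \<in> padic_units" "D \<in> padic_units"
    using K0_units[OF g] K0_units[OF h] K0_units[OF gh] by (simp_all only: defs)
  note nz = u[THEN padic_units_nonzero]
  have m1: "- 1 \<in> (padic_units :: 'p padic set)" by (intro padic_units_minus padic_units_1)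
  have units: "?h x y = 1" if "x \<in> {d, a', d', - 1}" "y \<in> {d, a', d', - 1}" for x y
    using that u m1 by (intro hilbert_symbol_units) auto
  have "padic_residue D = padic_residue (d * d')"
    using K0_mult_residue[OF g h] u by (simp add: defs padic_residue_mult padic_units_in_integers)
  then have "quad_char D = quad_char (d * d')"
    using u by (simp add: quad_char_unit padic_units_mult)
  then have hD: "?h D w = ?h d w * ?h d' w" if "w \<noteq> 0" for w
    using hilbert_symbol_unit_cong[OF u(4) padic_units_mult[OF u(1,3)] _ that] nz that
    by (simp add: hilbert_symbol_mult_left)
  have "padic_residue (a' * d') = 1"
    using K0_units[OF h] u by (simp add: defs padic_residue_mult padic_units_in_integers)
  then have "quad_char (a' * d') = quad_char (1 :: 'p padic)"
    unfolding quad_char_unit[OF padic_units_mult[OF u(2,3)]] quad_char_unit[OF padic_units_1] by simp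
  then have "?h (a' * d') w = ?h 1 w" if "w \<noteq> 0" for w
    using that by (rule hilbert_symbol_unit_cong[OF padic_units_mult[OF u(2,3)] padic_units_1])
  then have ha: "?h a' w = ?h d' w" if "w \<noteq> 0" for w
    using that nz hilbert_symbol_cases[of a' w] hilbert_symbol_cases[of d' w]
      hilbert_symbol_mult_left[of w a' d'] by (elim disjE) simp_all
  have C: "C = c * a' + d * c'" by (simp add: defs)
  have s: "kubota_s g = (if c = 0 then 1 else ?h c d)" "kubota_s h = (if c' = 0 then 1 else ?h c' d')"
    "kubota_s (g ** h) = (if C = 0 then 1 else ?h C D)"
    using kubota_s_K0[OF g] kubota_s_K0[OF h] kubota_s_K0[OF gh] by (simp_all only: defs)
  have t: "kubota_tau g = (if c = 0 then d else c)" "kubota_tau h = (if c' = 0 then d' else c')"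
    "kubota_tau (g ** h) = (if C = 0 then D else C)"
    unfolding defs by (simp_all add: kubota_tau_def del: matrix_mult_nth_2)
  have hD': "?h w D = ?h w d * ?h w d'" if "w \<noteq> 0" for w
    using hD[OF that] by (simp add: hilbert_symbol_commute)
  have ha': "?h w a' = ?h w d'" if "w \<noteq> 0" for w
    using ha[OF that] by (simp add: hilbert_symbol_commute)
  note ex = hilbert_symbol_mult_right hilbert_symbol_mult_left hD hD' ha ha'
  note ac = mult.commute mult.left_commute hilbert_symbol_commute
  have units': "?h d d = 1" "?h d d' = 1" "?h d' d = 1" "?h d' d' = 1" 
    "?h d (- 1) = 1" "?h d' (- 1) = 1" "?h (- 1) d = 1" "?h (- 1) d' = 1"
    using units by simp_all
  show ?thesis
  proof (cases "c = 0"; cases "c' = 0")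
    assume "c = 0" "c' = 0"
    then show ?thesis using nz units'
      by (simp add: kubota_cocycle_def s t C ex)
  next
    assume c: "c = 0" "c' \<noteq> 0"
    then show ?thesis using nz units'
      by (simp add: kubota_cocycle_def s t C ex hilbert_symbol_diag) (simp add: ac)
  next
    assume c: "c \<noteq> 0" "c' = 0"
    then show ?thesis using nz units'
      by (simp add: kubota_cocycle_def s t C ex hilbert_symbol_diag) (simp add: ac)
  next
    assume c: "c \<noteq> 0" "c' \<noteq> 0"
    show ?thesis
    proof (cases "C = 0")
      case False
      have "?h C (- ((d * c') * (c * a'))) * ?h (c * a') (d * c') = 1"
        using c nz False by (intro steinberg_sum) (simp_all add: C)
      then have st: "?h C (- 1) * (?h C d * ?h C c' * (?h C c * ?h C d')) * (?h c d * ?h c c' * (?h d' d * ?h d' c')) = 1"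
        using c nz False hilbert_symbol_minus_right[of C "(d * c') * (c * a')"]
        by (simp add: ex) (simp add: mult.assoc mult.left_commute)
      have "kubota_cocycle g h = ?h (C * c) (C * c') * ?h c d * ?h c' d' * ?h C D"
        using c False by (simp add: kubota_cocycle_def s t)
      also have "\<dots> = ?h C (- 1) * (?h C d * ?h C c' * (?h C c * ?h C d')) * (?h c d * ?h c c' * (?h d' d * ?h d' c'))"
        using c False nz units' by (simp add: ex hilbert_symbol_diag) (simp add: ac)
      finally show ?thesis using st by simp
    next
      case True
      have "d * c' = - (c * a')" using True unfolding C by (simp add: eq_neg_iff_add_eq_0 add.commute)
      then have "?h w (d * c') = ?h w (- (c * a'))" for w by simp
      then have "?h w d * ?h w c' = ?h w (- 1) * ?h w (c * a')" if "w \<noteq> 0" for w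
        using that c nz hilbert_symbol_minus_right[of w "c * a'"] hilbert_symbol_mult_right[of w d c'] by simp
      then have "?h w d * ?h w c' = ?h w (- 1) * (?h w c * ?h w d')" if "w \<noteq> 0" for w
        using that c nz by (simp add: hilbert_symbol_mult_right ha')
      then have "?h w d * (?h w d * ?h w c') = ?h w d * (?h w (- 1) * (?h w c * ?h w d'))" if "w \<noteq> 0" for w
        using that by simp
      then have hc: "?h w c' = ?h w d * (?h w (- 1) * (?h w c * ?h w d'))" if "w \<noteq> 0" for w
        using that by simp
      have hc': "?h c' w = ?h d w * (?h (- 1) w * (?h c w * ?h d' w))" if "w \<noteq> 0" for w
        using hc[OF that] by (simp only: hilbert_symbol_commute)
      have "kubota_cocycle g h = ?h (D * c) (D * c') * ?h c d * ?h c' d'"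
        using c True by (simp add: kubota_cocycle_def s t)
      also have "\<dots> = 1"
        using c nz units' by (simp add: ex hc hc' hilbert_symbol_diag) (simp add: ac)
      finally show ?thesis .
    qed
  qed
qed

lemma K0_cover_subgroup: "subgroup K0_cover (mp_group :: 'p metaplectic monoid)"
proof -
  interpret group "mp_group :: 'p metaplectic monoid" by (rule group_mp_group)
  show ?thesis
  proof (rule subgroupI)
    have "mp_section (mat 1) \<in> (K0_cover :: 'p metaplectic set)" by (simp add: K0_cover_def K0_1)
    then show "(K0_cover :: 'p metaplectic set) \<noteq> {}" by blast
    fix x :: "'p metaplectic" assume x: "x \<in> K0_cover"
    let ?M = "mp_matrix x"
    let ?A = "mat2 (?M $ 2 $ 2) (- ?M $ 1 $ 2) (- ?M $ 2 $ 1) (?M $ 1 $ 1)"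
    have "mp_matrix (inv\<^bsub>mp_group\<^esub> x \<otimes>\<^bsub>mp_group\<^esub> x) = mat 1"
      using l_inv[of x] by (simp add: mp_group_def)
    then have "mp_matrix (inv\<^bsub>mp_group\<^esub> x) ** ?M = mat 1"
      by (simp add: mp_group_def)
    then have "mp_matrix (inv\<^bsub>mp_group\<^esub> x) ** ?M ** ?A = mat 1 ** ?A" by (rule arg_cong)
    then have "mp_matrix (inv\<^bsub>mp_group\<^esub> x) ** (?M ** ?A) = ?A"
      by (simp only: matrix_mul_assoc matrix_mul_lid)
    then have "mp_matrix (inv\<^bsub>mp_group\<^esub> x) = ?A"
      by (simp only: matrix_adjugate_2(2)[OF det_mp_matrix] matrix_mul_rid)
    moreover have "?A \<in> K0" using x by (intro K0_adjugate) (simp add: K0_cover_def)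
    ultimately show "inv\<^bsub>mp_group\<^esub> x \<in> K0_cover"
      by (simp only: K0_cover_def mem_Collect_eq)
  qed (auto simp: K0_cover_def mp_group_def K0_mult)
qed

end

section \<open>Generators of the double cover\<close>

definition upper :: "'p::prime_card padic \<Rightarrow> 'p metaplectic"
  where "upper z = mp_section (mat2 1 z 0 1)"

definition lower :: "'p::prime_card padic \<Rightarrow> 'p metaplectic"
  where "lower z = mp_section (mat2 1 0 z 1)"

definition torus :: "'p::prime_card padic \<Rightarrow> 'p metaplectic"
  where "torus a = mp_section (mat2 a 0 0 (inverse a))"

definition weyl_elt :: "'p::prime_card padic \<Rightarrow> 'p metaplectic"
  where "weyl_elt t = mp_section (weyl t)"

definition sign_elt :: "int \<Rightarrow> 'p::prime_card metaplectic"
  where "sign_elt e = Abs_metaplectic (mat 1, e)"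

lemma weyl_nth [simp]:
  "weyl t $ 1 $ 1 = 0" "weyl t $ 1 $ 2 = t" "weyl t $ 2 $ 1 = - inverse t" "weyl t $ 2 $ 2 = 0"
  by (simp_all add: weyl_def)

lemma det_weyl [simp]: "t \<noteq> 0 \<Longrightarrow> det (weyl t) = 1"
  by (simp add: det_2)

lemma elt_matrix [simp]:
  "mp_matrix (upper z) = mat2 1 z 0 1" "mp_sign (upper z) = 1"
  "mp_matrix (lower z) = mat2 1 0 z 1" "mp_sign (lower z) = 1"
  "a \<noteq> 0 \<Longrightarrow> mp_matrix (torus a) = mat2 a 0 0 (inverse a)" "a \<noteq> 0 \<Longrightarrow> mp_sign (torus a) = 1"
  "t \<noteq> 0 \<Longrightarrow> mp_matrix (weyl_elt t) = weyl t" "t \<noteq> 0 \<Longrightarrow> mp_sign (weyl_elt t) = 1"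
  "e = 1 \<or> e = - 1 \<Longrightarrow> mp_matrix (sign_elt e) = mat 1" "e = 1 \<or> e = - 1 \<Longrightarrow> mp_sign (sign_elt e) = e"
  by (simp_all add: upper_def lower_def torus_def weyl_elt_def sign_elt_def)

lemma kubota_s_trivial: "g $ 2 $ 1 = 0 \<or> g $ 2 $ 2 = 0 \<or> g $ 2 $ 2 = 1 \<Longrightarrow> kubota_s g = 1"
  by (auto simp: kubota_s_def)

text \<open>One argument of the Hilbert symbol becomes a nonzero square, so only the factors
  \<open>kubota_s\<close> survive.\<close>

lemma kubota_cocycle_tau_eq:
  assumes "kubota_tau (g ** h) = kubota_tau g \<or> kubota_tau (g ** h) = kubota_tau h"
    "kubota_tau (g ** h) \<noteq> 0"
  shows "kubota_cocycle g h = kubota_s g * kubota_s h * kubota_s (g ** h)"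
  using assms by (auto simp: kubota_cocycle_def)

text \<open>In both products \<tau> of the product equals \<tau> of the Weyl factor. Each cocycle is
  then \<open>kubota_s\<close> of the common product, and the signs agree without being
  evaluated.\<close>

lemma weyl_upper:
  assumes "t \<noteq> 0"
  shows "mp_mult (weyl_elt t) (upper z) = mp_mult (lower (- z / t ^ 2)) (weyl_elt t)"
proof (rule mp_eqI)
  show m: "mp_matrix (mp_mult (weyl_elt t) (upper z)) = mp_matrix (mp_mult (lower (- z / t ^ 2)) (weyl_elt t))"
    using assms by (simp add: mat2_eq_iff[of "_ ** _" "_ ** _"] power2_eq_square field_simps)
  have "kubota_cocycle (weyl t) (mat2 1 z 0 1) = kubota_s (weyl t ** mat2 1 z 0 1)"
    using assms by (subst kubota_cocycle_tau_eq) (simp_all add: kubota_tau_def kubota_s_trivial)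
  moreover have "kubota_cocycle (mat2 1 0 (- z / t ^ 2) 1) (weyl t) = kubota_s (mat2 1 0 (- z / t ^ 2) 1 ** weyl t)"
    using assms by (subst kubota_cocycle_tau_eq) (simp_all add: kubota_tau_def kubota_s_trivial)
  ultimately show "mp_sign (mp_mult (weyl_elt t) (upper z)) = mp_sign (mp_mult (lower (- z / t ^ 2)) (weyl_elt t))"
    using m assms by simp
qed

lemma weyl_lower:
  assumes "t \<noteq> 0"
  shows "mp_mult (weyl_elt t) (lower z) = mp_mult (upper (- (t ^ 2) * z)) (weyl_elt t)"
proof (rule mp_eqI)
  show m: "mp_matrix (mp_mult (weyl_elt t) (lower z)) = mp_matrix (mp_mult (upper (- (t ^ 2) * z)) (weyl_elt t))"
    using assms by (simp add: mat2_eq_iff[of "_ ** _" "_ ** _"] power2_eq_square field_simps)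
  have "kubota_cocycle (weyl t) (mat2 1 0 z 1) = 1"
    using assms by (subst kubota_cocycle_tau_eq) (simp_all add: kubota_tau_def kubota_s_trivial)
  moreover have "kubota_cocycle (mat2 1 (- (t ^ 2) * z) 0 1) (weyl t) = 1"
    using assms by (subst kubota_cocycle_tau_eq) (simp_all add: kubota_tau_def kubota_s_trivial)
  ultimately show "mp_sign (mp_mult (weyl_elt t) (lower z)) = mp_sign (mp_mult (upper (- (t ^ 2) * z)) (weyl_elt t))"
    using assms by simp
qed

text \<open>The rank one identity behind the big cell. It holds in the cover without a correcting
  sign because (x, -x) = 1.\<close>

lemma upper_eq_lower_weyl_lower:
  assumes "t \<noteq> 0"
  shows "upper t = mp_mult (lower (inverse t)) (mp_mult (weyl_elt t) (lower (inverse t)))"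
proof (rule mp_eqI)
  let ?l = "mat2 1 0 (inverse t) 1"
  show "mp_matrix (upper t) = mp_matrix (mp_mult (lower (inverse t)) (mp_mult (weyl_elt t) (lower (inverse t))))"
    using assms by (simp add: mat2_eq_iff[of "mat2 1 t 0 1"])
  have "kubota_cocycle (weyl t) ?l = 1"
    using assms by (subst kubota_cocycle_tau_eq) (simp_all add: kubota_tau_def kubota_s_trivial)
  moreover have "kubota_cocycle ?l (weyl t ** ?l) = 1"
    using assms hilbert_symbol_neg_self[of "inverse t"]
    by (simp add: kubota_cocycle_def kubota_tau_def kubota_s_trivial)
  ultimately show "mp_sign (upper t) = mp_sign (mp_mult (lower (inverse t)) (mp_mult (weyl_elt t) (lower (inverse t))))"
    using assms by simp
qed

lemma lower_eq_upper_weyl_upper: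
  assumes "t \<noteq> 0"
  shows "lower t = mp_mult (upper (inverse t)) (mp_mult (weyl_elt (- inverse t)) (upper (inverse t)))"
proof (rule mp_eqI)
  let ?u = "mat2 1 (inverse t) 0 1"
  show "mp_matrix (lower t) = mp_matrix (mp_mult (upper (inverse t)) (mp_mult (weyl_elt (- inverse t)) (upper (inverse t))))"
    using assms by (simp add: mat2_eq_iff[of "mat2 1 0 t 1"])
  have "kubota_cocycle (weyl (- inverse t)) ?u = 1"
    using assms by (subst kubota_cocycle_tau_eq) (simp_all add: kubota_tau_def kubota_s_trivial)
  moreover have "kubota_cocycle ?u (weyl (- inverse t) ** ?u) = 1"
    using assms by (subst kubota_cocycle_tau_eq) (simp_all add: kubota_tau_def kubota_s_trivial)
  ultimately show "mp_sign (lower t) = mp_sign (mp_mult (upper (inverse t)) (mp_mult (weyl_elt (- inverse t)) (upper (inverse t))))"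
    using assms by simp
qed

text \<open>The sign \<open>e\<close> is the cocycle of diag(a, 1/a) with w(t), evaluated from
  \<tau> values 1/a, -1/t and -1/(a t). It is the source of the quadratic character in one of the
  two relations.\<close>

lemma torus_weyl:
  assumes "a \<noteq> 0" "t \<noteq> 0" "e = hilbert_symbol (- (inverse (a * a * t))) (inverse (a * t * t))"
  shows "weyl_elt (a * t) = mp_mult (sign_elt e) (mp_mult (torus a) (weyl_elt t))"
proof (rule mp_eqI)
  have e: "e = 1 \<or> e = - 1" using assms(3) hilbert_symbol_cases by blast
  show "mp_matrix (weyl_elt (a * t)) = mp_matrix (mp_mult (sign_elt e) (mp_mult (torus a) (weyl_elt t)))"
    using assms(1,2) e by (simp add: mat2_eq_iff[of "weyl _"])
  have "kubota_cocycle (mat2 a 0 0 (inverse a)) (weyl t) = e"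
    using assms by (simp add: kubota_cocycle_def kubota_tau_def kubota_s_trivial mult_ac)
  moreover have "kubota_cocycle (mat 1) (mat2 a 0 0 (inverse a) ** weyl t) = 1"
    using assms by (intro kubota_cocycle_1) (simp add: det_mul)
  ultimately show "mp_sign (weyl_elt (a * t)) = mp_sign (mp_mult (sign_elt e) (mp_mult (torus a) (weyl_elt t)))"
    using assms(1,2) e by (auto simp: matrix_mul_lid)
qed

text \<open>The product is -1, so \<tau> is -1 there and 1/t remains in both arguments of the
  symbol. For t = 1/p and odd p this symbol is (p, p) = (-1/p).\<close>

lemma weyl_square:
  assumes "t \<noteq> 0"
  shows "mp_matrix (mp_mult (weyl_elt t) (weyl_elt t)) = mat2 (- 1) 0 0 (- 1)"
    "mp_sign (mp_mult (weyl_elt t) (weyl_elt t)) = hilbert_symbol (inverse t) (inverse t)"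
proof -
  show m: "mp_matrix (mp_mult (weyl_elt t) (weyl_elt t)) = mat2 (- 1) 0 0 (- 1)"
    using assms by (simp add: mat2_eq_iff[of "_ ** _"])
  show "mp_sign (mp_mult (weyl_elt t) (weyl_elt t)) = hilbert_symbol (inverse t) (inverse t)"
    using assms by (simp add: kubota_cocycle_def kubota_tau_def kubota_s_trivial)
qed

section \<open>Conjugation by lifted Weyl elements\<close>

context odd_prime
begin

abbreviation mult :: "'p metaplectic \<Rightarrow> 'p metaplectic \<Rightarrow> 'p metaplectic"  (infixl \<open>\<cdot>\<close> 70)
  where "x \<cdot> y \<equiv> mp_mult x y"

abbreviation minv :: "'p metaplectic \<Rightarrow> 'p metaplectic"
  where "minv x \<equiv> inv\<^bsub>mp_group\<^esub> x"

lemma mp_assoc: "x \<cdot> y \<cdot> z = x \<cdot> (y \<cdot> z)"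
  and mp_one: "mp_section (mat 1) \<cdot> x = x" "x \<cdot> mp_section (mat 1) = x"
  and mp_inv: "minv x \<cdot> x = mp_section (mat 1)" "x \<cdot> minv x = mp_section (mat 1)"
proof -
  interpret group "mp_group :: 'p metaplectic monoid" by (rule group_mp_group)
  show "x \<cdot> y \<cdot> z = x \<cdot> (y \<cdot> z)" "mp_section (mat 1) \<cdot> x = x" "x \<cdot> mp_section (mat 1) = x"
    "minv x \<cdot> x = mp_section (mat 1)" "x \<cdot> minv x = mp_section (mat 1)"
    using m_assoc[of x y z] l_one[of x] r_one[of x] l_inv[of x] r_inv[of x] by (simp_all add: mp_group_def)
qed

lemma mp_cancel: "minv x \<cdot> (x \<cdot> y) = y" "x \<cdot> (minv x \<cdot> y) = y"
  by (simp_all add: mp_inv mp_one flip: mp_assoc)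

lemma mp_inv_matrix: "mp_matrix (minv x) = mat2 (mp_matrix x $ 2 $ 2) (- mp_matrix x $ 1 $ 2) (- mp_matrix x $ 2 $ 1) (mp_matrix x $ 1 $ 1)"
  (is "_ = ?A")
proof -
  have "mp_matrix (minv x \<cdot> x) = mat 1" unfolding mp_inv by simp
  then have "mp_matrix (minv x) ** mp_matrix x ** ?A = mat 1 ** ?A" by simp
  then have "mp_matrix (minv x) ** (mp_matrix x ** ?A) = ?A"
    by (simp only: matrix_mul_assoc matrix_mul_lid)
  then show ?thesis by (simp only: matrix_adjugate_2(2)[OF det_mp_matrix] matrix_mul_rid)
qed

lemma weyl_conj_matrix:
  assumes "t \<noteq> 0"
  shows "mp_matrix (minv (weyl_elt t) \<cdot> g \<cdot> weyl_elt t) =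
      mat2 (mp_matrix g $ 2 $ 2) (- mp_matrix g $ 2 $ 1 * t ^ 2) (- mp_matrix g $ 1 $ 2 / t ^ 2) (mp_matrix g $ 1 $ 1)"
    and "mp_matrix (weyl_elt t \<cdot> g \<cdot> minv (weyl_elt t)) =
      mat2 (mp_matrix g $ 2 $ 2) (- mp_matrix g $ 2 $ 1 * t ^ 2) (- mp_matrix g $ 1 $ 2 / t ^ 2) (mp_matrix g $ 1 $ 1)"
  using assms by (simp_all add: mat2_eq_iff[of "_ ** _"] mp_inv_matrix power2_eq_square field_simps)

text \<open>From w g' = g w it suffices to compare two cocycles with the same product matrix N. Each
  equals (t, d) \<open>kubota_s\<close> N; the computation uses that a and d are inverse modulo p
  and so have the same symbols with every nonzero element.\<close>

lemma weyl_conj_sign: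
  assumes g: "g \<in> K0_cover" "minv (weyl_elt t) \<cdot> g \<cdot> weyl_elt t \<in> K0_cover" and t: "t \<noteq> 0"
  shows "mp_sign (minv (weyl_elt t) \<cdot> g \<cdot> weyl_elt t) = mp_sign g"
proof -
  let ?h = hilbert_symbol
  let ?g' = "minv (weyl_elt t) \<cdot> g \<cdot> weyl_elt t"
  define A where "A = mp_matrix g"
  define A' where "A' = mp_matrix ?g'"
  have A: "A \<in> K0" and A': "A' \<in> K0" using g by (simp_all add: K0_cover_def A_def A'_def)
  have entries: "A' $ 2 $ 1 = - A $ 1 $ 2 / t ^ 2" "A' $ 2 $ 2 = A $ 1 $ 1"
    unfolding A'_def weyl_conj_matrix[OF t] by (simp_all add: A_def)
  define a b c d where abcd: "a = A $ 1 $ 1" "b = A $ 1 $ 2" "c = A $ 2 $ 1" "d = A $ 2 $ 2"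
  have u: "a \<in> padic_units" "d \<in> padic_units" using K0_units[OF A] by (simp_all add: abcd)
  note nz = u[THEN padic_units_nonzero]
  have m1: "- 1 \<in> (padic_units :: 'p padic set)" by (intro padic_units_minus padic_units_1)
  have un: "?h d d = 1" "?h a d = 1" "?h d a = 1" "?h (- 1) d = 1" "?h d (- 1) = 1" "?h (- 1) a = 1" "?h a (- 1) = 1"
    using u m1 by (simp_all add: hilbert_symbol_units)
  have "padic_residue (a * d) = 1"
    using K0_units[OF A] u by (simp add: abcd padic_residue_mult padic_units_in_integers)
  then have "quad_char (a * d) = quad_char (1 :: 'p padic)"
    unfolding quad_char_unit[OF padic_units_mult[OF u]] quad_char_unit[OF padic_units_1] by simp
  then have "?h (a * d) w = ?h 1 w" if "w \<noteq> 0" for w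
    using that by (rule hilbert_symbol_unit_cong[OF padic_units_mult[OF u] padic_units_1])
  then have ha: "?h w a = ?h w d" if "w \<noteq> 0" for w
    using that nz hilbert_symbol_cases[of a w] hilbert_symbol_cases[of d w]
      hilbert_symbol_mult_left[of w a d] hilbert_symbol_commute[of w] by (elim disjE) simp_all
  define g' where "g' = ?g'"
  have A'g: "A' = mp_matrix g'" by (simp only: A'_def g'_def)
  have eq: "weyl_elt t \<cdot> g' = g \<cdot> weyl_elt t" by (simp add: g'_def mp_assoc mp_cancel)
  let ?N = "A ** weyl t"
  have N: "weyl t ** A' = ?N"
    using arg_cong[OF eq, of mp_matrix] t by (simp add: A_def A'g)
  have tN: "kubota_tau ?N = - d * inverse t" using nz t by (simp add: kubota_tau_def abcd)
  have tw: "kubota_tau (weyl t) = - inverse t" using t by (simp add: kubota_tau_def)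
  have sw: "kubota_s (weyl t) = 1" by (simp add: kubota_s_trivial)
  have sA: "kubota_s A = (if c = 0 then 1 else ?h c d)" using kubota_s_K0[OF A] by (simp add: abcd)
  have tA: "kubota_tau A = (if c = 0 then d else c)" by (simp add: kubota_tau_def abcd)
  have sA': "kubota_s A' = (if b = 0 then 1 else ?h (- b / t ^ 2) a)"
    using kubota_s_K0[OF A'] t by (simp add: entries abcd)
  have tA': "kubota_tau A' = (if b = 0 then a else - b / t ^ 2)"
    using t by (simp add: kubota_tau_def entries abcd)
  have sq: "?h (d * (inverse t * inverse t)) w = ?h d w" for w
    using t by (intro hilbert_symbol_square_mult_eq[of "inverse t"]) (simp_all add: power2_eq_square)
  have sq': "?h w (d * (inverse t * inverse t)) = ?h w d" for w
    using sq[of w] by (simp add: hilbert_symbol_commute)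
  have hi: "?h (inverse t) d = ?h t d"
    using t by (intro hilbert_symbol_square_mult_eq[of "inverse t"]) (simp_all add: power2_eq_square)
  have dt: "- d * inverse t * - inverse t = d * (inverse t * inverse t)" by simp
  have k1: "kubota_cocycle A (weyl t) = ?h t d * kubota_s ?N"
  proof (cases "c = 0")
    case True
    have "?h (- d * inverse t * d) d = ?h (d ^ 2 * (- inverse t)) d" by (simp add: power2_eq_square mult_ac)
    also have "\<dots> = ?h (- inverse t) d" using nz by (intro hilbert_symbol_square_mult)
    also have "\<dots> = ?h t d"
      using hilbert_symbol_mult_left[of d "- 1" "inverse t"] nz t un hi by simp
    finally show ?thesis
      unfolding kubota_cocycle_def tN tw sw sA tA dt sq' using True by simp
  next
    case False
    have "?h (- d * inverse t * c) d = ?h (- 1) d * ?h d d * ?h (inverse t) d * ?h c d"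
      using hilbert_symbol_mult_left[of d "- 1" "d * (inverse t * c)"] False nz t
      by (simp add: hilbert_symbol_mult_left mult_ac)
    then have "?h (- d * inverse t * c) d = ?h t d * ?h c d" using un hi by simp
    then show ?thesis
      unfolding kubota_cocycle_def tN tw sw sA tA dt sq' using False by simp
  qed
  have k2: "kubota_cocycle (weyl t) A' = ?h t d * kubota_s ?N"
  proof (cases "b = 0")
    case True
    have "?h d (- d * inverse t * a) = ?h d (- 1) * ?h d d * ?h d (inverse t) * ?h d a"
      using hilbert_symbol_mult_right[of d "- 1" "d * (inverse t * a)"] nz t
      by (simp add: hilbert_symbol_mult_right mult_ac)
    then have "?h d (- d * inverse t * a) = ?h t d" using un hi hilbert_symbol_commute[of d "inverse t"] by simp
    then show ?thesis
      unfolding kubota_cocycle_def N tN tw sw sA' tA' dt sq using True by simp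
  next
    case False
    have "?h d (- d * inverse t * (- b / t ^ 2)) = ?h d ((inverse t) ^ 2 * (d * (inverse t * b)))"
      by (simp add: field_simps power2_eq_square)
    also have "\<dots> = ?h d (d * (inverse t * b))"
      using hilbert_symbol_square_mult[of "inverse t" "d * (inverse t * b)" d] t
      by (simp only: hilbert_symbol_commute[of d "(inverse t) ^ 2 * (d * (inverse t * b))"]
        hilbert_symbol_commute[of d "d * (inverse t * b)"] nonzero_imp_inverse_nonzero not_False_eq_True)
    also have "\<dots> = ?h t d * ?h d b"
      using nz t False un hi hilbert_symbol_commute[of d "inverse t"] by (simp add: hilbert_symbol_mult_right)
    finally have 1: "?h d (- d * inverse t * (- b / t ^ 2)) = ?h t d * ?h d b" .
    have "?h (- b / t ^ 2) a = ?h (- b) a"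
      using t by (intro hilbert_symbol_square_mult_eq[of "inverse t"]) (simp_all add: field_simps)
    also have "\<dots> = ?h (- b) d" using False by (intro ha) simp
    also have "\<dots> = ?h d b"
      using hilbert_symbol_mult_left[of d "- 1" b] nz False un hilbert_symbol_commute[of d b] by simp
    finally show ?thesis
      using 1 unfolding kubota_cocycle_def N tN tw sw sA' tA' dt sq using False by simp
  qed
  have "mp_sign g' * kubota_cocycle (weyl t) A' = mp_sign g * kubota_cocycle A (weyl t)"
    using arg_cong[OF eq, of mp_sign] t by (simp add: A_def A'g)
  then show ?thesis
    unfolding k1 k2 g'_def[symmetric] using hilbert_symbol_cases[of t d] kubota_s_cases[of ?N] by auto
qed

end

section \<open>Algebras with quadratic generators\<close>

locale complex_algebra = ring A for A :: "(complex, 'a) module" (structure) +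
  assumes smult_closed [simp, intro]: "x \<in> carrier A \<Longrightarrow> c \<odot> x \<in> carrier A"
    and smult_r_distr: "x \<in> carrier A \<Longrightarrow> y \<in> carrier A \<Longrightarrow> c \<odot> (x \<oplus> y) = c \<odot> x \<oplus> c \<odot> y"
    and smult_l_distr: "x \<in> carrier A \<Longrightarrow> (c + d) \<odot> x = c \<odot> x \<oplus> d \<odot> x"
    and smult_assoc: "x \<in> carrier A \<Longrightarrow> c \<odot> (d \<odot> x) = (c * d) \<odot> x"
    and smult_1 [simp]: "x \<in> carrier A \<Longrightarrow> 1 \<odot> x = x"
    and smult_mult_l: "x \<in> carrier A \<Longrightarrow> y \<in> carrier A \<Longrightarrow> (c \<odot> x) \<otimes> y = c \<odot> (x \<otimes> y)"
    and smult_mult_r: "x \<in> carrier A \<Longrightarrow> y \<in> carrier A \<Longrightarrow> x \<otimes> (c \<odot> y) = c \<odot> (x \<otimes> y)"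
begin

lemma smult_0 [simp]: "x \<in> carrier A \<Longrightarrow> 0 \<odot> x = \<zero>"
  using smult_l_distr[of x 0 0] by (metis add.r_cancel_one' add_0 smult_closed)

primrec word_prod :: "('x \<Rightarrow> 'a) \<Rightarrow> 'x list \<Rightarrow> 'a"
  where "word_prod u [] = \<one>" | "word_prod u (x # w) = u x \<otimes> word_prod u w"

definition free_eval :: "('x \<Rightarrow> 'a) \<Rightarrow> ('x free_word \<Rightarrow>\<^sub>0 complex) \<Rightarrow> 'a"
  where "free_eval u P = (\<Oplus>w\<in>Poly_Mapping.keys P. Poly_Mapping.lookup P w \<odot> word_prod u (letters w))"

end

lemma poly_mapping_single_induct:
  assumes "P 0" "\<And>w c p. P p \<Longrightarrow> P (Poly_Mapping.single w c + p)"
  shows "P (p :: 'a \<Rightarrow>\<^sub>0 'b::comm_monoid_add)"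
proof (induction p rule: Poly_Mapping.update_induct)
  case const
  show ?case using assms(1) by simp
next
  case (update f a b)
  then have "Poly_Mapping.update a b f = Poly_Mapping.single a b + f"
    by (intro poly_mapping_eqI) (auto simp: lookup_update lookup_add lookup_single in_keys_iff when_def)
  then show ?case using update assms(2) by metis
qed

lemma ring_free_algebra: "ring (free_algebra :: (complex, 'x free_word \<Rightarrow>\<^sub>0 complex) module)"
proof (intro ringI abelian_groupI monoidI)
  fix x :: "'x free_word \<Rightarrow>\<^sub>0 complex"
  show "\<exists>y\<in>carrier free_algebra. y \<oplus>\<^bsub>free_algebra\<^esub> x = \<zero>\<^bsub>free_algebra\<^esub>"
    by (intro bexI[of _ "- x"]) (simp_all add: free_algebra_def)
qed (simp_all add: free_algebra_def algebra_simps)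

lemma free_algebra_simps [simp]:
  "carrier free_algebra = UNIV" "x \<otimes>\<^bsub>free_algebra\<^esub> y = x * y" "x \<oplus>\<^bsub>free_algebra\<^esub> y = x + y"
  "\<one>\<^bsub>free_algebra\<^esub> = 1" "\<zero>\<^bsub>free_algebra\<^esub> = 0" "c \<odot>\<^bsub>free_algebra\<^esub> x = free_const c * x"
  by (simp_all add: free_algebra_def)

definition quadratic_relators :: "('x \<Rightarrow> complex) \<Rightarrow> ('x \<Rightarrow> complex) \<Rightarrow> ('x free_word \<Rightarrow>\<^sub>0 complex) set"
  where "quadratic_relators \<alpha> \<beta> =
    range (\<lambda>x. free_gen x * free_gen x - (free_const (\<alpha> x) * free_gen x + free_const (\<beta> x)))"

text \<open>Linear combinations of words without equal neighbours. For two letters these are the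
  alternating words, that is, the reduced words of the infinite dihedral group.\<close>

definition alternating :: "('x free_word \<Rightarrow>\<^sub>0 complex) \<Rightarrow> bool"
  where "alternating Q \<longleftrightarrow> (\<forall>w\<in>Poly_Mapping.keys Q. distinct_adj (letters w))"

lemma alternating_single: "distinct_adj (letters w) \<Longrightarrow> alternating (Poly_Mapping.single w c)"
  by (simp add: alternating_def)

lemma alternating_add: "alternating P \<Longrightarrow> alternating Q \<Longrightarrow> alternating (P + Q)"
  using Poly_Mapping.keys_add[of P Q] by (auto simp: alternating_def)

locale quadratic_generators = complex_algebra A for A :: "(complex, 'a) module" (structure) +
  fixes u :: "'x \<Rightarrow> 'a" and \<alpha> \<beta> :: "'x \<Rightarrow> complex"
  assumes u_closed [simp, intro]: "u x \<in> carrier A"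
    and quadratic: "u x \<otimes> u x = \<alpha> x \<odot> u x \<oplus> \<beta> x \<odot> \<one>"
begin

abbreviation "F \<equiv> free_algebra :: (complex, 'x free_word \<Rightarrow>\<^sub>0 complex) module"
abbreviation "lk \<equiv> Poly_Mapping.lookup"
abbreviation "ks \<equiv> Poly_Mapping.keys"
abbreviation "sg \<equiv> Poly_Mapping.single"

lemma word_prod_closed [simp, intro]: "word_prod u w \<in> carrier A"
  by (induction w) auto

lemma word_prod_append: "word_prod u (v @ w) = word_prod u v \<otimes> word_prod u w"
  by (induction v) (auto simp: m_assoc)

lemma free_eval_superset:
  assumes "finite S" "ks P \<subseteq> S"
  shows "free_eval u P = (\<Oplus>w\<in>S. lk P w \<odot> word_prod u (letters w))"
  unfolding free_eval_def
proof (rule add.finprod_mono_neutral_cong_left[OF assms])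
  show "lk P w \<odot> word_prod u (letters w) = \<zero>" if "w \<in> S - ks P" for w
    using that by (simp add: in_keys_iff)
qed (rule refl, rule Pi_I, rule smult_closed, rule word_prod_closed)

lemma free_eval_closed [simp, intro]: "free_eval u P \<in> carrier A"
  unfolding free_eval_def by (intro finsum_closed) auto

lemma free_eval_add: "free_eval u (P + Q) = free_eval u P \<oplus> free_eval u Q"
proof -
  let ?S = "ks P \<union> ks Q"
  have "free_eval u (P + Q) = (\<Oplus>w\<in>?S. lk P w \<odot> word_prod u (letters w) \<oplus> lk Q w \<odot> word_prod u (letters w))"
    using Poly_Mapping.keys_add[of P Q] by (subst free_eval_superset[of ?S]) (auto simp: lookup_add smult_l_distr)
  also have "\<dots> = free_eval u P \<oplus> free_eval u Q"
    by (subst finsum_addf) (auto simp: free_eval_superset[of ?S])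
  finally show ?thesis .
qed

lemma free_eval_single: "free_eval u (sg w c) = c \<odot> word_prod u (letters w)"
  by (subst free_eval_superset[of "{w}"]) (auto simp: lookup_single)

lemma free_eval_0: "free_eval u 0 = \<zero>"
  by (simp add: free_eval_def)

lemma free_eval_1: "free_eval u 1 = \<one>"
  using free_eval_single[of 0 1, unfolded single_one] by (simp add: zero_free_word_def)

lemma free_eval_single_mult:
  "free_eval u (sg v c * Q) = (c \<odot> word_prod u (letters v)) \<otimes> free_eval u Q"
proof (induction Q rule: poly_mapping_single_induct)
  case (2 w d Q)
  have "free_eval u (sg v c * sg w d) = (c * d) \<odot> (word_prod u (letters v) \<otimes> word_prod u (letters w))"
    by (simp add: mult_single free_eval_single plus_free_word_def word_prod_append)
  also have "\<dots> = (c \<odot> word_prod u (letters v)) \<otimes> free_eval u (sg w d)"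
    by (simp add: free_eval_single smult_mult_l smult_mult_r smult_assoc mult.commute)
  finally show ?case
    using 2 by (simp add: distrib_left free_eval_add r_distr)
qed (simp add: free_eval_0)

lemma free_eval_mult: "free_eval u (P * Q) = free_eval u P \<otimes> free_eval u Q"
proof (induction P rule: poly_mapping_single_induct)
  case (2 w c P)
  then show ?case
    by (simp add: distrib_right free_eval_add free_eval_single_mult l_distr free_eval_single)
qed (simp add: free_eval_0)

lemma free_eval_const: "free_eval u (free_const c * P) = c \<odot> free_eval u P"
  by (simp add: free_const_def free_eval_mult free_eval_single zero_free_word_def smult_mult_l)

lemma free_eval_gen: "free_eval u (free_gen x) = u x"
  by (simp add: free_gen_def free_eval_single)

lemma free_eval_ring_hom: "ring_hom_ring F A (free_eval u)"
  by (intro ring_hom_ringI ring_free_algebra ring_axioms)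
    (simp_all add: free_eval_mult free_eval_add free_eval_1)

lemma free_eval_relator: "r \<in> quadratic_relators \<alpha> \<beta> \<Longrightarrow> free_eval u r = \<zero>"
proof -
  assume "r \<in> quadratic_relators \<alpha> \<beta>"
  then obtain x where "r = free_gen x * free_gen x - (free_const (\<alpha> x) * free_gen x + free_const (\<beta> x))"
    unfolding quadratic_relators_def by (rule imageE)
  then have r: "r + (free_const (\<alpha> x) * free_gen x + free_const (\<beta> x)) = free_gen x * free_gen x"
    by simp
  have "free_eval u (free_const (\<beta> x)) = \<beta> x \<odot> \<one>"
    using free_eval_const[of "\<beta> x" 1] by (simp add: free_eval_1)
  then have "free_eval u r \<oplus> (u x \<otimes> u x) = u x \<otimes> u x"
    using arg_cong[OF r, of "free_eval u"]
    by (simp add: free_eval_add free_eval_const free_eval_gen quadratic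
        free_eval_mult[of "free_gen x" "free_gen x"])
  then show ?thesis by (simp add: add.r_cancel_one)
qed

text \<open>Rewriting a repeated letter by its relator shortens the word, so alternating words span
  modulo the relators.\<close>
lemma alternating_normal_form:
  assumes I: "ideal I F" and R: "quadratic_relators \<alpha> \<beta> \<subseteq> I"
  shows "\<exists>Q. alternating Q \<and> P - Q \<in> I"
proof -
  interpret F: ring F by (rule ring_free_algebra)
  interpret I: ideal I F by (rule I)
  have add: "a + b \<in> I" if "a \<in> I" "b \<in> I" for a b
    using I.a_closed[OF that] by simp
  have zero: "0 \<in> I" using I.zero_closed by simp
  have l: "a * b \<in> I" if "b \<in> I" for a b using I.I_l_closed[OF that, of a] by simp
  have r: "a * b \<in> I" if "a \<in> I" for a b using I.I_r_closed[OF that, of b] by simp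
  have gen_single: "\<exists>Q. alternating Q \<and> free_gen x * sg w c - Q \<in> I" if w: "distinct_adj (letters w)" for x w c
  proof (cases "\<exists>v. letters w = x # v")
    case False
    then have "distinct_adj (x # letters w)" using w by (cases "letters w") auto
    moreover have "free_gen x * sg w c = sg (Word (x # letters w)) c"
      by (simp add: free_gen_def mult_single plus_free_word_def)
    ultimately show ?thesis
      using zero by (intro exI[of _ "free_gen x * sg w c"]) (simp add: alternating_single)
  next
    case True
    then obtain v where v: "w = Word (x # v)" by (metis free_word.collapse)
    let ?b = "sg (Word v) c"
    let ?Q = "sg w (\<alpha> x * c) + sg (Word v) (\<beta> x * c)"
    have dv: "distinct_adj v" using w v by (cases v) auto
    have w': "sg w c = free_gen x * ?b" by (simp add: v free_gen_def mult_single plus_free_word_def)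
    have "?Q = (free_const (\<alpha> x) * free_gen x + free_const (\<beta> x)) * ?b"
      by (simp add: v free_const_def free_gen_def distrib_right mult_single plus_free_word_def zero_free_word_def)
    then have "free_gen x * sg w c - ?Q =
        (free_gen x * free_gen x - (free_const (\<alpha> x) * free_gen x + free_const (\<beta> x))) * ?b"
      unfolding w' by (simp add: algebra_simps)
    then have "free_gen x * sg w c - ?Q \<in> I"
      using R by (auto simp: quadratic_relators_def intro!: r)
    moreover have "alternating ?Q"
      using w dv v by (intro alternating_add alternating_single) simp_all
    ultimately show ?thesis by blast
  qed
  have gen: "\<exists>Q. alternating Q \<and> free_gen x * P - Q \<in> I" if "alternating P" for x P
    using that
  proof (induction P rule: Poly_Mapping.update_induct)
    case const
    then show ?case using zero by (intro exI[of _ 0]) (simp add: alternating_def)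
  next
    case (update f a b)
    have eq: "Poly_Mapping.update a b f = sg a b + f"
      using update(1,2) by (intro poly_mapping_eqI) (auto simp: lookup_update lookup_add lookup_single in_keys_iff when_def)
    have "ks (Poly_Mapping.update a b f) = insert a (ks f)" using update(2) by (simp add: keys_update)
    then have f: "alternating f" and a: "distinct_adj (letters a)" using update(4) by (auto simp: alternating_def)
    obtain Q1 where Q1: "alternating Q1" "free_gen x * f - Q1 \<in> I" using update(3)[OF f] by blast
    obtain Q2 where Q2: "alternating Q2" "free_gen x * sg a b - Q2 \<in> I" using gen_single[OF a] by blast
    have "free_gen x * Poly_Mapping.update a b f - (Q2 + Q1) \<in> I"
      using add[OF Q2(2) Q1(2)] unfolding eq by (simp add: algebra_simps)
    then show ?case using alternating_add[OF Q2(1) Q1(1)] by blast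
  qed
  have word: "\<exists>Q. alternating Q \<and> sg (Word w) c - Q \<in> I" for w c
  proof (induction w)
    case Nil
    then show ?case using zero by (intro exI[of _ "sg (Word []) c"]) (simp add: alternating_single)
  next
    case (Cons x w)
    then obtain Q where Q: "alternating Q" "sg (Word w) c - Q \<in> I" by blast
    obtain Q' where Q': "alternating Q'" "free_gen x * Q - Q' \<in> I" using gen[OF Q(1)] by blast
    have "sg (Word (x # w)) c = free_gen x * sg (Word w) c"
      by (simp add: free_gen_def mult_single plus_free_word_def)
    then have "sg (Word (x # w)) c - Q' = free_gen x * (sg (Word w) c - Q) + (free_gen x * Q - Q')"
      by (simp add: algebra_simps)
    then show ?case using add[OF l[OF Q(2)] Q'(2)] Q'(1) by metis
  qed
  show ?thesis
  proof (induction P rule: poly_mapping_single_induct)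
    case 1
    then show ?case using zero by (intro exI[of _ 0]) (simp add: alternating_def)
  next
    case (2 w c P)
    then obtain Q where Q: "alternating Q" "P - Q \<in> I" by blast
    obtain Q' where Q': "alternating Q'" "sg w c - Q' \<in> I" using word[of "letters w" c] by auto
    have "sg w c + P - (Q' + Q) \<in> I" using add[OF Q'(2) Q(2)] by (simp add: algebra_simps)
    then show ?case using alternating_add[OF Q'(1) Q(1)] by blast
  qed
qed

text \<open>By the first isomorphism theorem it suffices that the kernel of evaluation is the
  relator ideal. An element of the kernel is congruent to an alternating combination, which also
  evaluates to zero and so vanishes by independence.\<close>

theorem presented_by_quadratic:
  assumes span: "\<And>a. a \<in> carrier A \<Longrightarrow> \<exists>P. free_eval u P = a"
    and indep: "\<And>Q. alternating Q \<Longrightarrow> free_eval u Q = \<zero> \<Longrightarrow> Q = 0"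
  shows "presented_by A u (quadratic_relators \<alpha> \<beta>)"
proof -
  note hom = free_eval_ring_hom
  let ?I = "genideal F (quadratic_relators \<alpha> \<beta>)" and ?ker = "a_kernel F A (free_eval u)"
  have ker: "?ker = {P. free_eval u P = \<zero>}" by (simp add: a_kernel_def')
  have I: "ideal ?I F" by (rule ring.genideal_ideal[OF ring_free_algebra]) simp
  have R: "quadratic_relators \<alpha> \<beta> \<subseteq> ?I" by (rule ring.genideal_self[OF ring_free_algebra]) simp
  have "?I \<subseteq> ?ker"
    by (rule ring.genideal_minimal[OF ring_free_algebra ring_hom_ring.kernel_is_ideal[OF hom]]) (auto simp: ker free_eval_relator)
  moreover have "?ker \<subseteq> ?I"
  proof
    fix P assume "P \<in> ?ker"
    then have P: "free_eval u P = \<zero>" by (simp add: ker)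
    obtain Q where Q: "alternating Q" "P - Q \<in> ?I" using alternating_normal_form[OF I R] by blast
    then have PQ: "free_eval u (P - Q) = \<zero>" using \<open>?I \<subseteq> ?ker\<close> by (auto simp: ker)
    have "free_eval u P = free_eval u (P - Q) \<oplus> free_eval u Q"
      unfolding free_eval_add[symmetric] by simp
    then have "free_eval u Q = \<zero>" using P PQ by simp
    then have "Q = 0" using indep Q(1) by blast
    then show "P \<in> ?I" using Q(2) by simp
  qed
  ultimately have eq: "?I = ?ker" by blast
  have surj: "free_eval u ` carrier F = carrier A" using span by auto
  have elem: "the_elem (free_eval u ` (?ker +>\<^bsub>F\<^esub> P)) = free_eval u P" for P
    by (rule ring_hom_ring.the_elem_simp[OF hom]) simp
  show ?thesis
    unfolding presented_by_def Let_def eq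
  proof (intro bexI[OF _ ring_hom_ring.FactRing_iso_set[OF hom surj]] conjI allI)
    fix c P
    show "the_elem (free_eval u ` (?ker +>\<^bsub>F\<^esub> c \<odot>\<^bsub>F\<^esub> P)) = c \<odot> the_elem (free_eval u ` (?ker +>\<^bsub>F\<^esub> P))"
      unfolding elem by (simp add: free_eval_const)
  next
    fix x show "the_elem (free_eval u ` (?ker +>\<^bsub>F\<^esub> free_gen x)) = u x"
      unfolding elem by (rule free_eval_gen)
  qed
qed

theorem generated_algebra_quadratic:
  assumes span: "\<And>a. a \<in> carrier A \<Longrightarrow> \<exists>P. free_eval u P = a"
  shows "generated_algebra A (range u) = carrier A"
proof
  have "a \<in> carrier A" if "a \<in> generated_algebra A (range u)" for a
    using that by induction auto
  then show "generated_algebra A (range u) \<subseteq> carrier A" by blast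
  have word: "word_prod u w \<in> generated_algebra A (range u)" for w
    by (induction w) (auto intro: generated_algebra.intros)
  have "free_eval u P \<in> generated_algebra A (range u)" for P
  proof (induction P rule: poly_mapping_single_induct)
    case 1
    \<comment> \<open>The inductive closure has no clause for zero; it arises as 0 times the
      identity.\<close>
    have "0 \<odot> \<one> \<in> generated_algebra A (range u)" by (intro generated_algebra.intros)
    then show ?case by (simp add: free_eval_0)
  next
    case (2 w c P)
    then show ?case
      by (simp add: free_eval_add free_eval_single generated_algebra.intros word)
  qed
  then show "carrier A \<subseteq> generated_algebra A (range u)" using span by blast
qed

end

section \<open>Hecke algebras of characters\<close>

text \<open>The sets \<open>{y. inv x \<otimes> y \<in> K}\<close> are the left cosets x K. Their
  measurability and measure 1 are the whole analytic input, from which translation invariance of the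
  relevant integrals is recovered by counting cosets.\<close>

locale hecke_pair = group G for G :: "'g monoid" (structure) +
  fixes K :: "'g set" and \<psi> :: "'g \<Rightarrow> complex" and \<mu> :: "'g measure"
  assumes carrier_UNIV [simp]: "carrier G = UNIV"
    and K_subgroup: "subgroup K G"
    and char_mult: "k \<in> K \<Longrightarrow> k' \<in> K \<Longrightarrow> \<psi> (k \<otimes> k') = \<psi> k * \<psi> k'"
    and char_1 [simp]: "\<psi> \<one> = 1"
    and coset_sets: "{y. inv x \<otimes> y \<in> K} \<in> sets \<mu>"
    and coset_measure: "emeasure \<mu> {y. inv x \<otimes> y \<in> K} = 1"
begin

lemma K_closed [simp, intro]: "\<one> \<in> K" "k \<in> K \<Longrightarrow> k' \<in> K \<Longrightarrow> k \<otimes> k' \<in> K" "k \<in> K \<Longrightarrow> inv k \<in> K"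
  using K_subgroup by (auto simp: subgroup_def)

lemma assoc: "x \<otimes> y \<otimes> z = x \<otimes> (y \<otimes> z)"
  by (rule m_assoc) simp_all

lemma cancel [simp]: "inv x \<otimes> x = \<one>" "x \<otimes> inv x = \<one>" "inv x \<otimes> (x \<otimes> y) = y" "x \<otimes> (inv x \<otimes> y) = y"
  "\<one> \<otimes> x = x" "x \<otimes> \<one> = x" "inv (inv x) = x" "inv \<one> = \<one>"
  by (simp_all flip: assoc)

lemma inv_mult: "inv (x \<otimes> y) = inv y \<otimes> inv x"
  by (rule inv_mult_group) simp_all

lemma char_inv: "k \<in> K \<Longrightarrow> \<psi> k * \<psi> (inv k) = 1"
  using char_mult[of k "inv k"] by simp

lemma K_mult_iff: "k \<in> K \<Longrightarrow> k \<otimes> x \<in> K \<longleftrightarrow> x \<in> K" "k \<in> K \<Longrightarrow> x \<otimes> k \<in> K \<longleftrightarrow> x \<in> K"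
proof -
  assume k: "k \<in> K"
  show "k \<otimes> x \<in> K \<longleftrightarrow> x \<in> K"
  proof
    assume "k \<otimes> x \<in> K"
    then have "inv k \<otimes> (k \<otimes> x) \<in> K" using k by blast
    then show "x \<in> K" by simp
  qed (use k in blast)
  show "x \<otimes> k \<in> K \<longleftrightarrow> x \<in> K"
  proof
    assume "x \<otimes> k \<in> K"
    then have "(x \<otimes> k) \<otimes> inv k \<in> K" using k by blast
    then show "x \<in> K" by (simp add: assoc)
  qed (use k in blast)
qed

text \<open>The combinatorial substitute for compact support: the support lies in finitely many left
  cosets r K.\<close>

definition covers :: "'g set \<Rightarrow> ('g \<Rightarrow> complex) \<Rightarrow> bool"
  where "covers R f \<longleftrightarrow> finite R \<and> (\<forall>g. f g \<noteq> 0 \<longrightarrow> (\<exists>r\<in>R. inv r \<otimes> g \<in> K))"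

definition separated :: "'g set \<Rightarrow> bool"
  where "separated R \<longleftrightarrow> (\<forall>r\<in>R. \<forall>r'\<in>R. inv r \<otimes> r' \<in> K \<longrightarrow> r = r')"

definition hecke_carrier :: "('g \<Rightarrow> complex) set"
  where "hecke_carrier = {f. (\<forall>k\<in>K. \<forall>k'\<in>K. \<forall>g. f (k \<otimes> g \<otimes> k') = \<psi> k * \<psi> k' * f g) \<and> (\<exists>R. covers R f)}"

definition conv :: "('g \<Rightarrow> complex) \<Rightarrow> ('g \<Rightarrow> complex) \<Rightarrow> 'g \<Rightarrow> complex"
  where "conv f1 f2 h = (\<integral>g. f1 g * f2 (inv g \<otimes> h) \<partial>\<mu>)"

definition hecke_one :: "'g \<Rightarrow> complex"
  where "hecke_one x = (if x \<in> K then \<psi> x else 0)"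

definition hecke_ring :: "(complex, 'g \<Rightarrow> complex) module"
  where "hecke_ring =
    \<lparr>carrier = hecke_carrier, monoid.mult = conv, one = hecke_one, zero = (\<lambda>x. 0),
     add = (\<lambda>f g x. f x + g x), smult = (\<lambda>c f x. c * f x)\<rparr>"

lemma hecke_ring_simps:
  "carrier hecke_ring = hecke_carrier" "f \<otimes>\<^bsub>hecke_ring\<^esub> g = conv f g" "\<one>\<^bsub>hecke_ring\<^esub> = hecke_one"
  "\<zero>\<^bsub>hecke_ring\<^esub> = (\<lambda>x. 0)" "f \<oplus>\<^bsub>hecke_ring\<^esub> g = (\<lambda>x. f x + g x)" "c \<odot>\<^bsub>hecke_ring\<^esub> f = (\<lambda>x. c * f x)"
  by (simp_all add: hecke_ring_def)

lemma same_coset_sym: "inv x \<otimes> y \<in> K \<Longrightarrow> inv y \<otimes> x \<in> K"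
  using K_closed(3)[of "inv x \<otimes> y"] by (simp add: inv_mult)

lemma same_coset_trans: "inv x \<otimes> y \<in> K \<Longrightarrow> inv y \<otimes> z \<in> K \<Longrightarrow> inv x \<otimes> z \<in> K"
  using K_closed(2)[of "inv x \<otimes> y" "inv y \<otimes> z"] by (simp add: assoc)

lemma hecke_left: "f \<in> hecke_carrier \<Longrightarrow> k \<in> K \<Longrightarrow> f (k \<otimes> g) = \<psi> k * f g"
proof -
  assume "f \<in> hecke_carrier" "k \<in> K"
  then have "f (k \<otimes> g \<otimes> \<one>) = \<psi> k * \<psi> \<one> * f g"
    unfolding hecke_carrier_def using K_closed(1) by blast
  then show ?thesis by simp
qed

lemma hecke_right: "f \<in> hecke_carrier \<Longrightarrow> k \<in> K \<Longrightarrow> f (g \<otimes> k) = \<psi> k * f g"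
proof -
  assume "f \<in> hecke_carrier" "k \<in> K"
  then have "f (\<one> \<otimes> g \<otimes> k) = \<psi> \<one> * \<psi> k * f g"
    unfolding hecke_carrier_def using K_closed(1) by blast
  then show ?thesis by simp
qed

lemma hecke_carrierI:
  assumes "\<And>k g. k \<in> K \<Longrightarrow> f (k \<otimes> g) = \<psi> k * f g" "\<And>k g. k \<in> K \<Longrightarrow> f (g \<otimes> k) = \<psi> k * f g" "covers R f"
  shows "f \<in> hecke_carrier"
  using assms unfolding hecke_carrier_def by auto

lemma separated_coverE:
  assumes "covers R f"
  obtains R' where "covers R' f" "separated R'"
proof -
  have "finite R" using assms by (simp add: covers_def)
  then have "\<exists>R'. finite R' \<and> separated R' \<and> (\<forall>r\<in>R. \<exists>r'\<in>R'. inv r' \<otimes> r \<in> K)"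
  proof induction
    case empty
    then show ?case by (intro exI[of _ "{}"]) (simp add: separated_def)
  next
    case (insert x R)
    then obtain R' where R': "finite R'" "separated R'" "\<forall>r\<in>R. \<exists>r'\<in>R'. inv r' \<otimes> r \<in> K" by blast
    show ?case
    proof (cases "\<exists>r'\<in>R'. inv r' \<otimes> x \<in> K")
      case True
      then show ?thesis using R' by (intro exI[of _ R']) simp
    next
      case False
      then have "separated (insert x R')"
        using R'(2) same_coset_sym unfolding separated_def by blast
      then show ?thesis using R' by (intro exI[of _ "insert x R'"]) auto
    qed
  qed
  then obtain R' where R': "finite R'" "separated R'" "\<forall>r\<in>R. \<exists>r'\<in>R'. inv r' \<otimes> r \<in> K" by blast
  then have "covers R' f" using assms same_coset_trans unfolding covers_def by meson
  then show ?thesis using R'(2) that by blast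
qed

text \<open>A right \<open>K\<close>-invariant function with finitely many cosets in its support is
  a finite combination of coset indicators, each of integral 1.\<close>

lemma coset_integral:
  assumes inv: "\<And>g k. k \<in> K \<Longrightarrow> F (g \<otimes> k) = F g" and R: "covers R F" "separated R"
  shows "integrable \<mu> F" "(\<integral>g. F g \<partial>\<mu>) = (\<Sum>r\<in>R. F r)"
proof -
  let ?C = "\<lambda>r. {y. inv r \<otimes> y \<in> K}"
  have fin: "finite R" using R by (simp add: covers_def)
  have F: "F = (\<lambda>g. \<Sum>r\<in>R. indicator (?C r) g *\<^sub>R F r)"
  proof
    fix g
    show "F g = (\<Sum>r\<in>R. indicator (?C r) g *\<^sub>R F r)"
    proof (cases "\<exists>r\<in>R. inv r \<otimes> g \<in> K")
      case True
      then obtain r where r: "r \<in> R" "inv r \<otimes> g \<in> K" by blast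
      have "indicator (?C r') g = (0::real)" if "r' \<in> R - {r}" for r'
        using that r R(2) same_coset_trans[OF _ same_coset_sym[OF r(2)], of r']
        unfolding separated_def by (auto simp: indicator_def)
      then have "(\<Sum>r\<in>R. indicator (?C r) g *\<^sub>R F r) = indicator (?C r) g *\<^sub>R F r"
        using r fin by (subst sum.remove[of _ r]) auto
      moreover have "F g = F r" using inv[OF r(2), of r] by simp
      ultimately show ?thesis using r by simp
    next
      case False
      then have "F g = 0" using R(1) by (auto simp: covers_def)
      then show ?thesis using False by (auto intro!: sum.neutral)
    qed
  qed
  have ind: "integrable \<mu> (\<lambda>g. indicator (?C r) g *\<^sub>R F r)" for r
    by (intro integrable_scaleR_left integrable_real_indicator) (simp_all add: coset_sets coset_measure)
  show "integrable \<mu> F" by (subst F) (intro Bochner_Integration.integrable_sum ind)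
  have "(\<integral>g. F g \<partial>\<mu>) = (\<Sum>r\<in>R. \<integral>g. indicator (?C r) g *\<^sub>R F r \<partial>\<mu>)"
    by (subst F) (intro Bochner_Integration.integral_sum ind)
  also have "\<dots> = (\<Sum>r\<in>R. F r)"
    by (intro sum.cong refl) (simp add: coset_sets coset_measure measure_def sets.Int_space_eq2)
  finally show "(\<integral>g. F g \<partial>\<mu>) = (\<Sum>r\<in>R. F r)" .
qed

text \<open>Left translation permutes the left cosets, so both integrals are the same finite
  sum.\<close>

lemma coset_integral_shift:
  assumes inv: "\<And>g k. k \<in> K \<Longrightarrow> F (g \<otimes> k) = F g" and R: "covers R F"
  shows "(\<integral>g. F (x \<otimes> g) \<partial>\<mu>) = (\<integral>g. F g \<partial>\<mu>)" "integrable \<mu> (\<lambda>g. F (x \<otimes> g))"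
proof -
  obtain R where R: "covers R F" "separated R" using separated_coverE[OF R] .
  let ?R = "(\<lambda>r. inv x \<otimes> r) ` R"
  have e: "inv (inv x \<otimes> r) \<otimes> g = inv r \<otimes> (x \<otimes> g)" for r g
    by (simp add: inv_mult assoc)
  have c: "covers ?R (\<lambda>g. F (x \<otimes> g))" using R(1) by (auto simp: covers_def e)
  have s: "separated ?R" using R(2) by (auto simp: separated_def e)
  have i: "F (x \<otimes> (g \<otimes> k)) = F (x \<otimes> g)" if "k \<in> K" for g k
    using inv[OF that, of "x \<otimes> g"] by (simp add: assoc)
  have inj: "inj_on (\<lambda>r. inv x \<otimes> r) R"
    by (rule inj_on_inverseI[of _ "\<lambda>r. x \<otimes> r"]) simp
  note shifted = coset_integral[where F = "\<lambda>g. F (x \<otimes> g)", OF i c s]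
  show "integrable \<mu> (\<lambda>g. F (x \<otimes> g))" by (rule shifted(1))
  have "(\<integral>g. F (x \<otimes> g) \<partial>\<mu>) = (\<Sum>r\<in>?R. F (x \<otimes> r))" by (rule shifted(2))
  also have "\<dots> = (\<Sum>r\<in>R. F r)" by (simp add: sum.reindex[OF inj])
  also have "\<dots> = (\<integral>g. F g \<partial>\<mu>)" by (rule coset_integral(2)[OF inv R, symmetric])
  finally show "(\<integral>g. F (x \<otimes> g) \<partial>\<mu>) = (\<integral>g. F g \<partial>\<mu>)" .
qed

lemma hecke_covers: "f \<in> hecke_carrier \<Longrightarrow> \<exists>R. covers R f"
  by (simp add: hecke_carrier_def)

text \<open>Right translation by k gives \<psi>(k) from the first factor and \<psi>(k^-1) from the
  second, so the integrand is constant on left cosets.\<close>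

lemma conv_integrand:
  assumes f: "f1 \<in> hecke_carrier" "f2 \<in> hecke_carrier"
  shows "k \<in> K \<Longrightarrow> f1 (g \<otimes> k) * f2 (inv (g \<otimes> k) \<otimes> h) = f1 g * f2 (inv g \<otimes> h)"
    and "covers R f1 \<Longrightarrow> covers R (\<lambda>g. f1 g * f2 (inv g \<otimes> h))"
proof -
  assume k: "k \<in> K"
  have "f1 (g \<otimes> k) * f2 (inv (g \<otimes> k) \<otimes> h) = (\<psi> k * \<psi> (inv k)) * (f1 g * f2 (inv g \<otimes> h))"
    using k by (simp add: hecke_right[OF f(1)] inv_mult assoc hecke_left[OF f(2)])
  then show "f1 (g \<otimes> k) * f2 (inv (g \<otimes> k) \<otimes> h) = f1 g * f2 (inv g \<otimes> h)"
    using k by (simp add: char_inv)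
qed (auto simp: covers_def)

lemma conv_sum:
  assumes "f1 \<in> hecke_carrier" "f2 \<in> hecke_carrier" "covers R f1" "separated R"
  shows "conv f1 f2 h = (\<Sum>r\<in>R. f1 r * f2 (inv r \<otimes> h))"
  unfolding conv_def
  by (rule coset_integral(2)[OF conv_integrand(1)[OF assms(1,2)] conv_integrand(2)[OF assms(1-3)] assms(4)])

lemma conv_closed:
  assumes f: "f1 \<in> hecke_carrier" "f2 \<in> hecke_carrier"
  shows "conv f1 f2 \<in> hecke_carrier"
proof -
  obtain R0 where "covers R0 f1" using hecke_covers[OF f(1)] by blast
  then obtain R where R: "covers R f1" "separated R" by (rule separated_coverE)
  obtain R2 where R2: "covers R2 f2" using hecke_covers[OF f(2)] by blast
  note sum = conv_sum[OF f R]
  show ?thesis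
  proof (rule hecke_carrierI[where R = "(\<lambda>(r, r'). r \<otimes> r') ` (R \<times> R2)"])
    fix k g assume k: "k \<in> K"
    show "conv f1 f2 (g \<otimes> k) = \<psi> k * conv f1 f2 g"
      unfolding sum using hecke_right[OF f(2) k]
      by (simp add: sum_distrib_left mult_ac flip: assoc)
    \<comment> \<open>Left equivariance is not visible in the coset sum, where k would move the
      representatives; the substitution x -> k x under the integral brings it out.\<close>
    have "conv f1 f2 (k \<otimes> g) = (\<integral>x. f1 (k \<otimes> x) * f2 (inv (k \<otimes> x) \<otimes> (k \<otimes> g)) \<partial>\<mu>)"
      unfolding conv_def
      by (rule coset_integral_shift(1)[symmetric, OF conv_integrand(1)[OF f] conv_integrand(2)[OF f R(1)]])
    also have "\<dots> = (\<integral>x. \<psi> k * (f1 x * f2 (inv x \<otimes> g)) \<partial>\<mu>)"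
      using k by (intro Bochner_Integration.integral_cong refl)
        (simp add: hecke_left[OF f(1)] inv_mult assoc)
    also have "\<dots> = \<psi> k * conv f1 f2 g" by (simp add: conv_def)
    finally show "conv f1 f2 (k \<otimes> g) = \<psi> k * conv f1 f2 g" .
  next
    have "\<exists>r\<in>R. \<exists>r'\<in>R2. inv (r \<otimes> r') \<otimes> g \<in> K" if "conv f1 f2 g \<noteq> 0" for g
    proof -
      from that obtain r where "r \<in> R" "f2 (inv r \<otimes> g) \<noteq> 0"
        unfolding sum by (metis (no_types, lifting) sum.neutral mult_zero_right)
      then obtain r' where "r' \<in> R2" "inv r' \<otimes> (inv r \<otimes> g) \<in> K"
        using R2 by (auto simp: covers_def)
      then show ?thesis using \<open>r \<in> R\<close> by (auto simp: inv_mult assoc)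
    qed
    then show "covers ((\<lambda>(r, r'). r \<otimes> r') ` (R \<times> R2)) (conv f1 f2)"
      using R R2 by (auto simp: covers_def)
  qed
qed

text \<open>Only the inner convolution is expanded into a finite sum. Each term is then an integral
  translated by its representative r, and undoing the translation yields the inner convolution of
  the other bracketing.\<close>

lemma conv_assoc:
  assumes f: "f1 \<in> hecke_carrier" "f2 \<in> hecke_carrier" "f3 \<in> hecke_carrier"
  shows "conv (conv f1 f2) f3 = conv f1 (conv f2 f3)"
proof
  fix h
  obtain R0 where "covers R0 f1" using hecke_covers[OF f(1)] by blast
  then obtain R where R: "covers R f1" "separated R" by (rule separated_coverE)
  obtain R2 where R2: "covers R2 f2" using hecke_covers[OF f(2)] by blast
  note F = conv_integrand(1)[OF f(2,3)] conv_integrand(2)[OF f(2,3) R2]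
  note shift = coset_integral_shift[OF F]
  have "conv (conv f1 f2) f3 h = (\<integral>y. (\<Sum>r\<in>R. f1 r * (f2 (inv r \<otimes> y) * f3 (inv (inv r \<otimes> y) \<otimes> (inv r \<otimes> h)))) \<partial>\<mu>)"
    unfolding conv_def[of "conv f1 f2"] conv_sum[OF f(1,2) R]
    by (simp add: sum_distrib_right mult.assoc inv_mult assoc)
  also have "\<dots> = (\<Sum>r\<in>R. (\<integral>y. f1 r * (f2 (inv r \<otimes> y) * f3 (inv (inv r \<otimes> y) \<otimes> (inv r \<otimes> h))) \<partial>\<mu>))"
    by (intro Bochner_Integration.integral_sum integrable_mult_right shift(2))
  also have "\<dots> = (\<Sum>r\<in>R. f1 r * (\<integral>y. f2 (inv r \<otimes> y) * f3 (inv (inv r \<otimes> y) \<otimes> (inv r \<otimes> h)) \<partial>\<mu>))"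
    by (intro sum.cong refl integral_mult_right_zero)
  also have "\<dots> = (\<Sum>r\<in>R. f1 r * conv f2 f3 (inv r \<otimes> h))"
    unfolding conv_def by (intro sum.cong refl arg_cong2[where f = "(*)"]) (rule shift(1))
  also have "\<dots> = conv f1 (conv f2 f3) h"
    by (rule conv_sum[OF f(1) conv_closed[OF f(2,3)] R, symmetric])
  finally show "conv (conv f1 f2) f3 h = conv f1 (conv f2 f3) h" .
qed

lemma hecke_one_carrier: "hecke_one \<in> hecke_carrier"
  by (rule hecke_carrierI[where R = "{\<one>}"]) (auto simp: hecke_one_def char_mult K_mult_iff covers_def)

lemma conv_one_left: "f \<in> hecke_carrier \<Longrightarrow> conv hecke_one f = f"
  by (rule ext, subst conv_sum[where R = "{\<one>}"])
    (auto simp: hecke_one_carrier hecke_one_def covers_def separated_def split: if_splits)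

lemma conv_one_right:
  assumes f: "f \<in> hecke_carrier"
  shows "conv f hecke_one = f"
proof
  fix h
  obtain R0 where "covers R0 f" using hecke_covers[OF f] by blast
  then obtain R where R: "covers R f" "separated R" by (rule separated_coverE)
  have fin: "finite R" using R by (simp add: covers_def)
  have fr: "f r * \<psi> (inv r \<otimes> h) = f h" if "inv r \<otimes> h \<in> K" for r
    using hecke_right[OF f that, of r] by (simp add: mult.commute)
  have "conv f hecke_one h = (\<Sum>r\<in>R. if inv r \<otimes> h \<in> K then f h else 0)"
    unfolding conv_sum[OF f hecke_one_carrier R]
    by (intro sum.cong refl) (simp add: hecke_one_def fr)
  also have "\<dots> = f h"
  proof (cases "f h = 0")
    case False
    then obtain r where r: "r \<in> R" "inv r \<otimes> h \<in> K" using R(1) by (auto simp: covers_def)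
    have "\<not> inv r' \<otimes> h \<in> K" if "r' \<in> R - {r}" for r'
      using that r R(2) same_coset_trans[OF _ same_coset_sym[OF r(2)], of r'] by (auto simp: separated_def)
    then show ?thesis using r fin by (subst sum.remove[of _ r]) auto
  qed (simp cong: if_cong)
  finally show "conv f hecke_one h = f h" .
qed

lemma covers_add: "covers R f \<Longrightarrow> covers R' g \<Longrightarrow> covers (R \<union> R') (\<lambda>x. a * f x + b * g x)"
  unfolding covers_def by (metis Un_iff add_0 finite_UnI mult_zero_right)

lemma hecke_lin: "f \<in> hecke_carrier \<Longrightarrow> g \<in> hecke_carrier \<Longrightarrow> (\<lambda>x. a * f x + b * g x) \<in> hecke_carrier"
  using covers_add hecke_covers[of f] hecke_covers[of g]
  by (auto intro!: hecke_carrierI simp: hecke_left hecke_right algebra_simps)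

lemma hecke_zero: "(\<lambda>x. 0) \<in> hecke_carrier"
  by (rule hecke_carrierI[where R = "{}"]) (auto simp: covers_def)

lemma conv_lin_right:
  assumes "f \<in> hecke_carrier" "g \<in> hecke_carrier" "g' \<in> hecke_carrier"
  shows "conv f (\<lambda>x. a * g x + b * g' x) = (\<lambda>x. a * conv f g x + b * conv f g' x)"
proof
  fix h
  obtain R0 where "covers R0 f" using hecke_covers[OF assms(1)] by blast
  then obtain R where R: "covers R f" "separated R" by (rule separated_coverE)
  show "conv f (\<lambda>x. a * g x + b * g' x) h = a * conv f g h + b * conv f g' h"
    using assms by (simp add: conv_sum[OF _ _ R] hecke_lin sum_distrib_left sum.distrib algebra_simps)
qed

lemma conv_lin_left:
  assumes "f \<in> hecke_carrier" "g \<in> hecke_carrier" "g' \<in> hecke_carrier"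
  shows "conv (\<lambda>x. a * g x + b * g' x) f = (\<lambda>x. a * conv g f x + b * conv g' f x)"
proof
  fix h
  obtain R1 R2 where "covers R1 g" "covers R2 g'" using hecke_covers assms by blast
  \<comment> \<open>All three convolutions have to be expanded over the same representatives, so the
    cover is taken for the union of the supports of \<open>g\<close> and \<open>g'\<close>.\<close>
  then have "covers (R1 \<union> R2) (\<lambda>x. if g x \<noteq> 0 \<or> g' x \<noteq> 0 then 1 else 0)"
    unfolding covers_def by auto
  then obtain R where R: "covers R (\<lambda>x. if g x \<noteq> 0 \<or> g' x \<noteq> 0 then 1 else 0)" "separated R"
    by (rule separated_coverE)
  have c: "covers R g" "covers R g'"
    using R(1) unfolding covers_def by (auto split: if_splits)
  then have c3: "covers R (\<lambda>x. a * g x + b * g' x)"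
    unfolding covers_def by (metis add_0 mult_zero_right)
  show "conv (\<lambda>x. a * g x + b * g' x) f h = a * conv g f h + b * conv g' f h"
    using assms by (simp add: conv_sum[OF _ _ c(1) R(2)] conv_sum[OF _ _ c(2) R(2)]
        conv_sum[OF _ _ c3 R(2)] hecke_lin sum_distrib_left sum.distrib algebra_simps)
qed

lemma hecke_ring_algebra: "complex_algebra hecke_ring"
proof -
  note lin = hecke_lin[of _ _ 1 1, simplified] hecke_lin[of _ "\<lambda>_. 0" _ 0, simplified, OF _ hecke_zero]
  have "ring hecke_ring"
  proof (intro ringI abelian_groupI monoidI)
    fix f assume f: "f \<in> carrier hecke_ring"
    then have "(\<lambda>x. - f x) \<in> hecke_carrier"
      using lin(2)[of f "- 1"] by (simp add: hecke_ring_def)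
    then show "\<exists>g\<in>carrier hecke_ring. g \<oplus>\<^bsub>hecke_ring\<^esub> f = \<zero>\<^bsub>hecke_ring\<^esub>"
      by (intro bexI[of _ "\<lambda>x. - f x"]) (simp_all add: hecke_ring_def)
  next
    fix f g h assume "f \<in> carrier hecke_ring" "g \<in> carrier hecke_ring" "h \<in> carrier hecke_ring"
    then show "(f \<oplus>\<^bsub>hecke_ring\<^esub> g) \<otimes>\<^bsub>hecke_ring\<^esub> h = f \<otimes>\<^bsub>hecke_ring\<^esub> h \<oplus>\<^bsub>hecke_ring\<^esub> g \<otimes>\<^bsub>hecke_ring\<^esub> h"
      "h \<otimes>\<^bsub>hecke_ring\<^esub> (f \<oplus>\<^bsub>hecke_ring\<^esub> g) = h \<otimes>\<^bsub>hecke_ring\<^esub> f \<oplus>\<^bsub>hecke_ring\<^esub> h \<otimes>\<^bsub>hecke_ring\<^esub> g"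
      using conv_lin_left[of h f g 1 1] conv_lin_right[of h f g 1 1] by (simp_all add: hecke_ring_def)
  qed (auto simp: hecke_ring_def lin hecke_zero hecke_one_carrier conv_closed conv_assoc conv_one_left
      conv_one_right algebra_simps)
  then show ?thesis
  proof (intro complex_algebra.intro complex_algebra_axioms.intro)
    fix f g c assume "f \<in> carrier hecke_ring" "g \<in> carrier hecke_ring"
    then have fg: "f \<in> hecke_carrier" "g \<in> hecke_carrier" by (simp_all add: hecke_ring_def)
    show "(c \<odot>\<^bsub>hecke_ring\<^esub> f) \<otimes>\<^bsub>hecke_ring\<^esub> g = c \<odot>\<^bsub>hecke_ring\<^esub> (f \<otimes>\<^bsub>hecke_ring\<^esub> g)"
      "f \<otimes>\<^bsub>hecke_ring\<^esub> (c \<odot>\<^bsub>hecke_ring\<^esub> g) = c \<odot>\<^bsub>hecke_ring\<^esub> (f \<otimes>\<^bsub>hecke_ring\<^esub> g)"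
      using conv_lin_left[OF fg(2,1) hecke_zero, of c 0] conv_lin_right[OF fg hecke_zero, of c 0]
      by (simp_all add: hecke_ring_def)
  qed (auto simp: hecke_ring_def lin algebra_simps)
qed

lemma hecke_ring_finsum:
  assumes "\<And>w. w \<in> S \<Longrightarrow> f w \<in> hecke_carrier" "finite S"
  shows "finsum hecke_ring f S = (\<lambda>x. \<Sum>w\<in>S. f w x)"
proof -
  interpret H: complex_algebra hecke_ring by (rule hecke_ring_algebra)
  show ?thesis
    using assms(2,1)
  proof induction
    case empty
    show ?case unfolding H.finsum_empty by (simp add: hecke_ring_simps)
  next
    case (insert x S)
    then have "finsum hecke_ring f (insert x S) = f x \<oplus>\<^bsub>hecke_ring\<^esub> finsum hecke_ring f S"
      by (intro H.finsum_insert) (auto simp: hecke_ring_simps)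
    then show ?case using insert by (simp add: hecke_ring_simps)
  qed
qed

end

section \<open>Hecke algebras of infinite dihedral type\<close>

text \<open>
  \<open>s i\<close> are the simple reflections and \<open>N i\<close> the root subgroups of \<open>K\<close> that \<open>s i\<close> does not
  normalise; \<open>x i b\<close> represent the cosets of \<open>K \<inter> s i K (s i)\<^sup>-\<^sup>1\<close> in \<open>K\<close>.
\<close>
locale dihedral_hecke = hecke_pair G K \<psi> \<mu>
  for G :: "'g monoid" (structure) and K :: "'g set" and \<psi> :: "'g \<Rightarrow> complex" and \<mu> :: "'g measure" +
  fixes s :: "'i \<Rightarrow> 'g" and N :: "'i \<Rightarrow> 'g set" and x :: "'i \<Rightarrow> nat \<Rightarrow> 'g" and q :: nat
    and c :: "'i \<Rightarrow> complex" and \<eta> :: "'i \<Rightarrow> nat \<Rightarrow> complex" and \<omega> :: "'i list \<Rightarrow> 'g"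
  assumes s_sq: "s i \<otimes> s i \<in> K"
    and N_K: "n \<in> N i \<Longrightarrow> n \<in> K"
    and N_conj: "i \<noteq> j \<Longrightarrow> n \<in> N i \<Longrightarrow> inv (s j) \<otimes> n \<otimes> s j \<in> N j"
    and conj_char: "k \<in> K \<Longrightarrow> inv (s i) \<otimes> k \<otimes> s i \<in> K \<Longrightarrow> \<psi> (inv (s i) \<otimes> k \<otimes> s i) = \<psi> k"
    and factor: "k \<in> K \<Longrightarrow> \<exists>k1 n. k = k1 \<otimes> n \<and> n \<in> N i \<and> s i \<otimes> k1 \<otimes> inv (s i) \<in> K"
    and x_K: "x i b \<in> K" and x_char: "\<psi> (x i b) = 1" and x_0: "x i 0 = \<one>"
    and x_cover: "k \<in> K \<Longrightarrow> \<exists>b<q. inv (s i) \<otimes> (inv (x i b) \<otimes> k) \<otimes> s i \<in> K"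
    and x_distinct: "b < q \<Longrightarrow> b' < q \<Longrightarrow> inv (s i) \<otimes> (inv (x i b) \<otimes> x i b') \<otimes> s i \<in> K \<Longrightarrow> b = b'"
    and big_cell: "0 < b \<Longrightarrow> b < q \<Longrightarrow>
      \<exists>k\<in>K. \<exists>k'\<in>K. inv (s i) \<otimes> inv (x i b) \<otimes> s i = k \<otimes> s i \<otimes> k' \<and> \<psi> k * \<psi> k' = \<eta> i b"
    and q_pos: "0 < q" and c_nonzero: "c i \<noteq> 0"
    and \<omega>_Nil: "\<omega> [] = \<one>" and \<omega>_Cons: "\<omega> (i # v) = s i \<otimes> \<omega> v"
    and \<omega>_notin_K: "distinct_adj v \<Longrightarrow> v \<noteq> [] \<Longrightarrow> \<omega> v \<notin> K"
    and generated: "\<one> \<in> S \<Longrightarrow> (\<And>k y. k \<in> K \<Longrightarrow> y \<in> S \<Longrightarrow> k \<otimes> y \<in> S) \<Longrightarrow>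
      (\<And>i y. y \<in> S \<Longrightarrow> s i \<otimes> y \<in> S) \<Longrightarrow> S = UNIV"
begin

lemma big_cellE:
  assumes "b \<in> {0<..<q}"
  obtains k k' where "k \<in> K" "k' \<in> K" "inv (s i) \<otimes> inv (x i b) \<otimes> s i = k \<otimes> s i \<otimes> k'"
    "\<psi> k * \<psi> k' = \<eta> i b"
proof -
  have "0 < b" "b < q" using assms by simp_all
  from big_cell[OF this, of i] show ?thesis by (elim bexE conjE) (rule that)
qed

section \<open>Double cosets of reduced words\<close>

definition dcos :: "'g \<Rightarrow> 'g set"
  where "dcos g = {h. \<exists>k\<in>K. \<exists>k'\<in>K. h = k \<otimes> g \<otimes> k'}"

lemma dcosI: "k \<in> K \<Longrightarrow> k' \<in> K \<Longrightarrow> k \<otimes> g \<otimes> k' \<in> dcos g"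
  unfolding dcos_def by blast

lemma dcos_self [simp]: "g \<in> dcos g"
  using dcosI[of \<one> \<one> g] by simp

lemma dcos_mult: "h \<in> dcos g \<Longrightarrow> k \<in> K \<Longrightarrow> k' \<in> K \<Longrightarrow> k \<otimes> h \<otimes> k' \<in> dcos g"
proof -
  assume "h \<in> dcos g" and k: "k \<in> K" "k' \<in> K"
  then obtain l l' where l: "l \<in> K" "l' \<in> K" "h = l \<otimes> g \<otimes> l'" by (auto simp: dcos_def)
  have "k \<otimes> h \<otimes> k' = (k \<otimes> l) \<otimes> g \<otimes> (l' \<otimes> k')" by (simp add: l assoc)
  then show ?thesis using dcosI[of "k \<otimes> l" "l' \<otimes> k'" g] k l by simp
qed

lemma dcos_mult_left: "h \<in> dcos g \<Longrightarrow> k \<in> K \<Longrightarrow> k \<otimes> h \<in> dcos g"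
  and dcos_mult_right: "h \<in> dcos g \<Longrightarrow> k \<in> K \<Longrightarrow> h \<otimes> k \<in> dcos g"
  using dcos_mult[of h g k \<one>] dcos_mult[of h g \<one> k] by simp_all

lemma dcos_sym: "h \<in> dcos g \<Longrightarrow> g \<in> dcos h"
proof -
  assume "h \<in> dcos g"
  then obtain k k' where k: "k \<in> K" "k' \<in> K" "h = k \<otimes> g \<otimes> k'" by (auto simp: dcos_def)
  have "g = inv k \<otimes> h \<otimes> inv k'" by (simp add: k assoc)
  then show ?thesis using dcosI[of "inv k" "inv k'" h] k by simp
qed

lemma dcos_trans: "h \<in> dcos g \<Longrightarrow> l \<in> dcos h \<Longrightarrow> l \<in> dcos g"
  using dcos_mult unfolding dcos_def[of h] by blast

lemma dcos_inv: "h \<in> dcos g \<Longrightarrow> inv h \<in> dcos (inv g)"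
proof -
  assume "h \<in> dcos g"
  then obtain k k' where k: "k \<in> K" "k' \<in> K" "h = k \<otimes> g \<otimes> k'" by (auto simp: dcos_def)
  have "inv h = inv k' \<otimes> inv g \<otimes> inv k" by (simp add: k assoc inv_mult)
  then show ?thesis using dcosI[of "inv k'" "inv k" "inv g"] k by simp
qed

lemma dcos_one: "g \<in> dcos \<one> \<longleftrightarrow> g \<in> K"
  using dcosI[of g \<one> \<one>] by (auto simp: dcos_def)

lemma s_inv: "inv (s i) = s i \<otimes> inv (s i \<otimes> s i)"
  by (simp add: inv_mult)

lemma s_inv_dcos: "inv (s i) \<in> dcos (s i)"
  unfolding s_inv by (intro dcos_mult_right dcos_self K_closed s_sq)

lemma s_notin_K: "s i \<notin> K"
  using \<omega>_notin_K[of "[i]"] by (simp add: \<omega>_Cons \<omega>_Nil)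

lemma distinct_adj_tl: "distinct_adj (i # v) \<Longrightarrow> distinct_adj v"
  by (cases v) auto

lemma distinct_adj_ConsI: "distinct_adj v \<Longrightarrow> (\<And>w. v \<noteq> i # w) \<Longrightarrow> distinct_adj (i # v)"
  by (cases v) auto

text \<open>Along a reduced word each reflection carries the current root subgroup into the one
  attached to its own letter, so the conjugate never leaves \<open>K\<close>: positive roots stay
  positive.\<close>

lemma word_conj: "distinct_adj (i # v) \<Longrightarrow> n \<in> N i \<Longrightarrow> inv (\<omega> v) \<otimes> n \<otimes> \<omega> v \<in> K"
proof (induction v arbitrary: i n)
  case Nil
  then show ?case by (simp add: \<omega>_Nil N_K)
next
  case (Cons j v)
  then have "inv (\<omega> v) \<otimes> (inv (s j) \<otimes> n \<otimes> s j) \<otimes> \<omega> v \<in> K"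
    using N_conj[of i j n] by auto
  then show ?case by (simp add: \<omega>_Cons inv_mult assoc)
qed

text \<open>Lengthening case of the multiplication rule: in the factorisation k = k1 n the factor k1
  passes to the left through s_i, and n passes to the right through the word.\<close>

lemma s_K_word:
  assumes "distinct_adj (i # v)" "k \<in> K"
  shows "s i \<otimes> (k \<otimes> \<omega> v) \<in> dcos (\<omega> (i # v))"
proof -
  obtain k1 n where k: "k = k1 \<otimes> n" "n \<in> N i" "s i \<otimes> k1 \<otimes> inv (s i) \<in> K"
    using factor[OF assms(2), of i] by blast
  have "s i \<otimes> (k \<otimes> \<omega> v) = (s i \<otimes> k1 \<otimes> inv (s i)) \<otimes> \<omega> (i # v) \<otimes> (inv (\<omega> v) \<otimes> n \<otimes> \<omega> v)"
    by (simp add: k \<omega>_Cons assoc)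
  then show ?thesis using dcosI[OF k(3) word_conj[OF assms(1) k(2)], of "\<omega> (i # v)"] by simp
qed

text \<open>Replacing k by its representative x_b leaves s_i^-1 x_b s_i to decide. It is trivial for
  b = 0 and, being inverse to a big cell element, lies in K s_i K otherwise.\<close>

lemma s_K_s:
  assumes "k \<in> K"
  shows "s i \<otimes> (k \<otimes> s i) \<in> K \<or> s i \<otimes> (k \<otimes> s i) \<in> dcos (s i)"
proof -
  obtain b where b: "b < q" "inv (s i) \<otimes> (inv (x i b) \<otimes> k) \<otimes> s i \<in> K"
    using x_cover[OF assms] by blast
  have e: "s i \<otimes> (k \<otimes> s i) = (s i \<otimes> s i) \<otimes> (inv (s i) \<otimes> x i b \<otimes> s i) \<otimes> (inv (s i) \<otimes> (inv (x i b) \<otimes> k) \<otimes> s i)"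
    by (simp add: assoc)
  show ?thesis
  proof (cases "b = 0")
    case True
    then show ?thesis unfolding e using b(2) s_sq by (simp add: x_0 K_mult_iff)
  next
    case False
    then obtain l l' where "l \<in> K" "l' \<in> K" "inv (s i) \<otimes> inv (x i b) \<otimes> s i = l \<otimes> s i \<otimes> l'"
      using big_cell[of b i] b(1) by auto
    then have "inv (s i) \<otimes> inv (x i b) \<otimes> s i \<in> dcos (s i)" by (auto intro: dcosI)
    then have "inv (inv (s i) \<otimes> inv (x i b) \<otimes> s i) \<in> dcos (inv (s i))" by (rule dcos_inv)
    then have "inv (s i) \<otimes> x i b \<otimes> s i \<in> dcos (s i)"
      using dcos_trans[OF s_inv_dcos] by (simp add: inv_mult assoc)
    then show ?thesis unfolding e by (intro disjI2 dcos_mult[OF _ s_sq b(2)])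
  qed
qed

lemma s_K_s_word:
  assumes "distinct_adj (i # v)" "k \<in> K"
  shows "s i \<otimes> (k \<otimes> \<omega> (i # v)) \<in> dcos (\<omega> v) \<or> s i \<otimes> (k \<otimes> \<omega> (i # v)) \<in> dcos (\<omega> (i # v))"
proof -
  have e: "s i \<otimes> (k \<otimes> \<omega> (i # v)) = (s i \<otimes> (k \<otimes> s i)) \<otimes> \<omega> v" by (simp add: \<omega>_Cons assoc)
  from s_K_s[OF assms(2), of i] show ?thesis
  proof
    assume "s i \<otimes> (k \<otimes> s i) \<in> K"
    then show ?thesis unfolding e by (intro disjI1 dcos_mult_left dcos_self)
  next
    assume "s i \<otimes> (k \<otimes> s i) \<in> dcos (s i)"
    then obtain l l' where l: "l \<in> K" "l' \<in> K" "s i \<otimes> (k \<otimes> s i) = l \<otimes> s i \<otimes> l'" by (auto simp: dcos_def)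
    have "l \<otimes> (s i \<otimes> (l' \<otimes> \<omega> v)) \<in> dcos (\<omega> (i # v))"
      by (intro dcos_mult_left s_K_word assms l)
    then show ?thesis unfolding e l(3) by (simp add: assoc)
  qed
qed

text \<open>By the two multiplication rules the union of these double cosets is stable under left
  multiplication by \<open>K\<close> and by every reflection.\<close>

lemma dcos_word_exhaust: "\<exists>v. distinct_adj v \<and> g \<in> dcos (\<omega> v)"
proof -
  let ?S = "{g. \<exists>v. distinct_adj v \<and> g \<in> dcos (\<omega> v)}"
  have "?S = UNIV"
  proof (rule generated)
    show "\<one> \<in> ?S" by (intro CollectI exI[of _ "[]"]) (simp add: \<omega>_Nil)
    show "k \<otimes> y \<in> ?S" if "k \<in> K" "y \<in> ?S" for k y
      using that dcos_mult_left by blast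
    fix i y assume "y \<in> ?S"
    then obtain v k k' where v: "distinct_adj v" "k \<in> K" "k' \<in> K" "y = k \<otimes> \<omega> v \<otimes> k'"
      by (auto simp: dcos_def)
    have "\<exists>w. distinct_adj w \<and> s i \<otimes> (k \<otimes> \<omega> v) \<in> dcos (\<omega> w)"
    proof (cases "\<exists>w. v = i # w")
      case True
      then obtain w where w: "v = i # w" by blast
      have d: "distinct_adj (i # w)" "distinct_adj w"
        using v(1) distinct_adj_tl unfolding w by simp_all
      show ?thesis using s_K_s_word[OF d(1) v(2)] d unfolding w by blast
    next
      case False
      then have "distinct_adj (i # v)" by (intro distinct_adj_ConsI v(1)) auto
      then show ?thesis using s_K_word[OF _ v(2)] by blast
    qed
    then obtain w where w: "distinct_adj w" "s i \<otimes> (k \<otimes> \<omega> v) \<in> dcos (\<omega> w)" by blast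
    have "s i \<otimes> y = s i \<otimes> (k \<otimes> \<omega> v) \<otimes> k'" by (simp add: v assoc)
    then have "s i \<otimes> y \<in> dcos (\<omega> w)" using dcos_mult_right[OF w(2) v(3)] by simp
    then show "s i \<otimes> y \<in> ?S" using w(1) by blast
  qed
  then show ?thesis by blast
qed

text \<open>Stripping the first letter i of the shorter word puts s_i k \<omega>(w), for some k in
  \<open>K\<close>, into the double coset of v. The multiplication rules also place it in that of w
  without its leading i, of w itself, or of i # w. Induction equates v with one of these words, and
  lengths exclude all but the first.\<close>

lemma dcos_word_unique_aux:
  "distinct_adj v \<Longrightarrow> distinct_adj w \<Longrightarrow> length v \<le> length w \<Longrightarrow> \<omega> w \<in> dcos (\<omega> v) \<Longrightarrow> v = w"
proof (induction v arbitrary: w)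
  case Nil
  then show ?case using \<omega>_notin_K[of w] by (auto simp: \<omega>_Nil dcos_one)
next
  case (Cons i v)
  have v: "distinct_adj v" using Cons.prems(1) by (rule distinct_adj_tl)
  from Cons.prems(4) have "s i \<otimes> \<omega> v \<in> dcos (\<omega> w)" using dcos_sym by (simp add: \<omega>_Cons)
  then obtain k k' where k: "k \<in> K" "k' \<in> K" "s i \<otimes> \<omega> v = k \<otimes> \<omega> w \<otimes> k'" by (auto simp: dcos_def)
  let ?k = "inv (s i \<otimes> s i) \<otimes> k"
  have k2: "?k \<in> K" using k s_sq by blast
  have "\<omega> v = inv (s i) \<otimes> (s i \<otimes> \<omega> v)" by simp
  also have "\<dots> = s i \<otimes> (?k \<otimes> \<omega> w) \<otimes> k'" unfolding k(3) by (subst s_inv) (simp add: assoc)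
  finally have "\<omega> v \<otimes> inv k' = s i \<otimes> (?k \<otimes> \<omega> w)" by (simp add: assoc)
  moreover have "\<omega> v \<otimes> inv k' \<in> dcos (\<omega> v)" using k by (intro dcos_mult_right dcos_self K_closed)
  ultimately have sv: "s i \<otimes> (?k \<otimes> \<omega> w) \<in> dcos (\<omega> v)" by simp
  have step: "v = w'" if "distinct_adj w'" "length v \<le> length w'" "s i \<otimes> (?k \<otimes> \<omega> w) \<in> dcos (\<omega> w')" for w'
    using Cons.IH[OF v that(1,2)] dcos_trans[OF sv dcos_sym[OF that(3)]] by blast
  show ?case
  proof (cases "\<exists>w'. w = i # w'")
    case True
    then obtain w' where w: "w = i # w'" by blast
    have "v = w' \<or> v = w"
      using s_K_s_word[of i w' ?k] k2 step[of w'] step[of w] Cons.prems(2,3)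
        distinct_adj_tl[OF Cons.prems(2)[unfolded w]]
      unfolding w by auto
    then show ?thesis using Cons.prems(3) w by auto
  next
    case False
    then have d: "distinct_adj (i # w)" by (intro distinct_adj_ConsI Cons.prems(2)) auto
    have "v = i # w" using step[OF d] s_K_word[OF d k2] Cons.prems(3) by simp
    then show ?thesis using Cons.prems(3) by simp
  qed
qed

lemma dcos_word_unique:
  "distinct_adj v \<Longrightarrow> distinct_adj w \<Longrightarrow> g \<in> dcos (\<omega> v) \<Longrightarrow> g \<in> dcos (\<omega> w) \<Longrightarrow> v = w"
proof -
  assume d: "distinct_adj v" "distinct_adj w" and g: "g \<in> dcos (\<omega> v)" "g \<in> dcos (\<omega> w)"
  have "\<omega> w \<in> dcos (\<omega> v)" "\<omega> v \<in> dcos (\<omega> w)"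
    using g dcos_sym dcos_trans by blast+
  then show ?thesis
    using dcos_word_unique_aux[OF d] dcos_word_unique_aux[OF d(2,1)] by (cases "length v \<le> length w") auto
qed

subsection \<open>The generators\<close>

definition U :: "'i \<Rightarrow> 'g \<Rightarrow> complex"
  where "U i g = (if g \<in> dcos (s i)
    then c i * (THE z. \<exists>k\<in>K. \<exists>k'\<in>K. g = k \<otimes> s i \<otimes> k' \<and> z = \<psi> k * \<psi> k') else 0)"

text \<open>Two decompositions of one element differ by an element of \<open>K\<close> whose
  conjugate under s_i is again in \<open>K\<close>. Invariance of \<psi> under this conjugation
  makes \<psi> k \<psi> k' independent of the decomposition, so the description in \<open>U\<close>
  denotes a unique value.\<close>

lemma U_eq:
  assumes k: "k \<in> K" "k' \<in> K"
  shows "U i (k \<otimes> s i \<otimes> k') = c i * (\<psi> k * \<psi> k')"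
proof -
  have "\<psi> l * \<psi> l' = \<psi> k * \<psi> k'"
    if l: "l \<in> K" "l' \<in> K" and eq: "k \<otimes> s i \<otimes> k' = l \<otimes> s i \<otimes> l'" for l l'
  proof -
    have "inv (s i) \<otimes> (inv l \<otimes> k) \<otimes> s i = inv (s i) \<otimes> inv l \<otimes> (k \<otimes> s i \<otimes> k') \<otimes> inv k'"
      by (simp add: assoc)
    also have "\<dots> = l' \<otimes> inv k'" unfolding eq by (simp add: assoc)
    finally have m: "inv (s i) \<otimes> (inv l \<otimes> k) \<otimes> s i = l' \<otimes> inv k'" .
    have "\<psi> (l' \<otimes> inv k') = \<psi> (inv l \<otimes> k)"
      using conj_char[of "inv l \<otimes> k" i] k l unfolding m by blast
    then have "\<psi> l' * \<psi> (inv k') = \<psi> (inv l) * \<psi> k" using k l by (simp add: char_mult)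
    then have "(\<psi> l * \<psi> l') * (\<psi> k' * \<psi> (inv k')) = (\<psi> l * \<psi> (inv l)) * (\<psi> k * \<psi> k')"
      by (simp add: mult_ac)
    then show ?thesis using k l by (simp add: char_inv)
  qed
  note unique = this
  have "(THE z. \<exists>l\<in>K. \<exists>l'\<in>K. k \<otimes> s i \<otimes> k' = l \<otimes> s i \<otimes> l' \<and> z = \<psi> l * \<psi> l') = \<psi> k * \<psi> k'"
  proof (rule the_equality)
    show "\<exists>l\<in>K. \<exists>l'\<in>K. k \<otimes> s i \<otimes> k' = l \<otimes> s i \<otimes> l' \<and> \<psi> k * \<psi> k' = \<psi> l * \<psi> l'"
      by (intro bexI[OF _ k(1)] bexI[OF _ k(2)] conjI refl)
    fix z assume "\<exists>l\<in>K. \<exists>l'\<in>K. k \<otimes> s i \<otimes> k' = l \<otimes> s i \<otimes> l' \<and> z = \<psi> l * \<psi> l'"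
    then show "z = \<psi> k * \<psi> k'" by (elim bexE conjE) (simp only: unique)
  qed
  then show ?thesis using dcosI[OF k, of "s i"] by (simp add: U_def)
qed

lemma U_outside: "g \<notin> dcos (s i) \<Longrightarrow> U i g = 0"
  by (simp add: U_def)

lemma U_mult: "k \<in> K \<Longrightarrow> U i (k \<otimes> g) = \<psi> k * U i g" "k \<in> K \<Longrightarrow> U i (g \<otimes> k) = \<psi> k * U i g"
proof -
  assume k: "k \<in> K"
  have "U i (k \<otimes> g) = \<psi> k * U i g \<and> U i (g \<otimes> k) = \<psi> k * U i g"
  proof (cases "g \<in> dcos (s i)")
    case True
    then obtain l l' where l: "l \<in> K" "l' \<in> K" "g = l \<otimes> s i \<otimes> l'" by (auto simp: dcos_def)
    have "k \<otimes> g = (k \<otimes> l) \<otimes> s i \<otimes> l'" "g \<otimes> k = l \<otimes> s i \<otimes> (l' \<otimes> k)" by (simp_all add: l assoc)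
    then show ?thesis
      using U_eq[of "k \<otimes> l" l' i] U_eq[of l "l' \<otimes> k" i] U_eq[of l l' i] k l by (simp add: char_mult)
  next
    case False
    have "k \<otimes> g \<notin> dcos (s i)"
      using False dcos_mult_left[of "k \<otimes> g" "s i" "inv k"] k by auto
    moreover have "g \<otimes> k \<notin> dcos (s i)"
      using False dcos_mult_right[of "g \<otimes> k" "s i" "inv k"] k by (auto simp: assoc)
    ultimately show ?thesis using False by (simp add: U_outside)
  qed
  then show "U i (k \<otimes> g) = \<psi> k * U i g" "U i (g \<otimes> k) = \<psi> k * U i g" by simp_all
qed

definition reps :: "'i \<Rightarrow> 'g set"
  where "reps i = (\<lambda>b. x i b \<otimes> s i) ` {..<q}"

lemma reps_covers: "covers (reps i) (U i)"
proof -
  have "\<exists>b<q. inv (x i b \<otimes> s i) \<otimes> g \<in> K" if "U i g \<noteq> 0" for g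
  proof -
    have "g \<in> dcos (s i)" using that U_outside by blast
    then obtain k k' where k: "k \<in> K" "k' \<in> K" "g = k \<otimes> s i \<otimes> k'" by (auto simp: dcos_def)
    obtain b where "b < q" "inv (s i) \<otimes> (inv (x i b) \<otimes> k) \<otimes> s i \<in> K" using x_cover[OF k(1)] by blast
    then have "b < q" "inv (s i) \<otimes> (inv (x i b) \<otimes> k) \<otimes> s i \<otimes> k' \<in> K" using k by blast+
    then show ?thesis by (auto simp: k inv_mult assoc)
  qed
  then show ?thesis by (auto simp: covers_def reps_def)
qed

lemma reps_separated: "separated (reps i)"
  unfolding separated_def
proof (intro ballI impI)
  fix r r' assume "r \<in> reps i" "r' \<in> reps i" and K: "inv r \<otimes> r' \<in> K"
  then obtain b b' where b: "b < q" "b' < q" "r = x i b \<otimes> s i" "r' = x i b' \<otimes> s i"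
    by (auto simp: reps_def)
  have "inv (s i) \<otimes> (inv (x i b) \<otimes> x i b') \<otimes> s i \<in> K"
    using K by (simp add: b inv_mult assoc)
  then have "b = b'" by (rule x_distinct[OF b(1,2)])
  then show "r = r'" by (simp add: b)
qed

lemma reps_inj: "inj_on (\<lambda>b. x i b \<otimes> s i) {..<q}"
proof (rule inj_onI)
  fix b b' assume b: "b \<in> {..<q}" "b' \<in> {..<q}" and eq: "x i b \<otimes> s i = x i b' \<otimes> s i"
  have "inv (s i) \<otimes> (inv (x i b) \<otimes> x i b') \<otimes> s i = inv (x i b \<otimes> s i) \<otimes> (x i b' \<otimes> s i)"
    by (simp add: inv_mult assoc)
  also have "\<dots> = \<one>" unfolding eq by simp
  finally show "b = b'" using x_distinct[of b b' i] b by simp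
qed

lemma U_carrier: "U i \<in> hecke_carrier"
  by (rule hecke_carrierI[OF U_mult reps_covers])

lemma U_rep: "U i (x i b \<otimes> s i) = c i"
  using U_eq[of "x i b" \<one> i] by (simp add: x_K x_char)

lemma U_s: "U i (s i) = c i"
  using U_eq[of \<one> \<one> i] by simp

lemma conv_U:
  assumes "f \<in> hecke_carrier"
  shows "conv (U i) f h = c i * (\<Sum>b<q. f (inv (s i) \<otimes> (inv (x i b) \<otimes> h)))"
proof -
  have "conv (U i) f h = (\<Sum>r\<in>reps i. U i r * f (inv r \<otimes> h))"
    by (rule conv_sum[OF U_carrier assms reps_covers reps_separated])
  also have "\<dots> = (\<Sum>b<q. c i * f (inv (s i) \<otimes> (inv (x i b) \<otimes> h)))"
    unfolding reps_def by (subst sum.reindex[OF reps_inj]) (simp add: U_rep inv_mult assoc)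
  finally show ?thesis by (simp add: sum_distrib_left)
qed

lemma sum_split_0: "(\<Sum>b<q. f b) = f 0 + (\<Sum>b\<in>{0<..<q}. f b)"
  for f :: "nat \<Rightarrow> complex"
proof -
  have "{..<q} = insert 0 {0<..<q}" using q_pos by auto
  then show ?thesis by simp
qed

lemma hecke_eqI:
  assumes f: "f \<in> hecke_carrier" "f' \<in> hecke_carrier"
    and out: "\<And>h. h \<notin> K \<Longrightarrow> h \<notin> dcos (s i) \<Longrightarrow> f h = f' h"
    and eq: "f \<one> = f' \<one>" "f (s i) = f' (s i)"
  shows "f = f'"
proof
  fix h
  consider "h \<in> K" | "h \<in> dcos (s i)" | "h \<notin> K" "h \<notin> dcos (s i)" by blast
  then show "f h = f' h"
  proof cases
    case 1
    then show ?thesis using hecke_right[OF f(1) 1, of \<one>] hecke_right[OF f(2) 1, of \<one>] eq by simp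
  next
    case 2
    then obtain k k' where "k \<in> K" "k' \<in> K" "h = k \<otimes> s i \<otimes> k'" by (auto simp: dcos_def)
    then show ?thesis using f eq by (simp add: hecke_left hecke_right)
  qed (rule out)
qed

text \<open>The square is supported on \<open>K\<close> and K s_i K, so two evaluations determine
  it. At the identity all q summands agree and give the constant term. At s_i the summand b = 0 is
  the value of U_i at the identity, which is 0, and the big cell supplies the others.\<close>

lemma U_quadratic:
  "conv (U i) (U i) = (\<lambda>h. (c i * (\<Sum>b\<in>{0<..<q}. \<eta> i b)) * U i h +
     (of_nat q * c i ^ 2 * \<psi> (inv (s i \<otimes> s i))) * hecke_one h)" (is "_ = (\<lambda>h. ?\<alpha> * U i h + ?\<beta> * hecke_one h)")
proof (rule hecke_eqI[where i = i])
  show "conv (U i) (U i) \<in> hecke_carrier" by (intro conv_closed U_carrier)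
  show "(\<lambda>h. ?\<alpha> * U i h + ?\<beta> * hecke_one h) \<in> hecke_carrier"
    by (intro hecke_lin U_carrier hecke_one_carrier)
  have one: "\<one> \<notin> dcos (s i)"
  proof
    assume "\<one> \<in> dcos (s i)"
    then have "s i \<in> dcos \<one>" by (rule dcos_sym)
    then show False using s_notin_K by (simp add: dcos_one)
  qed
  have "U i (inv (s i) \<otimes> inv (x i b)) = c i * \<psi> (inv (s i \<otimes> s i))" for b
  proof -
    have "\<psi> (inv (x i b)) = 1" using char_inv[OF x_K, of i b] by (simp add: x_char)
    moreover have "inv (s i) = \<one> \<otimes> s i \<otimes> inv (s i \<otimes> s i)" by (simp add: s_inv)
    then have "U i (inv (s i)) = c i * \<psi> (inv (s i \<otimes> s i))"
      using U_eq[of \<one> "inv (s i \<otimes> s i)" i] s_sq by simp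
    ultimately show ?thesis using U_mult(2)[of "inv (x i b)" i "inv (s i)"] x_K by simp
  qed
  then show "conv (U i) (U i) \<one> = ?\<alpha> * U i \<one> + ?\<beta> * hecke_one \<one>"
    using one by (simp add: conv_U[OF U_carrier] U_outside hecke_one_def power2_eq_square)
  have "U i (inv (s i) \<otimes> (inv (x i b) \<otimes> s i)) = c i * \<eta> i b" if "b \<in> {0<..<q}" for b
  proof -
    obtain k k' where k: "k \<in> K" "k' \<in> K" "inv (s i) \<otimes> inv (x i b) \<otimes> s i = k \<otimes> s i \<otimes> k'" "\<psi> k * \<psi> k' = \<eta> i b"
      by (rule big_cellE[OF \<open>b \<in> {0<..<q}\<close>])
    then show ?thesis using U_eq[OF k(1,2), of i] by (simp add: assoc)
  qed
  then show "conv (U i) (U i) (s i) = ?\<alpha> * U i (s i) + ?\<beta> * hecke_one (s i)"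
    using one by (simp add: conv_U[OF U_carrier] sum_split_0 x_0 U_outside U_s hecke_one_def s_notin_K sum_distrib_left)
      (simp add: sum_distrib_left mult_ac)
  fix h assume h: "h \<notin> K" "h \<notin> dcos (s i)"
  have "U i (inv (s i) \<otimes> (inv (x i b) \<otimes> h)) = 0" for b
  proof (rule U_outside, rule notI)
    assume "inv (s i) \<otimes> (inv (x i b) \<otimes> h) \<in> dcos (s i)"
    then obtain k k' where k: "k \<in> K" "k' \<in> K" "inv (s i) \<otimes> (inv (x i b) \<otimes> h) = k \<otimes> s i \<otimes> k'" by (auto simp: dcos_def)
    have "h = x i b \<otimes> (s i \<otimes> (inv (s i) \<otimes> (inv (x i b) \<otimes> h)))" by simp
    also have "\<dots> = x i b \<otimes> (s i \<otimes> (k \<otimes> s i)) \<otimes> k'" unfolding k by (simp add: assoc)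
    finally show False
      using h s_K_s[OF k(1), of i] dcos_mult[of _ "s i" "x i b" k'] x_K k(2) by (auto simp: K_mult_iff)
  qed
  then show "conv (U i) (U i) h = ?\<alpha> * U i h + ?\<beta> * hecke_one h"
    using h by (simp add: conv_U[OF U_carrier] U_outside hecke_one_def)
qed

lemma quadratic_generators_U: "quadratic_generators hecke_ring U (\<lambda>i. c i * (\<Sum>b\<in>{0<..<q}. \<eta> i b))
  (\<lambda>i. of_nat q * c i ^ 2 * \<psi> (inv (s i \<otimes> s i)))"
proof (rule quadratic_generators.intro[OF hecke_ring_algebra], rule quadratic_generators_axioms.intro)
  show "U i \<in> carrier hecke_ring" for i by (simp only: hecke_ring_simps U_carrier)
qed (simp only: hecke_ring_simps U_quadratic)

abbreviation "words \<equiv> complex_algebra.word_prod hecke_ring U"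
abbreviation "evals \<equiv> complex_algebra.free_eval hecke_ring U"

lemmas words_simps [simp] = complex_algebra.word_prod.simps[OF hecke_ring_algebra]
lemmas evals_simps = quadratic_generators.free_eval_add[OF quadratic_generators_U]
  quadratic_generators.free_eval_single[OF quadratic_generators_U]
  quadratic_generators.free_eval_0[OF quadratic_generators_U]

lemma word_prod_hecke: "words v \<in> hecke_carrier"
  using quadratic_generators.word_prod_closed[OF quadratic_generators_U, of v] by (simp add: hecke_ring_simps)

text \<open>The support statement is the lengthening rule. For the value at \<omega>(i # v), the
  summand b = 0 is the previous nonzero value, whereas for b > 0 the big cell moves the argument
  into the double coset of i # v, where the shorter product vanishes. No cancellation can
  occur.\<close>

lemma word_prod_support:
  assumes "distinct_adj v"
  shows "(\<forall>h. words v h \<noteq> 0 \<longrightarrow> h \<in> dcos (\<omega> v)) \<and> words v (\<omega> v) \<noteq> 0"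
  using assms
proof (induction v)
  case Nil
  show ?case by (simp add: hecke_ring_simps hecke_one_def \<omega>_Nil dcos_one)
next
  case (Cons i v)
  have d: "distinct_adj v" using Cons.prems by (rule distinct_adj_tl)
  let ?f = "words v"
  have supp: "h \<in> dcos (\<omega> v)" if "?f h \<noteq> 0" for h using Cons.IH[OF d] that by blast
  have nz: "?f (\<omega> v) \<noteq> 0" using Cons.IH[OF d] by blast
  have e: "words (i # v) h = c i * (\<Sum>b<q. ?f (inv (s i) \<otimes> (inv (x i b) \<otimes> h)))" for h
    by (simp add: hecke_ring_simps conv_U word_prod_hecke)
  have "h \<in> dcos (\<omega> (i # v))" if "words (i # v) h \<noteq> 0" for h
  proof -
    from that obtain b where "?f (inv (s i) \<otimes> (inv (x i b) \<otimes> h)) \<noteq> 0"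
      unfolding e by (metis (no_types, lifting) mult_zero_right sum.neutral)
    then have "inv (s i) \<otimes> (inv (x i b) \<otimes> h) \<in> dcos (\<omega> v)" by (rule supp)
    then obtain k k' where k: "k \<in> K" "k' \<in> K" "inv (s i) \<otimes> (inv (x i b) \<otimes> h) = k \<otimes> \<omega> v \<otimes> k'"
      by (auto simp: dcos_def)
    have "h = x i b \<otimes> (s i \<otimes> (inv (s i) \<otimes> (inv (x i b) \<otimes> h)))" by simp
    also have "\<dots> = x i b \<otimes> (s i \<otimes> (k \<otimes> \<omega> v)) \<otimes> k'" unfolding k by (simp add: assoc)
    also have "\<dots> \<in> dcos (\<omega> (i # v))" by (intro dcos_mult s_K_word Cons.prems k x_K)
    finally show ?thesis .
  qed
  moreover have "words (i # v) (\<omega> (i # v)) \<noteq> 0"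
  proof -
    have "?f (inv (s i) \<otimes> (inv (x i b) \<otimes> \<omega> (i # v))) = 0" if b: "b \<in> {0<..<q}" for b
    proof (rule ccontr)
      assume "?f (inv (s i) \<otimes> (inv (x i b) \<otimes> \<omega> (i # v))) \<noteq> 0"
      then have 1: "inv (s i) \<otimes> (inv (x i b) \<otimes> \<omega> (i # v)) \<in> dcos (\<omega> v)" by (rule supp)
      obtain k k' where k: "k \<in> K" "k' \<in> K" "inv (s i) \<otimes> inv (x i b) \<otimes> s i = k \<otimes> s i \<otimes> k'"
        by (rule big_cellE[OF b])
      have "inv (s i) \<otimes> (inv (x i b) \<otimes> \<omega> (i # v)) = (inv (s i) \<otimes> inv (x i b) \<otimes> s i) \<otimes> \<omega> v"
        by (simp add: \<omega>_Cons assoc)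
      also have "\<dots> = k \<otimes> (s i \<otimes> (k' \<otimes> \<omega> v))" unfolding k by (simp add: assoc)
      also have "\<dots> \<in> dcos (\<omega> (i # v))" by (intro dcos_mult_left s_K_word Cons.prems k)
      finally have "v = i # v" using dcos_word_unique[OF d Cons.prems 1] by simp
      then show False by simp
    qed
    then show ?thesis unfolding e sum_split_0 using nz c_nonzero by (simp add: x_0 \<omega>_Cons)
  qed
  ultimately show ?case by blast
qed

lemma free_eval_hecke:
  "evals P = (\<lambda>h. \<Sum>w\<in>Poly_Mapping.keys P. Poly_Mapping.lookup P w * words (letters w) h)"
  unfolding complex_algebra.free_eval_def[OF hecke_ring_algebra]
  by (subst hecke_ring_finsum) (use hecke_lin[OF word_prod_hecke hecke_zero, of _ _ 0] in \<open>simp_all add: hecke_ring_simps\<close>)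

text \<open>Products along different alternating words have disjoint supports, so evaluation at
  \<omega>(w) isolates the coefficient of w.\<close>

lemma alternating_independent:
  assumes "alternating Q" "evals Q = \<zero>\<^bsub>hecke_ring\<^esub>"
  shows "Q = 0"
proof (rule poly_mapping_eqI)
  fix w
  show "Poly_Mapping.lookup Q w = Poly_Mapping.lookup 0 w"
  proof (cases "w \<in> Poly_Mapping.keys Q")
    case True
    have d: "distinct_adj (letters w)" using True assms(1) by (simp add: alternating_def)
    have "words (letters v) (\<omega> (letters w)) = 0" if v: "v \<in> Poly_Mapping.keys Q - {w}" for v
    proof (rule ccontr)
      have d': "distinct_adj (letters v)" using v assms(1) by (simp add: alternating_def)
      assume "words (letters v) (\<omega> (letters w)) \<noteq> 0"
      then have "\<omega> (letters w) \<in> dcos (\<omega> (letters v))" using word_prod_support[OF d'] by blast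
      then have "letters v = letters w" using dcos_word_unique[OF d' d _ dcos_self] by blast
      then show False using v by (simp add: free_word.expand)
    qed
    then have "evals Q (\<omega> (letters w)) = Poly_Mapping.lookup Q w * words (letters w) (\<omega> (letters w))"
      unfolding free_eval_hecke using True by (subst sum.remove[of _ w]) auto
    then show ?thesis using assms(2) word_prod_support[OF d] by (simp add: hecke_ring_simps)
  qed (simp add: in_keys_iff)
qed

text \<open>On a double coset the equivariance leaves one degree of freedom, the value at
  \<omega>(v). Dividing the value of f by that of the product along v therefore gives the
  coefficient; the finite cover of f bounds the set of words involved.\<close>

lemma words_span:
  assumes f: "f \<in> hecke_carrier"
  shows "\<exists>P. evals P = f"
proof -
  obtain R where R: "covers R f" using hecke_covers[OF f] by blast
  obtain W where W: "\<And>g. distinct_adj (W g)" "\<And>g. g \<in> dcos (\<omega> (W g))"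
    using dcos_word_exhaust by metis
  let ?V = "W ` R"
  define a where "a v = f (\<omega> v) / words v (\<omega> v)" for v
  let ?P = "\<Sum>v\<in>?V. Poly_Mapping.single (Word v) (a v)"
  have fin: "finite ?V" using R by (simp add: covers_def)
  have "evals (\<Sum>v\<in>S. Poly_Mapping.single (Word v) (a v)) = (\<lambda>h. \<Sum>v\<in>S. a v * words v h)"
    if "finite S" for S
    using that
  proof induction
    case (insert v S)
    then show ?case by (simp add: evals_simps) (simp add: hecke_ring_simps)
  qed (simp add: evals_simps hecke_ring_simps)
  then have P: "evals ?P h = (\<Sum>v\<in>?V. a v * words v h)" for h using fin by simp
  have "evals ?P h = f h" for h
  proof -
    have out: "words v h = 0" if "v \<in> ?V" "v \<noteq> W h" for v
    proof (rule ccontr)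
      assume nz: "words v h \<noteq> 0"
      have d: "distinct_adj v" using that W by auto
      then have "h \<in> dcos (\<omega> v)" using word_prod_support nz by blast
      then show False using dcos_word_unique[OF d W(1) _ W(2)] that by blast
    qed
    show ?thesis
    proof (cases "W h \<in> ?V")
      case True
      obtain k k' where k: "k \<in> K" "k' \<in> K" "h = k \<otimes> \<omega> (W h) \<otimes> k'"
        using W(2)[of h] by (auto simp: dcos_def)
      have eq: "g h = \<psi> k * \<psi> k' * g (\<omega> (W h))" if "g \<in> hecke_carrier" for g
        using k(1,2) by (subst k(3)) (simp add: hecke_left[OF that] hecke_right[OF that])
      have "evals ?P h = a (W h) * words (W h) h"
        unfolding P using True fin out by (subst sum.remove[of _ "W h"]) auto
      then show ?thesis
        using word_prod_support[OF W(1)[of h]] unfolding eq[OF f] eq[OF word_prod_hecke] a_def by simp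
    next
      case False
      have "f h = 0"
      proof (rule ccontr)
        assume "f h \<noteq> 0"
        then obtain r where r: "r \<in> R" "inv r \<otimes> h \<in> K" using R by (auto simp: covers_def)
        have "h \<in> dcos (\<omega> (W r))"
          using dcos_mult_right[OF W(2)[of r] r(2)] by simp
        then have "W r = W h" using dcos_word_unique W by blast
        then show False using False imageI[OF r(1), of W] by simp
      qed
      moreover have "evals ?P h = 0"
        unfolding P using out False by (intro sum.neutral) (metis mult_zero_right)
      ultimately show ?thesis by simp
    qed
  qed
  then show ?thesis by blast
qed

theorem hecke_presented:
  "presented_by hecke_ring U (quadratic_relators (\<lambda>i. c i * (\<Sum>b\<in>{0<..<q}. \<eta> i b))
     (\<lambda>i. of_nat q * c i ^ 2 * \<psi> (inv (s i \<otimes> s i))))"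
  by (rule quadratic_generators.presented_by_quadratic[OF quadratic_generators_U])
    (simp_all only: hecke_ring_simps(1) words_span alternating_independent)

theorem hecke_generated: "generated_algebra hecke_ring (range U) = hecke_carrier"
  using quadratic_generators.generated_algebra_quadratic[OF quadratic_generators_U] words_span
  by (simp add: hecke_ring_simps)

end

section \<open>The Iwahori subgroup and the affine reflections\<close>

text \<open>The parameters of w(p^(-n)) for n = 0 and n = 1, matching the two generators.\<close>

primrec root_param :: "hecke_gen \<Rightarrow> 'p::prime_card padic"
  where "root_param X0 = 1" | "root_param X1 = inverse \<varpi>"

definition simple_refl :: "hecke_gen \<Rightarrow> 'p::prime_card metaplectic"
  where "simple_refl i = weyl_elt (root_param i)"

primrec root_subgroup :: "hecke_gen \<Rightarrow> 'p::prime_card metaplectic set"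
  where "root_subgroup X0 = upper ` padic_integers" | "root_subgroup X1 = lower ` padic_ideal 1"

primrec root_rep :: "hecke_gen \<Rightarrow> nat \<Rightarrow> 'p::prime_card metaplectic"
  where "root_rep X0 b = upper (of_nat b)" | "root_rep X1 b = lower (\<varpi> * of_nat b)"

lemma root_param_nonzero [simp]: "root_param i \<noteq> 0"
  by (cases i) simp_all

lemma padic_minus_iff [simp]: "- x \<in> padic_integers \<longleftrightarrow> x \<in> padic_integers"
  "- x \<in> padic_ideal n \<longleftrightarrow> x \<in> padic_ideal n"
  using padic_integers_closed(8)[of x] padic_integers_closed(8)[of "- x"]
    padic_ideal_closed(4)[of x n] padic_ideal_closed(4)[of "- x" n] by auto

lemma padic_ideal_mult_uniformizer: "x \<in> padic_integers \<Longrightarrow> \<varpi> * x \<in> padic_ideal 1"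
  using padic_idealI[of x 1] by simp

lemma uniformizer_in_ideal [simp]: "\<varpi> \<in> padic_ideal 1"
  using padic_ideal_mult_uniformizer[of 1] by simp

lemma exists_nat_residue:
  fixes z :: "'p::prime_card padic"
  assumes "z \<in> padic_integers"
  shows "\<exists>b<CARD('p). z - of_nat b \<in> padic_ideal 1"
proof (intro exI conjI)
  note r = padic_residue_bounds[OF assms]
  show "nat (padic_residue z) < CARD('p)" using r by linarith
  have "padic_residue (of_int (padic_residue z) :: 'p padic) = padic_residue z"
    unfolding padic_residue_of_int using r by simp
  then have "z - of_int (padic_residue z) \<in> padic_ideal 1"
    using assms by (subst padic_residue_eq_iff[symmetric]) auto
  then show "z - of_nat (nat (padic_residue z)) \<in> padic_ideal 1" using r by simp
qed

lemma of_nat_eq_mod_ideal: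
  assumes "b < CARD('p)" "b' < CARD('p)" "(of_nat b' - of_nat b :: 'p::prime_card padic) \<in> padic_ideal 1"
  shows "b = b'"
proof -
  have "padic_residue (of_int (int b') :: 'p padic) = padic_residue (of_int (int b) :: 'p padic)"
    using assms(3) padic_residue_eq_iff[of "of_int (int b') :: 'p padic" "of_int (int b)"] by simp
  then show ?thesis using assms(1,2) unfolding padic_residue_of_int by simp
qed

lemma of_nat_unit:
  assumes "0 < b" "b < CARD('p)"
  shows "(of_nat b :: 'p::prime_card padic) \<in> padic_units"
proof -
  have "\<not> int CARD('p) dvd int b" using assms zdvd_not_zless[of "int b" "int CARD('p)"] by simp
  then show ?thesis using of_int_in_padic_units_iff[where 'p = 'p, of "int b"] by simp
qed

lemma mem_K0_cover_iff:
  "x \<in> K0_cover \<longleftrightarrow> mp_matrix x $ 1 $ 1 \<in> padic_integers \<and> mp_matrix x $ 1 $ 2 \<in> padic_integers \<and>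
    mp_matrix x $ 2 $ 1 \<in> padic_ideal 1 \<and> mp_matrix x $ 2 $ 2 \<in> padic_integers"
  unfolding K0_cover_def mem_Collect_eq K0_iff by simp

lemma elt_in_K0_cover:
  "z \<in> padic_integers \<Longrightarrow> upper z \<in> K0_cover"
  "z \<in> padic_ideal 1 \<Longrightarrow> lower z \<in> K0_cover"
  "a \<in> padic_units \<Longrightarrow> torus a \<in> K0_cover"
  "e = 1 \<or> e = - 1 \<Longrightarrow> sign_elt e \<in> K0_cover"
  by (simp_all add: mem_K0_cover_iff padic_units_in_integers padic_units_inverse padic_units_nonzero)

section \<open>Root subgroups, coset representatives and factorisation in the Iwahori
  subgroup\<close>

context odd_prime
begin

lemma weyl_conj_mem:
  assumes "t \<noteq> 0"
  shows "minv (weyl_elt t) \<cdot> g \<cdot> weyl_elt t \<in> K0_cover \<longleftrightarrow>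
      mp_matrix g $ 1 $ 1 \<in> padic_integers \<and> mp_matrix g $ 1 $ 2 / t ^ 2 \<in> padic_ideal 1 \<and>
      mp_matrix g $ 2 $ 1 * t ^ 2 \<in> padic_integers \<and> mp_matrix g $ 2 $ 2 \<in> padic_integers" (is "?A \<longleftrightarrow> ?B")
    and "weyl_elt t \<cdot> g \<cdot> minv (weyl_elt t) \<in> K0_cover \<longleftrightarrow>
      mp_matrix g $ 1 $ 1 \<in> padic_integers \<and> mp_matrix g $ 1 $ 2 / t ^ 2 \<in> padic_ideal 1 \<and>
      mp_matrix g $ 2 $ 1 * t ^ 2 \<in> padic_integers \<and> mp_matrix g $ 2 $ 2 \<in> padic_integers" (is "?C \<longleftrightarrow> _")
proof -
  show "?A \<longleftrightarrow> ?B" unfolding mem_K0_cover_iff weyl_conj_matrix(1)[OF assms] by auto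
  show "?C \<longleftrightarrow> ?B" unfolding mem_K0_cover_iff weyl_conj_matrix(2)[OF assms] by auto
qed

lemma refl_conj_mem:
  "minv (simple_refl X0) \<cdot> g \<cdot> simple_refl X0 \<in> K0_cover \<longleftrightarrow>
      mp_matrix g $ 1 $ 1 \<in> padic_integers \<and> mp_matrix g $ 1 $ 2 \<in> padic_ideal 1 \<and>
      mp_matrix g $ 2 $ 1 \<in> padic_integers \<and> mp_matrix g $ 2 $ 2 \<in> padic_integers"
  "simple_refl X0 \<cdot> g \<cdot> minv (simple_refl X0) \<in> K0_cover \<longleftrightarrow>
      mp_matrix g $ 1 $ 1 \<in> padic_integers \<and> mp_matrix g $ 1 $ 2 \<in> padic_ideal 1 \<and>
      mp_matrix g $ 2 $ 1 \<in> padic_integers \<and> mp_matrix g $ 2 $ 2 \<in> padic_integers"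
  "minv (simple_refl X1) \<cdot> g \<cdot> simple_refl X1 \<in> K0_cover \<longleftrightarrow>
      mp_matrix g $ 1 $ 1 \<in> padic_integers \<and> mp_matrix g $ 1 $ 2 * \<varpi> ^ 2 \<in> padic_ideal 1 \<and>
      mp_matrix g $ 2 $ 1 \<in> padic_ideal 2 \<and> mp_matrix g $ 2 $ 2 \<in> padic_integers"
  "simple_refl X1 \<cdot> g \<cdot> minv (simple_refl X1) \<in> K0_cover \<longleftrightarrow>
      mp_matrix g $ 1 $ 1 \<in> padic_integers \<and> mp_matrix g $ 1 $ 2 * \<varpi> ^ 2 \<in> padic_ideal 1 \<and>
      mp_matrix g $ 2 $ 1 \<in> padic_ideal 2 \<and> mp_matrix g $ 2 $ 2 \<in> padic_integers"
  unfolding simple_refl_def using root_param_nonzero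
  by (simp_all add: weyl_conj_mem padic_ideal_iff[of _ 2] power_inverse divide_inverse)

lemma conj_upper: "t \<noteq> 0 \<Longrightarrow> minv (weyl_elt t) \<cdot> upper z \<cdot> weyl_elt t = lower (- z / t ^ 2)"
proof -
  assume t: "t \<noteq> 0"
  have "weyl_elt t \<cdot> lower (- z / t ^ 2) = upper z \<cdot> weyl_elt t"
    using weyl_lower[OF t, of "- z / t ^ 2"] t by simp
  then have "minv (weyl_elt t) \<cdot> (weyl_elt t \<cdot> lower (- z / t ^ 2)) = minv (weyl_elt t) \<cdot> (upper z \<cdot> weyl_elt t)"
    by simp
  then show ?thesis by (simp add: mp_cancel mp_assoc)
qed

lemma conj_lower: "t \<noteq> 0 \<Longrightarrow> minv (weyl_elt t) \<cdot> lower z \<cdot> weyl_elt t = upper (- (t ^ 2) * z)"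
proof -
  assume t: "t \<noteq> 0"
  have "weyl_elt t \<cdot> upper (- (t ^ 2) * z) = lower z \<cdot> weyl_elt t"
    using weyl_upper[OF t, of "- (t ^ 2) * z"] t by simp
  then have "minv (weyl_elt t) \<cdot> (weyl_elt t \<cdot> upper (- (t ^ 2) * z)) = minv (weyl_elt t) \<cdot> (lower z \<cdot> weyl_elt t)"
    by simp
  then show ?thesis by (simp add: mp_cancel mp_assoc)
qed

lemma minv_eqI: "x \<cdot> y = mp_section (mat 1) \<Longrightarrow> minv x = y"
  by (metis mp_cancel(1) mp_one(2))

lemma minv_upper: "z \<in> padic_integers \<Longrightarrow> minv (upper z) = upper (- z)"
proof (rule minv_eqI, rule mp_eqI)
  assume "z \<in> padic_integers"
  then have "upper z \<in> (K0_cover :: 'p metaplectic set)" "upper (- z) \<in> (K0_cover :: 'p metaplectic set)"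
    by (simp_all add: elt_in_K0_cover)
  then show "mp_sign (upper z \<cdot> upper (- z)) = mp_sign (mp_section (mat 1))"
    using kubota_cocycle_K0[of "mat2 1 z 0 1" "mat2 1 (- z) 0 1"] by (simp add: K0_cover_def)
qed (simp add: mat2_eq_iff[of "_ ** _"])

lemma minv_lower: "z \<in> padic_ideal 1 \<Longrightarrow> minv (lower z) = lower (- z)"
proof (rule minv_eqI, rule mp_eqI)
  assume "z \<in> padic_ideal 1"
  then have "lower z \<in> (K0_cover :: 'p metaplectic set)" "lower (- z) \<in> (K0_cover :: 'p metaplectic set)"
    by (intro elt_in_K0_cover; simp)+
  then show "mp_sign (lower z \<cdot> lower (- z)) = mp_sign (mp_section (mat 1))"
    using kubota_cocycle_K0[of "mat2 1 0 z 1" "mat2 1 0 (- z) 1"] by (simp add: K0_cover_def)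
qed (simp add: mat2_eq_iff[of "_ ** _"])

lemma K0_cover_entries:
  assumes "k \<in> (K0_cover :: 'p metaplectic set)"
  defines "A \<equiv> mp_matrix k"
  shows "A $ 1 $ 1 \<in> padic_units" "A $ 2 $ 2 \<in> padic_units" "A $ 1 $ 1 \<in> padic_integers" "A $ 1 $ 2 \<in> padic_integers"
    "A $ 2 $ 1 \<in> padic_ideal 1" "A $ 2 $ 2 \<in> padic_integers" "A $ 2 $ 1 \<in> padic_integers"
    "inverse (A $ 1 $ 1) \<in> padic_integers" "inverse (A $ 2 $ 2) \<in> padic_integers"
    "A $ 1 $ 1 \<noteq> 0" "A $ 2 $ 2 \<noteq> 0"
proof -
  have A: "A \<in> K0" using assms by (simp add: K0_cover_def)
  show u: "A $ 1 $ 1 \<in> padic_units" "A $ 2 $ 2 \<in> padic_units" using K0_units[OF A] by simp_all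
  show "A $ 1 $ 1 \<in> padic_integers" "A $ 1 $ 2 \<in> padic_integers"
    "A $ 2 $ 1 \<in> padic_ideal 1" "A $ 2 $ 2 \<in> padic_integers"
    using assms mem_K0_cover_iff by blast+
  then show "A $ 2 $ 1 \<in> padic_integers" using padic_ideal_subset_integers by blast
  show "inverse (A $ 1 $ 1) \<in> padic_integers" "inverse (A $ 2 $ 2) \<in> padic_integers"
    "A $ 1 $ 1 \<noteq> 0" "A $ 2 $ 2 \<noteq> 0"
    using u padic_units_inverse padic_units_in_integers padic_units_nonzero by blast+
qed

lemma root_subgroup_in_K0: "n \<in> root_subgroup i \<Longrightarrow> n \<in> (K0_cover :: 'p metaplectic set)"
  by (cases i) (auto simp: elt_in_K0_cover simp del: One_nat_def)

lemma root_subgroup_conj: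
  assumes "i \<noteq> j" "n \<in> root_subgroup i"
  shows "minv (simple_refl j) \<cdot> n \<cdot> simple_refl j \<in> root_subgroup j"
proof (cases i)
  case X0
  then have j: "j = X1" using assms(1) by (cases j) simp_all
  obtain z where z: "n = upper z" "z \<in> padic_integers" using assms(2) X0 by auto
  have "- z / (inverse \<varpi>) ^ 2 = \<varpi> * (- (\<varpi> * z))" by (simp add: power2_eq_square field_simps)
  moreover have "\<varpi> * (- (\<varpi> * z)) \<in> padic_ideal 1"
    using z by (intro padic_ideal_mult_uniformizer) simp
  ultimately show ?thesis unfolding j z simple_refl_def by (simp add: conj_upper del: One_nat_def)
next
  case X1
  then have j: "j = X0" using assms(1) by (cases j) simp_all
  obtain z where z: "n = lower z" "z \<in> padic_ideal 1" using assms(2) X1 by auto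
  then show ?thesis unfolding j z simple_refl_def
    by (simp add: conj_lower padic_ideal_subset_integers[of z 1] del: One_nat_def)
qed

text \<open>Dividing by n on the right clears the upper right entry for \<open>X0\<close> and the
  lower left entry for \<open>X1\<close>, which is the only entry that could leave the Iwahori shape
  under conjugation by the reflection.\<close>

lemma K0_cover_factor:
  assumes k: "k \<in> (K0_cover :: 'p metaplectic set)"
  shows "\<exists>k1 n. k = k1 \<cdot> n \<and> n \<in> root_subgroup i \<and> simple_refl i \<cdot> k1 \<cdot> minv (simple_refl i) \<in> K0_cover"
proof (cases i)
  note e = K0_cover_entries[OF k]
  let ?A = "mp_matrix k"
  case X0
  define z where "z = ?A $ 1 $ 2 * inverse (?A $ 1 $ 1)"
  have z: "z \<in> padic_integers" "?A $ 1 $ 1 * z = ?A $ 1 $ 2" using e by (simp_all add: z_def)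
  let ?n = "upper z"
  have "simple_refl X0 \<cdot> (k \<cdot> minv ?n) \<cdot> minv (simple_refl X0) \<in> K0_cover"
    unfolding refl_conj_mem using e z by (simp add: mp_inv_matrix)
  moreover have "k = (k \<cdot> minv ?n) \<cdot> ?n" by (simp add: mp_assoc mp_inv mp_one)
  moreover have "?n \<in> root_subgroup X0" using z by simp
  ultimately show ?thesis unfolding X0 by blast
next
  note e = K0_cover_entries[OF k]
  let ?A = "mp_matrix k"
  case X1
  define z where "z = ?A $ 2 $ 1 * inverse (?A $ 2 $ 2)"
  have z: "z \<in> padic_ideal 1" "?A $ 2 $ 2 * z = ?A $ 2 $ 1" using e by (simp_all add: z_def del: One_nat_def)
  note zi = padic_ideal_subset_integers[OF z(1)]
  let ?n = "lower z"
  have "?A $ 1 $ 2 * \<varpi> ^ 2 \<in> padic_ideal 1"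
    using e(4) padic_ideal_mult_uniformizer[of "?A $ 1 $ 2 * \<varpi>"]
    by (simp add: power2_eq_square mult_ac del: One_nat_def)
  then have "simple_refl X1 \<cdot> (k \<cdot> minv ?n) \<cdot> minv (simple_refl X1) \<in> K0_cover"
    unfolding refl_conj_mem using e z zi by (simp add: mp_inv_matrix del: One_nat_def)
  moreover have "k = (k \<cdot> minv ?n) \<cdot> ?n" by (simp add: mp_assoc mp_inv mp_one)
  moreover have "?n \<in> root_subgroup X1" using z by (simp del: One_nat_def)
  ultimately show ?thesis unfolding X1 by blast
qed

lemma root_rep_in_K0: "root_rep i b \<in> (K0_cover :: 'p metaplectic set)"
  by (cases i) (simp_all add: elt_in_K0_cover padic_ideal_mult_uniformizer del: One_nat_def)

text \<open>For \<open>X0\<close> the upper right entry has to become divisible by p, which forces b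
  to be the residue of that entry over the lower right one. For \<open>X1\<close> the lower left
  entry has to become divisible by p^2, so it is first divided by p and then by the upper left
  entry.\<close>

lemma root_rep_cover:
  assumes k: "k \<in> (K0_cover :: 'p metaplectic set)"
  shows "\<exists>b<CARD('p). minv (simple_refl i) \<cdot> (minv (root_rep i b) \<cdot> k) \<cdot> simple_refl i \<in> K0_cover"
proof (cases i)
  note e = K0_cover_entries[OF k]
  let ?A = "mp_matrix k"
  case X0
  have "?A $ 1 $ 2 * inverse (?A $ 2 $ 2) \<in> padic_integers" using e by simp
  then obtain b where b: "b < CARD('p)" "?A $ 1 $ 2 * inverse (?A $ 2 $ 2) - of_nat b \<in> padic_ideal 1"
    using exists_nat_residue by blast
  have "(?A $ 1 $ 2 * inverse (?A $ 2 $ 2) - of_nat b) * ?A $ 2 $ 2 \<in> padic_ideal 1"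
    by (rule padic_ideal_closed(5)[OF b(2) e(6)])
  then have "?A $ 1 $ 2 - of_nat b * ?A $ 2 $ 2 \<in> padic_ideal 1"
    using e by (simp add: left_diff_distrib mult.assoc)
  then show ?thesis
    unfolding X0 refl_conj_mem using e b(1) by (intro exI[of _ b]) (simp add: mp_inv_matrix)
next
  note e = K0_cover_entries[OF k]
  let ?A = "mp_matrix k"
  case X1
  define c where "c = ?A $ 2 $ 1 / \<varpi>"
  have c: "?A $ 2 $ 1 = \<varpi> * c" "c \<in> padic_integers"
    using e(5) by (simp_all add: c_def padic_ideal_iff)
  have "c * inverse (?A $ 1 $ 1) \<in> padic_integers" using e c by simp
  then obtain b where b: "b < CARD('p)" "c * inverse (?A $ 1 $ 1) - of_nat b \<in> padic_ideal 1"
    using exists_nat_residue by blast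
  have "(c * inverse (?A $ 1 $ 1) - of_nat b) * ?A $ 1 $ 1 \<in> padic_ideal 1"
    by (rule padic_ideal_closed(5)[OF b(2) e(3)])
  then have "c - of_nat b * ?A $ 1 $ 1 \<in> padic_ideal 1"
    using e by (simp add: left_diff_distrib mult.assoc)
  then have 1: "?A $ 2 $ 1 - \<varpi> * of_nat b * ?A $ 1 $ 1 \<in> padic_ideal 2"
    by (simp add: c(1) padic_ideal_iff diff_divide_distrib power2_eq_square)
  have 2: "?A $ 1 $ 2 * \<varpi> ^ 2 \<in> padic_ideal 1"
    using e(4) padic_ideal_mult_uniformizer[of "?A $ 1 $ 2 * \<varpi>"]
    by (simp add: power2_eq_square mult_ac del: One_nat_def)
  show ?thesis
    unfolding X1 refl_conj_mem using e b(1) 1 2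
    by (intro exI[of _ b]) (simp add: mp_inv_matrix del: One_nat_def)
qed

lemma root_rep_distinct:
  assumes b: "b < CARD('p)" "b' < CARD('p)"
    and K: "minv (simple_refl i) \<cdot> (minv (root_rep i b) \<cdot> root_rep i b') \<cdot> simple_refl i \<in> (K0_cover :: 'p metaplectic set)"
  shows "b = b'"
proof (cases i)
  case X0
  have "(of_nat b' - of_nat b :: 'p padic) \<in> padic_ideal 1"
    using K unfolding X0 refl_conj_mem by (simp add: mp_inv_matrix)
  then show ?thesis by (rule of_nat_eq_mod_ideal[OF b])
next
  case X1
  have "(\<varpi> * of_nat b' - \<varpi> * of_nat b :: 'p padic) \<in> padic_ideal 2"
    using K unfolding X1 refl_conj_mem by (simp add: mp_inv_matrix)
  then have "(of_nat b' - of_nat b :: 'p padic) \<in> padic_ideal 1"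
    by (simp add: padic_ideal_iff diff_divide_distrib power2_eq_square)
  then show ?thesis by (rule of_nat_eq_mod_ideal[OF b])
qed

end

subsection \<open>The character\<close>

locale iwahori_char = odd_prime ty for ty :: "'p::prime_card itself" +
  fixes \<gamma> :: "int \<Rightarrow> complex"
  assumes \<gamma>_cases: "\<gamma> = (\<lambda>_. 1) \<or> \<gamma> = (\<lambda>a. of_int (Legendre a (int CARD('p))))"
begin

definition chi :: "'p metaplectic \<Rightarrow> complex"
  where "chi x = cnj (genuine_char \<gamma> x)"

lemma Legendre_residue: "u \<in> padic_units \<Longrightarrow> Legendre (padic_residue (u :: 'p padic)) (int CARD('p)) = quad_char u"
  by (simp add: quad_char_unit)

lemma \<gamma>_mult: "\<gamma> ((a * b) mod int CARD('p)) = \<gamma> a * \<gamma> b"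
  using \<gamma>_cases by (auto simp: Legendre_mod Legendre_mult prime_card CARD_gt_2)

lemma \<gamma>_1 [simp]: "\<gamma> 1 = 1"
  using \<gamma>_cases Legendre_residue[OF padic_units_1] by auto

lemma cnj_\<gamma>: "cnj (\<gamma> a) = \<gamma> a"
  using \<gamma>_cases by auto

lemma chi_eq: "chi x = of_int (mp_sign x) * \<gamma> (padic_residue (mp_matrix x $ 2 $ 2))"
  by (simp add: chi_def genuine_char_def cnj_\<gamma>)

lemma \<gamma>_residue_mult:
  "x \<in> padic_integers \<Longrightarrow> y \<in> padic_integers \<Longrightarrow>
    \<gamma> (padic_residue (x * y :: 'p padic)) = \<gamma> (padic_residue x) * \<gamma> (padic_residue y)"
  by (simp add: padic_residue_mult \<gamma>_mult)

lemma \<gamma>_residue_cases: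
  assumes "u \<in> padic_units"
  shows "\<gamma> (padic_residue (u :: 'p padic)) = 1 \<or> \<gamma> (padic_residue u) = - 1"
  using \<gamma>_cases Legendre_residue[OF assms] quad_char_cases[OF padic_units_nonzero[OF assms]] by auto

lemma \<gamma>_residue_inverse:
  assumes "u \<in> padic_units"
  shows "\<gamma> (padic_residue (inverse u :: 'p padic)) = \<gamma> (padic_residue u)"
proof -
  have "\<gamma> (padic_residue (inverse u * u)) = 1" using padic_units_nonzero[OF assms] by simp
  then have "\<gamma> (padic_residue (inverse u)) * \<gamma> (padic_residue u) = 1"
    using assms by (simp add: \<gamma>_residue_mult padic_units_in_integers padic_units_inverse del: left_inverse)
  then show ?thesis using \<gamma>_residue_cases[OF assms] \<gamma>_residue_cases[OF padic_units_inverse[OF assms]] by auto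
qed

lemma chi_mult:
  assumes "x \<in> K0_cover" "y \<in> K0_cover"
  shows "chi (x \<cdot> y) = chi x * chi y"
proof -
  have K: "mp_matrix x \<in> K0" "mp_matrix y \<in> K0" using assms by (simp_all add: K0_cover_def)
  have "\<gamma> (padic_residue ((mp_matrix x ** mp_matrix y) $ 2 $ 2)) =
      \<gamma> (padic_residue (mp_matrix x $ 2 $ 2)) * \<gamma> (padic_residue (mp_matrix y $ 2 $ 2))"
    unfolding K0_mult_residue[OF K] by (rule \<gamma>_mult)
  then show ?thesis
    unfolding chi_eq mp_mult_matrix mp_mult_sign kubota_cocycle_K0[OF K] by simp
qed

lemma chi_elt [simp]:
  "chi (upper z) = 1" "chi (lower z) = 1" "a \<in> padic_units \<Longrightarrow> chi (torus a) = \<gamma> (padic_residue a)"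
  "e = 1 \<or> e = - 1 \<Longrightarrow> chi (sign_elt e) = of_int e" "chi (mp_section (mat 1)) = 1"
  by (simp_all add: chi_eq padic_units_nonzero \<gamma>_residue_inverse)

text \<open>Conjugation by a reflection swaps the diagonal entries. Their residues are inverse to
  each other, and \<gamma> takes values 1 and -1 on units, so it does not see the swap; the sign is
  handled by \<open>weyl_conj_sign\<close>.\<close>

lemma chi_conj:
  assumes k: "k \<in> K0_cover" "minv (simple_refl i) \<cdot> k \<cdot> simple_refl i \<in> K0_cover"
  shows "chi (minv (simple_refl i) \<cdot> k \<cdot> simple_refl i) = chi k"
proof -
  let ?A = "mp_matrix k"
  have A: "?A \<in> K0" using k by (simp add: K0_cover_def)
  have "\<gamma> (padic_residue (?A $ 1 $ 1)) * \<gamma> (padic_residue (?A $ 2 $ 2)) = 1"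
    unfolding \<gamma>_mult[symmetric] K0_units(3)[OF A] by simp
  then have eq: "\<gamma> (padic_residue (?A $ 1 $ 1)) = \<gamma> (padic_residue (?A $ 2 $ 2))"
    using \<gamma>_residue_cases[OF K0_units(1)[OF A]] \<gamma>_residue_cases[OF K0_units(2)[OF A]] by auto
  have "mp_sign (minv (simple_refl i) \<cdot> k \<cdot> simple_refl i) = mp_sign k"
    using k unfolding simple_refl_def by (intro weyl_conj_sign root_param_nonzero)
  moreover have "mp_matrix (minv (simple_refl i) \<cdot> k \<cdot> simple_refl i) $ 2 $ 2 = ?A $ 1 $ 1"
    unfolding simple_refl_def weyl_conj_matrix[OF root_param_nonzero] by simp
  ultimately show ?thesis unfolding chi_eq eq[symmetric] by (simp only:)
qed

text \<open>The additional quadratic character for \<open>X1\<close> is the sign from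
  \<open>torus_weyl\<close> at t = 1/p.\<close>

primrec cell_char :: "hecke_gen \<Rightarrow> nat \<Rightarrow> complex"
  where "cell_char X0 b = \<gamma> (padic_residue (- of_nat b :: 'p padic))"
  | "cell_char X1 b = of_int (quad_char (of_nat b :: 'p padic)) * \<gamma> (padic_residue (of_nat b :: 'p padic))"

lemma big_cell_aux:
  assumes L: "L \<in> K0_cover" "R \<in> K0_cover" "chi L = 1" "chi R = 1"
    and a: "a \<in> padic_units" and e: "e = hilbert_symbol (- (inverse (a * a * t))) (inverse (a * t * t))" and "t \<noteq> 0"
    and g: "g = L \<cdot> (weyl_elt (a * t) \<cdot> R)"
  shows "\<exists>k\<in>K0_cover. \<exists>k'\<in>K0_cover. g = k \<cdot> weyl_elt t \<cdot> k' \<and> chi k * chi k' = of_int e * \<gamma> (padic_residue a)"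
proof -
  let ?k = "L \<cdot> (sign_elt e \<cdot> torus a)"
  have e1: "e = 1 \<or> e = - 1" using e hilbert_symbol_cases by blast
  have K: "sign_elt e \<in> (K0_cover :: 'p metaplectic set)" "torus a \<in> K0_cover"
    using e1 a by (simp_all add: elt_in_K0_cover)
  interpret K: subgroup K0_cover "mp_group :: 'p metaplectic monoid" by (rule K0_cover_subgroup)
  have cl: "x \<cdot> y \<in> K0_cover" if "x \<in> K0_cover" "y \<in> K0_cover" for x y
    using K.m_closed[OF that] by (simp add: mp_group_def)
  have "?k \<in> K0_cover" "R \<in> K0_cover" using L K cl by blast+
  moreover have "g = ?k \<cdot> weyl_elt t \<cdot> R"
    unfolding g torus_weyl[OF padic_units_nonzero[OF a] \<open>t \<noteq> 0\<close> e] by (simp add: mp_assoc)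
  moreover have "chi ?k * chi R = of_int e * \<gamma> (padic_residue a)"
    using L K e1 a by (simp add: chi_mult cl)
  ultimately show ?thesis by blast
qed

lemma big_cell:
  assumes b: "0 < b" "b < CARD('p)"
  shows "\<exists>k\<in>K0_cover. \<exists>k'\<in>K0_cover. minv (simple_refl i) \<cdot> minv (root_rep i b) \<cdot> simple_refl i = k \<cdot> simple_refl i \<cdot> k' \<and>
    chi k * chi k' = cell_char i b"
proof -
  define z where "z = (of_nat b :: 'p padic)"
  have z: "z \<in> padic_units" unfolding z_def using b by (rule of_nat_unit)
  note z0 = padic_units_nonzero[OF z]
  have zi: "inverse z \<in> padic_units" using z by (rule padic_units_inverse)
  show ?thesis
  proof (cases i)
    case X0
    have u: "- inverse z \<in> padic_units" using zi by (rule padic_units_minus)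
    define e where "e = hilbert_symbol (- (inverse (- inverse z * - inverse z * 1))) (inverse (- inverse z * 1 * 1))"
    have "minv (simple_refl X0) \<cdot> minv (root_rep X0 b) \<cdot> simple_refl X0 = lower z"
      using z by (simp add: simple_refl_def z_def[symmetric] minv_upper padic_units_in_integers conj_upper)
    also have "\<dots> = upper (inverse z) \<cdot> (weyl_elt (- inverse z * 1) \<cdot> upper (inverse z))"
      using lower_eq_upper_weyl_upper[OF z0] by simp
    finally have g: "minv (simple_refl X0) \<cdot> minv (root_rep X0 b) \<cdot> simple_refl X0 =
      upper (inverse z) \<cdot> (weyl_elt (- inverse z * 1) \<cdot> upper (inverse z))" .
    \<comment> \<open>With t = 1 both arguments are units, so no sign arises.\<close>
    have "e = 1"
      unfolding e_def using z0 z padic_units_mult[OF z z]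
      by (intro hilbert_symbol_units) (simp_all add: padic_units_minus)
    moreover have "\<gamma> (padic_residue (- inverse z)) = \<gamma> (padic_residue (- z))"
      using \<gamma>_residue_inverse[OF padic_units_minus[OF z]] by simp
    ultimately show ?thesis
      using big_cell_aux[OF _ _ chi_elt(1) chi_elt(1) u e_def one_neq_zero g] zi
      by (simp add: X0 simple_refl_def[of X0] elt_in_K0_cover padic_units_in_integers z_def[symmetric])
  next
    case X1
    let ?t = "inverse \<varpi> :: 'p padic"
    define e where "e = hilbert_symbol (- (inverse (z * z * ?t))) (inverse (z * ?t * ?t))"
    have l: "\<varpi> * inverse z \<in> padic_ideal 1" using zi padic_units_in_integers by (intro padic_ideal_mult_uniformizer)
    have "minv (simple_refl X1) \<cdot> minv (root_rep X1 b) \<cdot> simple_refl X1 = upper (z * ?t)"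
    proof -
      have t0: "?t \<noteq> 0" by simp
      have "- (?t ^ 2) * (- (\<varpi> * z)) = z * ?t" by (simp add: power2_eq_square field_simps)
      then show ?thesis
        unfolding simple_refl_def root_param.simps root_rep.simps z_def[symmetric]
          minv_lower[OF padic_ideal_mult_uniformizer[OF padic_units_in_integers[OF z]]] conj_lower[OF t0]
        by (rule arg_cong)
    qed
    also have "\<dots> = lower (\<varpi> * inverse z) \<cdot> (weyl_elt (z * ?t) \<cdot> lower (\<varpi> * inverse z))"
      using upper_eq_lower_weyl_lower[of "z * ?t"] z0 by (simp add: mult.commute)
    finally have g: "minv (simple_refl X1) \<cdot> minv (root_rep X1 b) \<cdot> simple_refl X1 =
      lower (\<varpi> * inverse z) \<cdot> (weyl_elt (z * ?t) \<cdot> lower (\<varpi> * inverse z))" .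
    \<comment> \<open>The first argument has order 1 and the second order 2, so the tame formula
      keeps only the quadratic character of the second, which has the square class of z.\<close>
    have "e = quad_char z"
    proof -
      have 1: "padic_ord (- (inverse (z * z * ?t))) = 1"
        using z0 z by (subst padic_ord_minus) (simp_all add: padic_ord_mult padic_ord_inverse)
      have 2: "padic_ord (inverse (z * ?t * ?t)) = 2"
        using z0 z by (simp add: padic_ord_mult padic_ord_inverse)
      have "quad_char (inverse (z * ?t * ?t)) = quad_char (inverse z)"
        using z0 quad_char_mult[of "inverse z" "\<varpi> * \<varpi>"] by (simp add: quad_char_mult mult.assoc)
      moreover have "quad_char (inverse z) * quad_char z = 1"
        using z0 quad_char_mult[of "inverse z" z] by simp
      then have "quad_char (inverse z) = quad_char z" using quad_char_cases[OF z0] by auto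
      ultimately show ?thesis
        unfolding e_def using z0 by (subst hilbert_symbol_tame) (simp_all add: 1 2 del: inverse_mult_distrib)
    qed
    then show ?thesis
      using big_cell_aux[OF _ _ chi_elt(2) chi_elt(2) z e_def _ g] elt_in_K0_cover(2)[OF l]
      by (simp add: X1 simple_refl_def[of X1] z_def[symmetric])
  qed
qed

end

subsection \<open>Words in the reflections\<close>

definition word_elt :: "hecke_gen list \<Rightarrow> 'p::prime_card metaplectic"
  where "word_elt v = foldr (\<lambda>i g. mp_mult (simple_refl i) g) v (mp_section (mat 1))"

lemma word_elt_simps [simp]:
  "word_elt [] = mp_section (mat 1)" "word_elt (i # v) = mp_mult (simple_refl i) (word_elt v)"
  by (simp_all add: word_elt_def)

lemma refl_matrix [simp]:
  "mp_matrix (simple_refl X0) = weyl 1" "mp_matrix (simple_refl X1) = weyl (inverse \<varpi>)"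
  by (simp_all add: simple_refl_def)

lemma inverse_uniformizer_mult_notin:
  "z \<notin> padic_integers \<Longrightarrow> inverse \<varpi> * z \<notin> padic_integers"
proof
  assume z: "z \<notin> padic_integers" "inverse \<varpi> * z \<in> padic_integers"
  have "\<varpi> * (inverse \<varpi> * z) \<in> padic_integers"
    by (intro padic_integers_closed(7) padic_integers_closed(3) z(2))
  moreover have "\<varpi> * (inverse \<varpi> * z) = z" by simp
  ultimately show False using z(1) by (simp only:)
qed

lemma inverse_uniformizer_notin: "inverse \<varpi> \<notin> (padic_integers :: 'p::prime_card padic set)"
  by (simp add: padic_integers_iff_ord padic_ord_inverse)

text \<open>The product s_1 s_0 is diagonal with entries -1/p and -p, so each further pair of
  letters multiplies the first row by -1/p and denominators only grow.\<close>

lemma word_elt_X1: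
  "distinct_adj (X1 # v) \<Longrightarrow> \<exists>j. mp_matrix (word_elt (X1 # v) :: 'p::prime_card metaplectic) $ 1 $ j \<notin> padic_integers"
proof (induction v rule: induct_list012)
  case 1
  show ?case using inverse_uniformizer_notin[where 'p = 'p] by (intro exI[of _ 2]) simp
next
  case (2 x)
  then have "x = X0" by (cases x) simp_all
  then show ?case using inverse_uniformizer_notin[where 'p = 'p] by (intro exI[of _ 1]) simp
next
  case (3 x y zs)
  then have xy: "x = X0" "y = X1" by (cases x; cases y; simp)+
  then obtain j where j: "mp_matrix (word_elt (X1 # zs) :: 'p metaplectic) $ 1 $ j \<notin> padic_integers"
    using 3 by auto
  have "mp_matrix (word_elt (X1 # x # y # zs) :: 'p metaplectic) $ 1 $ j =
      inverse \<varpi> * (- mp_matrix (word_elt (X1 # zs) :: 'p metaplectic) $ 1 $ j)"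
    unfolding xy by simp
  also have "\<dots> \<notin> padic_integers"
    by (intro inverse_uniformizer_mult_notin) (use j in \<open>simp only: vector_uminus_component padic_minus_iff not_False_eq_True\<close>)
  finally show ?case by blast
qed

text \<open>A leading s_0 moves the first row to the second with a sign, so any denominator
  survives. The word s_0 alone is integral but has the unit -1 in the lower left corner.\<close>

lemma word_elt_notin_K0:
  assumes "distinct_adj v" "v \<noteq> []"
  shows "(word_elt v :: 'p::prime_card metaplectic) \<notin> K0_cover"
proof
  assume K: "(word_elt v :: 'p metaplectic) \<in> K0_cover"
  then have int: "mp_matrix (word_elt v :: 'p metaplectic) $ i $ j \<in> padic_integers" for i j
    by (simp add: K0_cover_def K0_def)
  obtain i w where v: "v = i # w" using assms(2) by (cases v) auto
  show False
  proof (cases i)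
    case X1
    then show False using word_elt_X1[of w] assms(1) int unfolding v X1 by blast
  next
    case X0
    show False
    proof (cases w)
      case Nil
      then have "mp_matrix (word_elt v :: 'p metaplectic) $ 2 $ 1 = - 1" by (simp add: v X0)
      then have "(- 1 :: 'p padic) \<in> padic_ideal 1" using K unfolding mem_K0_cover_iff by metis
      moreover have "(- 1 :: 'p padic) \<in> padic_units" by (intro padic_units_minus padic_units_1)
      ultimately show False using padic_units_iff_ideal[of "- 1 :: 'p padic"] by (simp del: One_nat_def)
    next
      case (Cons j u)
      then have j: "j = X1" using assms(1) by (cases j) (simp_all add: v X0)
      then obtain l where l: "mp_matrix (word_elt (X1 # u) :: 'p metaplectic) $ 1 $ l \<notin> padic_integers"
        using word_elt_X1[of u] assms(1) by (auto simp: v Cons)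
      have "mp_matrix (word_elt v :: 'p metaplectic) $ 2 $ l = - mp_matrix (word_elt (X1 # u) :: 'p metaplectic) $ 1 $ l"
        unfolding v X0 Cons j by simp
      then show False using int[of 2 l] l by (simp only: vector_uminus_component padic_minus_iff)
    qed
  qed
qed

context odd_prime
begin

text \<open>Since \<open>K0_cover\<close> contains both lifts of the identity, whether an element
  preserves \<open>S\<close> depends only on its matrix. The products of the two reflections give
  the powers of p on the diagonal, hence the torus, all Weyl elements and all unipotents, and the
  Bruhat decomposition gives the rest.\<close>

lemma generated_by_reflections:
  assumes one: "mp_section (mat 1) \<in> S" and K: "\<And>k y. k \<in> K0_cover \<Longrightarrow> y \<in> S \<Longrightarrow> k \<cdot> y \<in> S"
    and simple_refl: "\<And>i y. y \<in> S \<Longrightarrow> simple_refl i \<cdot> y \<in> S"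
  shows "S = (UNIV :: 'p metaplectic set)"
proof -
  define good where "good A \<longleftrightarrow> (\<forall>g y. mp_matrix g = A \<longrightarrow> y \<in> S \<longrightarrow> g \<cdot> y \<in> S)" for A
  have goodI: "good (mp_matrix g0)" if "\<And>y. y \<in> S \<Longrightarrow> g0 \<cdot> y \<in> S" for g0
    unfolding good_def
  proof (intro allI impI)
    fix g y assume g: "mp_matrix g = mp_matrix g0" and y: "y \<in> S"
    have "mp_matrix (g \<cdot> minv g0) = mp_matrix (g0 \<cdot> minv g0)" by (simp only: mp_mult_matrix g)
    then have "mp_matrix (g \<cdot> minv g0) = mat 1" unfolding mp_inv by simp
    then have "g \<cdot> minv g0 \<in> K0_cover" by (simp add: K0_cover_def K0_1)
    then have "(g \<cdot> minv g0) \<cdot> (g0 \<cdot> y) \<in> S" by (intro K that y)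
    then show "g \<cdot> y \<in> S" by (simp add: mp_assoc mp_cancel)
  qed
  have mult: "good (A ** B)" if A: "good A" "det A = 1" and B: "good B" "det B = 1" for A B
  proof -
    have "(mp_section A \<cdot> mp_section B) \<cdot> y \<in> S" if "y \<in> S" for y
      using A B that unfolding good_def by (simp add: mp_assoc)
    then have "good (mp_matrix (mp_section A \<cdot> mp_section B))" by (rule goodI)
    then show ?thesis using A B by simp
  qed
  have K0: "good A" if "A \<in> K0" for A
    using that K unfolding good_def by (auto simp: K0_cover_def)
  have w: "good (weyl 1)" "good (weyl (inverse \<varpi>))"
    using goodI[of "simple_refl X0"] goodI[of "simple_refl X1"] simple_refl by simp_all
  have m1: "mat2 (- 1) 0 0 (- 1) \<in> (K0 :: ('p padic ^ 2 ^ 2) set)" by (simp add: K0_iff)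
  have D: "good (mat2 \<varpi> 0 0 (inverse \<varpi>))" "good (mat2 (inverse \<varpi>) 0 0 \<varpi>)"
  proof -
    have "mat2 \<varpi> 0 0 (inverse \<varpi>) = mat2 (- 1) 0 0 (- 1) ** (weyl 1 ** weyl (inverse \<varpi> :: 'p padic))"
      "mat2 (inverse \<varpi>) 0 0 \<varpi> = mat2 (- 1) 0 0 (- 1) ** (weyl (inverse \<varpi> :: 'p padic) ** weyl 1)"
      by (simp_all add: mat2_eq_iff[of "mat2 _ _ _ _"])
    then show "good (mat2 \<varpi> 0 0 (inverse \<varpi>))" "good (mat2 (inverse \<varpi>) 0 0 \<varpi>)"
      using w by (simp_all add: mult K0[OF m1] det_mul)
  qed
  have diag_mult: "mat2 x 0 0 y ** mat2 x' 0 0 y' = mat2 (x * x') 0 0 (y * y')" for x y x' y' :: "'p padic"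
    by (simp add: mat2_eq_iff[of "_ ** _"])
  have pow: "good (mat2 (\<varpi> ^ n) 0 0 (inverse (\<varpi> ^ n)))" "good (mat2 (inverse (\<varpi> ^ n)) 0 0 (\<varpi> ^ n))" for n
  proof (induction n)
    case 0
    { case 1 show ?case by (intro K0) (simp add: K0_iff) }
    { case 2 show ?case by (intro K0) (simp add: K0_iff) }
  next
    case (Suc n)
    { case 1 show ?case using mult[OF D(1) _ Suc(1)] by (simp add: diag_mult) }
    { case 2 show ?case using mult[OF D(2) _ Suc(2)] by (simp add: diag_mult) }
  qed
  have diag: "good (mat2 x 0 0 (inverse x))" if x0: "x \<noteq> 0" for x
  proof -
    obtain k u where x: "x = \<varpi> powi k * u" "u \<in> padic_units" using padic_decomp[OF x0] .
    have u: "good (mat2 u 0 0 (inverse u))"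
      using x(2) by (intro K0) (simp add: K0_iff padic_units_in_integers padic_units_inverse padic_units_nonzero)
    have u1: "det (mat2 u 0 0 (inverse u)) = 1" using padic_units_nonzero[OF x(2)] by simp
    show ?thesis
    proof (cases k rule: int_cases2)
      case (nonneg n)
      then show ?thesis using mult[OF pow(1)[of n] _ u u1] x(1) by (simp add: diag_mult)
    next
      case (nonpos n)
      then show ?thesis using mult[OF pow(2)[of n] _ u u1] x(1) by (simp add: diag_mult power_int_minus)
    qed
  qed
  have weyl: "good (weyl t)" if "t \<noteq> 0" for t
  proof -
    have "weyl t = mat2 t 0 0 (inverse t) ** weyl 1" by (simp add: mat2_eq_iff[of "weyl t"])
    then show ?thesis using mult[OF diag[OF that] _ w(1)] that by simp
  qed
  have upper: "good (mat2 1 z 0 1)" for z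
  proof (cases "z = 0")
    case True
    then show ?thesis by (intro K0) (simp add: K0_iff)
  next
    case False
    \<comment> \<open>Conjugation by diag(p^n, p^-n) multiplies the entry by p^(2n), which is enough
      to make it integral.\<close>
    define n where "n = nat \<bar>padic_ord z\<bar>"
    have "z * \<varpi> ^ n * \<varpi> ^ n \<in> padic_integers"
      using False by (simp add: padic_integers_iff_ord padic_ord_mult padic_ord_power n_def)
    then have g: "good (mat2 1 (z * \<varpi> ^ n * \<varpi> ^ n) 0 1)" by (intro K0) (simp add: K0_iff)
    have "mat2 1 z 0 1 = mat2 (inverse (\<varpi> ^ n)) 0 0 (\<varpi> ^ n) ** mat2 1 (z * \<varpi> ^ n * \<varpi> ^ n) 0 1 **
        mat2 (\<varpi> ^ n) 0 0 (inverse (\<varpi> ^ n))"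
      by (simp add: mat2_eq_iff[of "mat2 _ _ _ _"])
    also have "good \<dots>" by (intro mult pow g) (simp_all add: det_mul)
    finally show ?thesis .
  qed
  have main: "good A" if det: "det A = 1" and c: "A $ 2 $ 1 \<noteq> 0" for A
  proof -
    let ?a = "A $ 1 $ 1" and ?c = "A $ 2 $ 1" and ?d = "A $ 2 $ 2"
    have b: "A $ 1 $ 2 = (?a * ?d - 1) / ?c" using det c by (simp add: det_2 field_simps)
    have "A = mat2 1 (?a / ?c) 0 1 ** weyl (- inverse ?c) ** mat2 1 (?d / ?c) 0 1"
      using c by (simp add: mat2_eq_iff[of A] b field_simps)
    also have "good \<dots>" using c by (intro mult upper weyl) (simp_all add: det_mul)
    finally show ?thesis .
  qed
  have all: "good A" if det: "det A = 1" for A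
  proof (cases "A $ 2 $ 1 = 0")
    case True
    then have d: "A $ 2 $ 2 \<noteq> 0" using det by (auto simp: det_2)
    \<comment> \<open>Right multiplication by w(-1) moves the nonzero lower right entry into the
      lower left corner, which returns to the big cell.\<close>
    have "A = (A ** weyl (- 1)) ** weyl 1" by (simp add: mat2_eq_iff[of A])
    also have "good \<dots>"
      using d by (intro mult main w) (simp_all add: det_mul det)
    finally show ?thesis .
  qed (rule main[OF det])
  have "g \<in> S" for g
  proof -
    have "g \<cdot> mp_section (mat 1) \<in> S" using all[of "mp_matrix g"] one unfolding good_def by simp
    then show ?thesis by (simp add: mp_one)
  qed
  then show ?thesis by blast
qed

end

section \<open>Topology of the double cover\<close>

lemma principal_congruence_iff:
  "A \<in> principal_congruence n \<longleftrightarrow> det A = 1 \<and> A $ 1 $ 1 - 1 \<in> padic_ideal n \<and> A $ 1 $ 2 \<in> padic_ideal n \<and>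
    A $ 2 $ 1 \<in> padic_ideal n \<and> A $ 2 $ 2 - 1 \<in> padic_ideal n"
  by (auto simp: principal_congruence_def forall_2)

lemma principal_congruence_antimono:
  assumes "m \<le> n" "A \<in> principal_congruence n"
  shows "A \<in> principal_congruence m"
  using assms(2) by (auto simp: principal_congruence_iff intro: padic_ideal_antimono[OF assms(1)])

lemma principal_congruence_det: "A \<in> principal_congruence n \<Longrightarrow> det A = 1"
  by (simp add: principal_congruence_iff)

lemma principal_congruence_K0:
  assumes "A \<in> principal_congruence 1"
  shows "A \<in> K0"
proof -
  have "A $ 1 $ 1 - 1 \<in> padic_ideal 1" "A $ 2 $ 2 - 1 \<in> padic_ideal 1" "A $ 1 $ 2 \<in> padic_ideal 1"
    using assms by (simp_all add: principal_congruence_iff)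
  note int = this[THEN padic_ideal_subset_integers]
  have "A $ 1 $ 1 \<in> padic_integers" "A $ 2 $ 2 \<in> padic_integers"
    using padic_integers_closed(5)[OF int(1), of 1] padic_integers_closed(5)[OF int(2), of 1] by simp_all
  then show ?thesis using assms int(3) by (simp add: K0_iff principal_congruence_iff)
qed

lemma padic_ideal_Inter: "(\<And>n. z \<in> padic_ideal n) \<Longrightarrow> z = 0"
proof (rule ccontr)
  assume "\<And>n. z \<in> padic_ideal n" "z \<noteq> 0"
  then have "int (nat (padic_ord z + 1)) \<le> padic_ord z" using padic_ideal_iff_ord by blast
  then show False by linarith
qed

lemma padic_limit:
  assumes f: "\<And>n. f n \<in> padic_integers" and diff: "\<And>n. f (Suc n) - f n \<in> padic_ideal n"
  obtains z where "z \<in> padic_integers" "\<And>n. z - f n \<in> padic_ideal n"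
proof -
  have "\<exists>u. f n = padic_of u" for n using f[of n] by (auto elim: padic_integersE)
  then obtain g where g: "\<And>n. f n = padic_of (g n)" by metis
  have eq: "padic_res (g (Suc n)) n = padic_res (g n) n" for n
  proof -
    have "padic_of (g (Suc n) - g n) \<in> padic_ideal n" using diff[of n] by (simp add: g padic_of_simps)
    then have "(padic_res (g (Suc n)) n - padic_res (g n) n) mod int CARD('a) ^ n = 0"
      by (simp add: padic_of_in_ideal_iff padic_res_diff)
    then have "padic_res (g (Suc n)) n mod int CARD('a) ^ n = padic_res (g n) n mod int CARD('a) ^ n"
      by (simp only: mod_eq_dvd_iff mod_eq_0_iff_dvd)
    then show ?thesis by simp
  qed
  have compat: "padic_res (g (Suc n)) (Suc n) mod int CARD('a) ^ n = padic_res (g n) n" for n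
    using padic_res_mod_le[of n "Suc n" "g (Suc n)"] eq[of n] by simp
  have "\<exists>z :: 'a padic_int. \<forall>n. padic_res z n = padic_res (g n) n"
    using padic_int_exists[where 'p = 'a, OF compat, of "\<exists>z :: 'a padic_int. \<forall>n. padic_res z n = padic_res (g n) n"]
    by blast
  then obtain z :: "'a padic_int" where z: "\<And>n. padic_res z n = padic_res (g n) n" by blast
  have "padic_of z - f n \<in> padic_ideal n" for n
    unfolding g padic_of_simps(4)[symmetric] padic_of_in_ideal_iff by (simp add: padic_res_diff z)
  then show ?thesis by (rule that[OF padic_integersI])
qed

text \<open>The residue modulo p^n, transported to the field. It is meaningful on p-adic integers,
  where \<open>padic_of\<close> has a unique preimage.\<close>

definition digit :: "nat \<Rightarrow> 'p::prime_card padic \<Rightarrow> int"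
  where "digit n z = padic_res (inv_into UNIV padic_of z) n"

lemma digit_padic_of: "digit n (padic_of u) = padic_res (u :: 'p::prime_card padic_int) n"
proof -
  have "inj (padic_of :: 'p padic_int \<Rightarrow> 'p padic)" by (rule injI) simp
  then show ?thesis by (simp add: digit_def)
qed

lemma digit_eq_iff:
  assumes "x \<in> padic_integers" "y \<in> padic_integers"
  shows "digit n x = digit n y \<longleftrightarrow> x - y \<in> padic_ideal n"
proof -
  obtain u v where x: "x = padic_of u" and y: "y = padic_of v" using assms by (metis padic_integersE)
  have "x - y \<in> padic_ideal n \<longleftrightarrow> (padic_res u n - padic_res v n) mod int CARD('a) ^ n = 0"
    unfolding x y padic_of_simps(4)[symmetric] padic_of_in_ideal_iff padic_res_diff ..
  also have "\<dots> \<longleftrightarrow> padic_res u n mod int CARD('a) ^ n = padic_res v n mod int CARD('a) ^ n"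
    by (simp only: mod_eq_dvd_iff mod_eq_0_iff_dvd)
  finally show ?thesis by (simp add: x y digit_padic_of)
qed

lemma digit_bounds:
  "x \<in> padic_integers \<Longrightarrow> digit n (x :: 'p::prime_card padic) \<in> {0..<int CARD('p) ^ n}"
  by (elim padic_integersE) (simp add: digit_padic_of padic_res_less)

section \<open>Compactness and openness of the Iwahori subgroup\<close>

context odd_prime
begin

lemma section_in_K0_cover: "A \<in> principal_congruence 1 \<Longrightarrow> mp_section A \<in> (K0_cover :: 'p metaplectic set)"
  by (simp add: K0_cover_def principal_congruence_K0 principal_congruence_det)

lemma K0_cover_mult: "x \<in> K0_cover \<Longrightarrow> y \<in> K0_cover \<Longrightarrow> x \<cdot> y \<in> (K0_cover :: 'p metaplectic set)"
  using subgroup.m_closed[OF K0_cover_subgroup, of x y] by (simp add: mp_group_def)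

lemma K0_cover_mult_cancel:
  assumes "y \<in> K0_cover"
  shows "x \<cdot> y \<in> (K0_cover :: 'p metaplectic set) \<longleftrightarrow> x \<in> K0_cover"
proof
  assume "x \<cdot> y \<in> K0_cover"
  moreover have "minv y \<in> K0_cover"
    using subgroup.m_inv_closed[OF K0_cover_subgroup assms] .
  ultimately have "x \<cdot> y \<cdot> minv y \<in> K0_cover" by (rule K0_cover_mult)
  then show "x \<in> K0_cover" by (simp add: mp_assoc mp_inv mp_one)
qed (rule K0_cover_mult[OF _ assms])

lemma open_K0_coset: "open {y :: 'p metaplectic. minv x \<cdot> y \<in> K0_cover}"
  unfolding open_metaplectic_def
proof (intro ballI exI)
  fix y :: "'p metaplectic" and A :: "'p padic ^ 2 ^ 2"
  assume "y \<in> {y. minv x \<cdot> y \<in> K0_cover}" "A \<in> principal_congruence 1"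
  then show "y \<cdot> mp_section A \<in> {y. minv x \<cdot> y \<in> K0_cover}"
    by (simp add: section_in_K0_cover K0_cover_mult flip: mp_assoc)
qed

lemma closed_K0_coset: "closed {y :: 'p metaplectic. minv x \<cdot> y \<in> K0_cover}"
  unfolding closed_def open_metaplectic_def
proof (intro ballI exI)
  fix y :: "'p metaplectic" and A :: "'p padic ^ 2 ^ 2"
  assume "y \<in> - {y. minv x \<cdot> y \<in> K0_cover}" "A \<in> principal_congruence 1"
  then show "y \<cdot> mp_section A \<in> - {y. minv x \<cdot> y \<in> K0_cover}"
    by (simp add: section_in_K0_cover K0_cover_mult_cancel flip: mp_assoc)
qed

definition close :: "nat \<Rightarrow> 'p metaplectic \<Rightarrow> 'p metaplectic \<Rightarrow> bool"
  where "close n x y \<longleftrightarrow> mp_sign x = mp_sign y \<and> (\<forall>i j. mp_matrix x $ i $ j - mp_matrix y $ i $ j \<in> padic_ideal n)"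

text \<open>Entrywise closeness describes the topology on \<open>K0_cover\<close>: x^-1 y is
  computed with the adjugate and is congruent to 1. The bound n \<ge> 1 places it in
  \<open>K0\<close>, where the cocycle is trivial and equal signs suffice.\<close>

lemma close_in_neighbourhood:
  assumes xy: "x \<in> K0_cover" "y \<in> K0_cover" and close: "close n y x" and n: "n \<ge> 1"
  obtains A where "A \<in> principal_congruence n" "y = x \<cdot> mp_section A"
proof
  let ?X = "mp_matrix x" and ?Y = "mp_matrix y"
  let ?B = "mat2 (?X $ 2 $ 2) (- ?X $ 1 $ 2) (- ?X $ 2 $ 1) (?X $ 1 $ 1)"
  let ?A = "?B ** ?Y"
  have int: "?X $ i $ j \<in> padic_integers" for i j using xy by (simp add: K0_cover_def K0_def)
  have d: "?Y $ i $ j - ?X $ i $ j \<in> padic_ideal n" for i j using close by (simp add: close_def)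
  have BX: "?B ** ?X = mat 1" by (rule matrix_adjugate_2(1)) simp
  have "(?B ** ?Y) $ i $ j - (?B ** ?X) $ i $ j \<in> padic_ideal n" for i j
  proof -
    have "?B $ i $ l \<in> padic_integers" for i l
      using int exhaust_2[of i] exhaust_2[of l] by (auto simp: vector_uminus_component)
    then have "?B $ i $ 1 * (?Y $ 1 $ j - ?X $ 1 $ j) + ?B $ i $ 2 * (?Y $ 2 $ j - ?X $ 2 $ j) \<in> padic_ideal n"
      using d by (intro padic_ideal_closed(2) padic_ideal_closed(6))
    then show ?thesis by (simp add: algebra_simps)
  qed
  moreover have detA: "det ?A = 1" by (simp add: det_mul) (metis det_2 det_mp_matrix mult.commute)
  ultimately show A: "?A \<in> principal_congruence n"
    unfolding BX by (simp add: principal_congruence_def)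
  have AK: "?A \<in> K0" using principal_congruence_antimono[OF n A] by (rule principal_congruence_K0)
  show "y = x \<cdot> mp_section ?A"
  proof (rule mp_eqI)
    have "?X ** ?A = ?Y"
      by (simp only: matrix_mul_assoc matrix_adjugate_2(2)[OF det_mp_matrix] matrix_mul_lid)
    then show "mp_matrix y = mp_matrix (x \<cdot> mp_section ?A)"
      by (simp only: mp_mult_matrix mp_section_matrix[OF detA])
    have "kubota_cocycle ?X ?A = 1" using xy AK by (intro kubota_cocycle_K0) (simp_all add: K0_cover_def)
    then show "mp_sign y = mp_sign (x \<cdot> mp_section ?A)"
      using close by (simp only: mp_mult_sign mp_section_matrix[OF detA] mp_section_sign[OF detA] close_def mult_1_right)
  qed
qed

text \<open>Total boundedness: the residues of the four entries modulo p^n and the sign take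
  finitely many values. Representatives are picked inside \<open>S\<close> so that the covering
  argument can be iterated on subsets.\<close>

lemma finite_close_classes:
  assumes S: "S \<subseteq> (K0_cover :: 'p metaplectic set)"
  obtains R where "finite R" "R \<subseteq> S" "\<And>y. y \<in> S \<Longrightarrow> \<exists>x\<in>R. close n y x"
proof -
  define code where "code x = (digit n (mp_matrix x $ 1 $ 1), digit n (mp_matrix x $ 1 $ 2),
    digit n (mp_matrix x $ 2 $ 1), digit n (mp_matrix x $ 2 $ 2), mp_sign x)" for x :: "'p metaplectic"
  let ?D = "{0..<int CARD('p) ^ n}"
  have int: "mp_matrix x $ i $ j \<in> padic_integers" if "x \<in> S" for x i j
    using that S by (auto simp: K0_cover_def K0_def)
  have "code x \<in> ?D \<times> ?D \<times> ?D \<times> ?D \<times> {1, - 1}" if "x \<in> S" for x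
    using digit_bounds[OF int[OF that], of n] mp_sign_cases[of x] by (auto simp: code_def)
  then have "code ` S \<subseteq> ?D \<times> ?D \<times> ?D \<times> ?D \<times> {1, - 1}" by blast
  then have fin: "finite (code ` S)" by (rule finite_subset) simp
  define R where "R = (\<lambda>t. SOME x. x \<in> S \<and> code x = t) ` code ` S"
  have R: "(SOME x. x \<in> S \<and> code x = code y) \<in> S \<and> code (SOME x. x \<in> S \<and> code x = code y) = code y" if "y \<in> S" for y
    using that by (intro someI_ex[of "\<lambda>x. x \<in> S \<and> code x = code y"]) blast
  have cl: "close n y x" if "x \<in> S" "y \<in> S" "code x = code y" for x y
    using that(3) by (auto simp: code_def close_def forall_2
      intro!: digit_eq_iff[OF int[OF that(2)] int[OF that(1)], THEN iffD1])
  show ?thesis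
  proof
    show "finite R" using fin by (simp add: R_def)
    show "R \<subseteq> S" using R by (auto simp: R_def)
    show "\<exists>x\<in>R. close n y x" if "y \<in> S" for y
      using R[OF that] that cl by (auto simp: R_def)
  qed
qed

lemma close_sym: "close n x y \<Longrightarrow> close n y x"
proof -
  assume *: "close n x y"
  then have "- (mp_matrix x $ i $ j - mp_matrix y $ i $ j) \<in> padic_ideal n" for i j
    unfolding close_def by (intro padic_ideal_closed(4)) blast
  then show ?thesis using * by (simp add: close_def)
qed

lemma close_trans: "close n x y \<Longrightarrow> close n y z \<Longrightarrow> close n x z"
proof -
  assume *: "close n x y" "close n y z"
  then have "(mp_matrix x $ i $ j - mp_matrix y $ i $ j) + (mp_matrix y $ i $ j - mp_matrix z $ i $ j) \<in> padic_ideal n" for i j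
    unfolding close_def by (intro padic_ideal_closed(2)) blast+
  then show ?thesis using * by (simp add: close_def)
qed

lemma close_limit:
  assumes x: "\<And>n. x n \<in> (K0_cover :: 'p metaplectic set)" and close: "\<And>n. close n (x (Suc n)) (x n)"
  obtains y where "y \<in> K0_cover" "\<And>n. close n y (x n)"
proof -
  have int: "mp_matrix (x n) $ i $ j \<in> padic_integers" for n i j
    using x[of n] by (simp add: K0_cover_def K0_def)
  have "\<exists>z. z \<in> padic_integers \<and> (\<forall>n. z - mp_matrix (x n) $ i $ j \<in> padic_ideal n)" for i j
  proof -
    have "mp_matrix (x (Suc n)) $ i $ j - mp_matrix (x n) $ i $ j \<in> padic_ideal n" for n
      using close[of n] by (simp add: close_def)
    then show ?thesis using padic_limit[of "\<lambda>n. mp_matrix (x n) $ i $ j"] int by metis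
  qed
  then obtain Z where Z: "\<And>i j. Z i j \<in> padic_integers" "\<And>i j n. Z i j - mp_matrix (x n) $ i $ j \<in> padic_ideal n"
    by metis
  let ?Z = "mat2 (Z 1 1) (Z 1 2) (Z 2 1) (Z 2 2)"
  have sgn: "mp_sign (x n) = mp_sign (x 0)" for n
    using close by (induction n) (simp_all add: close_def)
  have "det ?Z - 1 \<in> padic_ideal n" for n
  proof -
    let ?X = "mp_matrix (x n)"
    have "det ?Z - det ?X = Z 1 1 * (Z 2 2 - ?X $ 2 $ 2) + (Z 1 1 - ?X $ 1 $ 1) * ?X $ 2 $ 2
      - (Z 1 2 * (Z 2 1 - ?X $ 2 $ 1) + (Z 1 2 - ?X $ 1 $ 2) * ?X $ 2 $ 1)"
      by (simp add: det_2 algebra_simps)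
    also have "\<dots> \<in> padic_ideal n"
      by (intro padic_ideal_closed(2,3) padic_ideal_closed(5,6) Z int)
    finally show ?thesis by simp
  qed
  then have detZ: "det ?Z = 1" using padic_ideal_Inter[of "det ?Z - 1"] by simp
  have "Z 2 1 - mp_matrix (x 1) $ 2 $ 1 + mp_matrix (x 1) $ 2 $ 1 \<in> padic_ideal 1"
    using x[of 1] unfolding mem_K0_cover_iff by (intro padic_ideal_closed(2) Z) blast
  then have z21: "Z 2 1 \<in> padic_ideal 1" by simp
  let ?y = "Abs_metaplectic (?Z, mp_sign (x 0))"
  have m: "mp_matrix ?y = ?Z" by (rule mp_matrix_Abs[OF detZ mp_sign_cases])
  have s: "mp_sign ?y = mp_sign (x 0)" by (rule mp_sign_Abs[OF detZ mp_sign_cases])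
  show ?thesis
  proof
    show "?y \<in> K0_cover" unfolding mem_K0_cover_iff m using Z z21 by simp
    show "close n ?y (x n)" for n
      unfolding close_def m s using Z(2) sgn[of n] by (simp add: forall_2)
  qed
qed

text \<open>If no finite subcover existed, total boundedness would give a sequence of ever finer
  classes without one, each centre chosen in the preceding class. Their limit lies in a member of
  the cover, which already contains a whole class.\<close>

lemma compact_K0_cover: "compact (K0_cover :: 'p metaplectic set)"
  unfolding compact_eq_Heine_Borel
proof (intro allI impI)
  fix C :: "'p metaplectic set set"
  assume C: "(\<forall>c\<in>C. open c) \<and> K0_cover \<subseteq> \<Union> C"
  define fc where "fc X \<longleftrightarrow> (\<exists>D\<subseteq>C. finite D \<and> X \<subseteq> \<Union> D)" for X
  have fc_mono: "fc X" if "fc Y" "X \<subseteq> Y" for X Y using that unfolding fc_def by (meson order_trans)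
  have fc_UN: "fc (\<Union>i\<in>I. X i)" if "finite I" "\<And>i. i \<in> I \<Longrightarrow> fc (X i)" for I :: "'p metaplectic set" and X
    using that
  proof induction
    case empty
    then show ?case unfolding fc_def by (intro exI[of _ "{}"]) simp
  next
    case (insert i I)
    then obtain D D' where "D \<subseteq> C" "finite D" "(\<Union>i\<in>I. X i) \<subseteq> \<Union> D" "D' \<subseteq> C" "finite D'" "X i \<subseteq> \<Union> D'"
      unfolding fc_def by (metis insertCI)
    then show ?case unfolding fc_def by (intro exI[of _ "D \<union> D'"]) auto
  qed
  define B where "B n x = {y \<in> K0_cover. close n y x}" for n x
  have split: "\<exists>x\<in>S. \<not> fc (B n x)" if S: "S \<subseteq> K0_cover" "\<not> fc S" for S n
  proof (rule ccontr)
    assume "\<not> (\<exists>x\<in>S. \<not> fc (B n x))"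
    then have fc: "fc (B n x)" if "x \<in> S" for x using that by blast
    obtain R where R: "finite R" "R \<subseteq> S" "\<And>y. y \<in> S \<Longrightarrow> \<exists>x\<in>R. close n y x"
      using finite_close_classes[OF S(1), of n] by blast
    have "fc (\<Union>x\<in>R. B n x)" using R fc by (intro fc_UN) auto
    moreover have "S \<subseteq> (\<Union>x\<in>R. B n x)" using R S by (auto simp: B_def)
    ultimately show False using S(2) fc_mono by blast
  qed
  show "\<exists>D\<subseteq>C. finite D \<and> K0_cover \<subseteq> \<Union> D"
  proof (rule ccontr)
    assume "\<not> (\<exists>D\<subseteq>C. finite D \<and> K0_cover \<subseteq> \<Union> D)"
    then have nfc: "\<not> fc K0_cover" by (simp add: fc_def)
    have "\<exists>x. \<forall>n. (x n \<in> K0_cover \<and> \<not> fc (B n (x n))) \<and> close n (x (Suc n)) (x n)"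
    proof (rule dependent_nat_choice)
      show "\<exists>x. x \<in> K0_cover \<and> \<not> fc (B 0 x)" using split[OF order_refl nfc] by blast
      fix x n assume "x \<in> K0_cover \<and> \<not> fc (B n x)"
      then obtain y where "y \<in> B n x" "\<not> fc (B (Suc n) y)"
        using split[of "B n x" "Suc n"] by (auto simp: B_def)
      then show "\<exists>y. (y \<in> K0_cover \<and> \<not> fc (B (Suc n) y)) \<and> close n y x" by (auto simp: B_def)
    qed
    then obtain x where x: "\<And>n. x n \<in> K0_cover" "\<And>n. \<not> fc (B n (x n))" "\<And>n. close n (x (Suc n)) (x n)" by blast
    obtain y where y: "y \<in> K0_cover" "\<And>n. close n y (x n)" using close_limit[OF x(1,3)] by blast
    obtain U where U: "U \<in> C" "y \<in> U" "open U" using C y by blast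
    then obtain n where n: "\<And>A. A \<in> principal_congruence n \<Longrightarrow> y \<cdot> mp_section A \<in> U"
      unfolding open_metaplectic_def by blast
    \<comment> \<open>\<open>close_in_neighbourhood\<close> needs a level of at least 1.\<close>
    let ?m = "max n 1"
    have "B ?m (x ?m) \<subseteq> U"
    proof
      fix w assume "w \<in> B ?m (x ?m)"
      then have w: "w \<in> K0_cover" "close ?m w (x ?m)" by (auto simp: B_def)
      have cl: "close ?m w y" using close_trans[OF w(2) close_sym[OF y(2)]] .
      obtain A where A: "A \<in> principal_congruence ?m" "w = y \<cdot> mp_section A"
        using close_in_neighbourhood[OF y(1) w(1) cl max.cobounded2] .
      show "w \<in> U"
        unfolding A(2) by (rule n[OF principal_congruence_antimono[OF max.cobounded1 A(1)]])
    qed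
    then have "fc (B ?m (x ?m))" unfolding fc_def using U by (intro exI[of _ "{U}"]) auto
    then show False using x(2) by blast
  qed
qed

lemma compact_K0_coset: "compact {y :: 'p metaplectic. minv x \<cdot> y \<in> K0_cover}"
proof -
  have "continuous_on UNIV (\<lambda>y. x \<cdot> y)"
    unfolding continuous_on_open_vimage[OF open_UNIV]
  proof (intro allI impI)
    fix B :: "'p metaplectic set" assume "open B"
    then show "open ((\<lambda>y. x \<cdot> y) -` B \<inter> UNIV)"
      unfolding open_metaplectic_def by (auto simp: mp_assoc[symmetric])
  qed
  then have "compact ((\<lambda>y. x \<cdot> y) ` K0_cover)"
    using compact_K0_cover compact_continuous_image continuous_on_subset by blast
  moreover have "{y. minv x \<cdot> y \<in> K0_cover} = (\<lambda>y. x \<cdot> y) ` K0_cover"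
    by (force simp: mp_cancel image_iff)
  ultimately show ?thesis by simp
qed

end

section \<open>The Iwahori Hecke algebra of the double cover\<close>

lemma mp_group_simps:
  "carrier mp_group = UNIV" "x \<otimes>\<^bsub>mp_group\<^esub> y = mp_mult x y" "\<one>\<^bsub>mp_group\<^esub> = mp_section (mat 1)"
  by (simp_all add: mp_group_def)

text \<open>If all nonzero residues were squares, squaring would be surjective on a finite set and
  hence injective, but 1 and p - 1 have the same square.\<close>

lemma ex_quadratic_nonresidue:
  assumes p: "prime p" "2 < p"
  shows "\<exists>n\<in>{0<..<p}. Legendre (int n) (int p) = - 1"
proof (rule ccontr)
  assume no: "\<not> (\<exists>n\<in>{0<..<p}. Legendre (int n) (int p) = - 1)"
  let ?f = "\<lambda>b. b ^ 2 mod p"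
  have res: "\<exists>m\<in>{0<..<p}. n = ?f m" if n: "n \<in> {0<..<p}" for n
  proof -
    have nd: "\<not> int p dvd int n" using n by (simp add: nat_dvd_not_less)
    then have "Legendre (int n) (int p) = 1" using no n Legendre_eq_1_or_minus_1[OF nd] by blast
    then obtain y where y: "[y ^ 2 = int n] (mod int p)"
      by (auto simp: Legendre_def QuadRes_def split: if_splits)
    let ?m = "nat (y mod int p)"
    have p0: "int p > 0" using p by simp
    have m: "int ?m = y mod int p" using p0 by simp
    have "int (?f ?m) = y ^ 2 mod int p" unfolding zmod_int of_nat_power m by (simp add: power_mod)
    also have "\<dots> = int n" using y n by (simp add: cong_def)
    finally have fm: "?f ?m = n" by linarith
    have "?m \<noteq> 0" using fm n by (cases "?m = 0") auto
    moreover have "int ?m < int p" unfolding m using p0 by simp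
    ultimately show ?thesis using fm by (intro bexI[of _ ?m]) auto
  qed
  have "?f ` {0<..<p} = {0<..<p}"
  proof (rule card_subset_eq[symmetric])
    show "{0<..<p} \<subseteq> ?f ` {0<..<p}" using res by blast
    then show "card {0<..<p} = card (?f ` {0<..<p})"
      by (intro le_antisym card_mono card_image_le) simp_all
  qed simp
  then have "inj_on ?f {0<..<p}" by (intro finite_surj_inj) simp_all
  moreover have "?f 1 = ?f (p - 1)"
  proof -
    have "(p - 1) ^ 2 = 1 + p * (p - 2)"
      using p(2) by (cases p) (simp_all add: power2_eq_square algebra_simps)
    moreover have "(1 + p * (p - 2)) mod p = 1 mod p" by (rule mod_mult_self2)
    ultimately show ?thesis by (simp only: power_one)
  qed
  ultimately have "1 = p - 1" using p(2) by (auto dest: inj_onD[of ?f "{0<..<p}" 1 "p - 1"])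
  then show False using p(2) by simp
qed

text \<open>Multiplication by a non-residue permutes the nonzero residues and negates every
  summand.\<close>

lemma sum_Legendre:
  assumes p: "prime p" "2 < p"
  shows "(\<Sum>b\<in>{0<..<p}. Legendre (int b) (int p)) = 0"
proof -
  obtain n where n: "n \<in> {0<..<p}" "Legendre (int n) (int p) = - 1"
    using ex_quadratic_nonresidue[OF p] by blast
  let ?f = "\<lambda>b. (n * b) mod p" and ?D = "{0<..<p}"
  have "\<not> p dvd n" using n by (simp add: nat_dvd_not_less)
  then have cop: "coprime n p" using prime_imp_coprime[OF p(1)] by (simp add: coprime_commute)
  have inj: "inj_on ?f ?D"
  proof (rule inj_onI)
    fix a b assume "a \<in> ?D" "b \<in> ?D" "?f a = ?f b"
    then have "[a = b] (mod p)" using cong_mult_lcancel_nat[OF cop] by (simp add: cong_def)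
    then show "a = b" using \<open>a \<in> ?D\<close> \<open>b \<in> ?D\<close> by (simp add: cong_def)
  qed
  have into: "?f ` ?D \<subseteq> ?D"
  proof
    fix c assume "c \<in> ?f ` ?D"
    then obtain b where b: "b \<in> ?D" "c = ?f b" by blast
    have "\<not> p dvd n * b" using p n b by (auto simp: prime_dvd_mult_iff nat_dvd_not_less)
    then show "c \<in> ?D" using b p by (simp add: dvd_eq_mod_eq_0)
  qed
  have surj: "?f ` ?D = ?D" by (rule endo_inj_surj[OF _ into inj]) simp
  have "(\<Sum>b\<in>?D. Legendre (int b) (int p)) = (\<Sum>b\<in>?f ` ?D. Legendre (int b) (int p))" unfolding surj ..
  also have "\<dots> = (\<Sum>b\<in>?D. Legendre (int (?f b)) (int p))" by (subst sum.reindex[OF inj]) simp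
  also have "\<dots> = (\<Sum>b\<in>?D. - Legendre (int b) (int p))"
    using n(2) by (intro sum.cong refl) (simp add: zmod_int Legendre_mod Legendre_mult[OF p])
  finally show ?thesis by (simp add: sum_negf)
qed

lemma Legendre_minus_1:
  assumes p: "prime p" "2 < p"
  shows "Legendre (- 1) (int p) = (if p mod 4 = 1 then 1 else - 1)"
proof -
  have odd: "odd p" using p prime_odd_nat by blast
  have nd: "\<not> int p dvd - 1" using p by simp
  have "[Legendre (- 1) (int p) = (- 1) ^ ((p - 1) div 2)] (mod int p)"
    by (rule euler_criterion[OF p])
  then have "int p dvd Legendre (- 1) (int p) - (- 1) ^ ((p - 1) div 2)" by (simp add: cong_iff_dvd_diff)
  moreover have "\<bar>Legendre (- 1) (int p) - (- 1) ^ ((p - 1) div 2)\<bar> < int p"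
    using Legendre_eq_1_or_minus_1[OF nd] p(2) by (cases "even ((p - 1) div 2)") auto
  ultimately have "Legendre (- 1) (int p) = (- 1) ^ ((p - 1) div 2)"
    using int_dvd_abs_less_imp_0 by fastforce
  moreover have "even ((p - 1) div 2) \<longleftrightarrow> p mod 4 = 1" using odd by presburger
  ultimately show ?thesis by simp
qed

section \<open>The constants in the quadratic relations\<close>

context iwahori_char
begin

definition cell_value :: "hecke_gen \<Rightarrow> complex"
  where "cell_value i = cnj (hecke_d CARD('p) (case i of X0 \<Rightarrow> 0 | X1 \<Rightarrow> 1))"

lemma Legendre_minus_1_square: "Legendre (- 1) (int CARD('p)) * Legendre (- 1) (int CARD('p)) = 1"
  by (simp add: Legendre_minus_1[OF prime_card CARD_gt_2])

text \<open>Conjugation absorbs the Legendre factor in \<open>hecke_d\<close>: for p = 3 modulo 4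
  the conjugate of -i is i, and otherwise both factors are 1.\<close>

lemma cell_value_simps:
  "cell_value X0 = 1" "cell_value X1 = eps CARD('p)"
  "(eps CARD('p)) ^ 2 = of_int (Legendre (- 1) (int CARD('p)))"
  by (simp_all add: cell_value_def hecke_d_def eps_def Legendre_minus_1[OF prime_card CARD_gt_2])

lemma cell_value_nonzero: "cell_value i \<noteq> 0"
  by (cases i) (simp_all add: cell_value_simps eps_def)

lemma residue_minus_1: "padic_residue (- 1 :: 'p padic) = (- 1) mod int CARD('p)"
  using padic_residue_of_int[where 'p = 'p, of "- 1"] by simp

lemma quad_char_minus_1: "quad_char (- 1 :: 'p padic) = Legendre (- 1) (int CARD('p))"
proof -
  have "(- 1 :: 'p padic) \<in> padic_units" by (intro padic_units_minus padic_units_1)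
  then show ?thesis by (simp add: quad_char_unit residue_minus_1 Legendre_mod)
qed

text \<open>The square lies over -1 with sign (1/t, 1/t), which is 1 for t = 1 and (p, p) = (-1/p)
  for t = 1/p. The character is 1 or -1 there, so passing to the inverse changes nothing.\<close>

lemma simple_refl_square:
  "simple_refl i \<cdot> simple_refl i \<in> K0_cover"
  "chi (minv (simple_refl i \<cdot> simple_refl i)) =
    of_int (case i of X0 \<Rightarrow> 1 | X1 \<Rightarrow> Legendre (- 1) (int CARD('p))) * \<gamma> (padic_residue (- 1 :: 'p padic))"
proof -
  let ?z = "simple_refl i \<cdot> simple_refl i"
  have m: "mp_matrix ?z = mat2 (- 1) 0 0 (- 1)"
    unfolding simple_refl_def by (rule weyl_square(1)[OF root_param_nonzero])
  have s: "mp_sign ?z = hilbert_symbol (inverse (root_param i)) (inverse (root_param i :: 'p padic))"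
    unfolding simple_refl_def by (rule weyl_square(2)[OF root_param_nonzero])
  show K: "?z \<in> K0_cover" unfolding mem_K0_cover_iff m by simp
  have "hilbert_symbol (\<varpi> :: 'p padic) \<varpi> = Legendre (- 1) (int CARD('p))"
    by (simp add: hilbert_symbol_tame quad_char_minus_1)
  then have sgn: "mp_sign ?z = (case i of X0 \<Rightarrow> 1 | X1 \<Rightarrow> Legendre (- 1) (int CARD('p)))"
    unfolding s by (cases i) simp_all
  have chi: "chi ?z = of_int (case i of X0 \<Rightarrow> 1 | X1 \<Rightarrow> Legendre (- 1) (int CARD('p))) * \<gamma> (padic_residue (- 1 :: 'p padic))"
    unfolding chi_eq m sgn by simp
  have "chi ?z = 1 \<or> chi ?z = - 1"
    using \<gamma>_residue_cases[OF padic_units_minus[OF padic_units_1]] mp_sign_cases[of ?z]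
    unfolding chi_eq m by auto
  moreover have "chi (?z \<cdot> minv ?z) = chi ?z * chi (minv ?z)"
    using K subgroup.m_inv_closed[OF K0_cover_subgroup K] by (rule chi_mult)
  then have "chi ?z * chi (minv ?z) = 1" unfolding mp_inv by simp
  ultimately have "chi (minv ?z) = chi ?z" by (auto simp: minus_equation_iff[of "chi (minv ?z)"])
  then show "chi (minv ?z) = of_int (case i of X0 \<Rightarrow> 1 | X1 \<Rightarrow> Legendre (- 1) (int CARD('p))) * \<gamma> (padic_residue (- 1 :: 'p padic))"
    unfolding chi .
qed

lemma quad_char_of_nat: "b \<in> {0<..<CARD('p)} \<Longrightarrow> quad_char (of_nat b :: 'p padic) = Legendre (int b) (int CARD('p))"
proof -
  assume b: "b \<in> {0<..<CARD('p)}"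
  then have "(of_nat b :: 'p padic) \<in> padic_units" by (intro of_nat_unit) simp_all
  moreover have "padic_residue (of_nat b :: 'p padic) = int b"
    using padic_residue_of_int[where 'p = 'p, of "int b"] b by simp
  ultimately show ?thesis by (simp add: quad_char_unit)
qed

lemma sum_quad_char: "(\<Sum>b\<in>{0<..<CARD('p)}. of_int (quad_char (of_nat b :: 'p padic)) :: complex) = 0"
proof -
  have "(\<Sum>b\<in>{0<..<CARD('p)}. of_int (quad_char (of_nat b :: 'p padic)) :: complex) =
      of_int (\<Sum>b\<in>{0<..<CARD('p)}. Legendre (int b) (int CARD('p)))"
    by (simp add: quad_char_of_nat)
  also have "\<dots> = 0" by (simp only: sum_Legendre[OF prime_card CARD_gt_2] of_int_0)
  finally show ?thesis .
qed

lemma \<gamma>_quad: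
  assumes "\<gamma> \<noteq> (\<lambda>_. 1)" "u \<in> padic_units"
  shows "\<gamma> (padic_residue (u :: 'p padic)) = of_int (quad_char u)"
  using \<gamma>_cases assms by (auto simp: Legendre_residue)

lemma sum_cell_char:
  "(\<Sum>b\<in>{0<..<CARD('p)}. cell_char X0 b) = (if \<gamma> = (\<lambda>_. 1) then of_nat CARD('p) - 1 else 0)"
  "(\<Sum>b\<in>{0<..<CARD('p)}. cell_char X1 b) = (if \<gamma> = (\<lambda>_. 1) then 0 else of_nat CARD('p) - 1)"
proof -
  let ?D = "{0<..<CARD('p)}"
  have card: "(of_nat (card ?D) :: complex) = of_nat CARD('p) - 1"
    using CARD_gt_2 by (simp add: of_nat_diff)
  have unit: "(of_nat b :: 'p padic) \<in> padic_units" if "b \<in> ?D" for b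
    using that by (intro of_nat_unit) simp_all
  show "(\<Sum>b\<in>?D. cell_char X0 b) = (if \<gamma> = (\<lambda>_. 1) then of_nat CARD('p) - 1 else 0)"
  proof (cases "\<gamma> = (\<lambda>_. 1)")
    case True
    have "cell_char X0 b = 1" for b by (simp add: fun_cong[OF True])
    then show ?thesis unfolding if_P[OF True] using card by (simp del: cell_char.simps)
  next
    case False
    have "cell_char X0 b = of_int (quad_char (- 1 :: 'p padic)) * of_int (quad_char (of_nat b :: 'p padic))" if "b \<in> ?D" for b
      using \<gamma>_quad[OF False padic_units_minus[OF unit[OF that]]] quad_char_mult[of "- 1" "of_nat b :: 'p padic"]
        padic_units_nonzero[OF unit[OF that]] by simp
    then have "(\<Sum>b\<in>?D. cell_char X0 b) = of_int (quad_char (- 1 :: 'p padic)) * (\<Sum>b\<in>?D. of_int (quad_char (of_nat b :: 'p padic)))"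
      by (simp add: sum_distrib_left)
    then show ?thesis unfolding if_not_P[OF False] using sum_quad_char by (simp del: cell_char.simps)
  qed
  show "(\<Sum>b\<in>?D. cell_char X1 b) = (if \<gamma> = (\<lambda>_. 1) then 0 else of_nat CARD('p) - 1)"
  proof (cases "\<gamma> = (\<lambda>_. 1)")
    case True
    have "cell_char X1 b = of_int (quad_char (of_nat b :: 'p padic))" for b by (simp add: fun_cong[OF True])
    then show ?thesis unfolding if_P[OF True] using sum_quad_char by (simp del: cell_char.simps)
  next
    case False
    have "cell_char X1 b = 1" if "b \<in> ?D" for b
    proof -
      have "quad_char (of_nat b :: 'p padic) * quad_char (of_nat b :: 'p padic) = 1"
        using padic_units_nonzero[OF unit[OF that]] by (rule quad_char_self)
      then have "(of_int (quad_char (of_nat b :: 'p padic) * quad_char (of_nat b :: 'p padic)) :: complex) = 1" by simp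
      then show ?thesis using \<gamma>_quad[OF False unit[OF that]] by simp
    qed
    then show ?thesis unfolding if_not_P[OF False] using card by (simp del: cell_char.simps)
  qed
qed

end

section \<open>The Iwahori Hecke algebra as an instance of the dihedral setting\<close>

locale iwahori_hecke = iwahori_char ty \<gamma> for ty :: "'p::prime_card itself" and \<gamma> :: "int \<Rightarrow> complex" +
  fixes \<mu> :: "'p metaplectic measure"
  assumes haar: "haar_measure \<mu>" and normalised: "emeasure \<mu> K0_cover = 1"
begin

lemma K0_cover_one: "mp_section (mat 1) \<in> (K0_cover :: 'p metaplectic set)"
  by (simp add: K0_cover_def K0_1)

lemma coset_eq_image: "{y. minv x \<cdot> y \<in> K0_cover} = (\<lambda>g. x \<cdot> g) ` (K0_cover :: 'p metaplectic set)"
  by (force simp: mp_cancel image_iff)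

lemma hecke_pair_mp: "hecke_pair mp_group K0_cover chi \<mu>"
proof (rule hecke_pair.intro[OF group_mp_group], rule hecke_pair_axioms.intro)
  show "carrier mp_group = (UNIV :: 'p metaplectic set)" by (rule mp_group_simps)
  show "subgroup (K0_cover :: 'p metaplectic set) mp_group" by (rule K0_cover_subgroup)
  show "chi (k \<otimes>\<^bsub>mp_group\<^esub> k') = chi k * chi k'" if "k \<in> K0_cover" "k' \<in> K0_cover" for k k'
    using that unfolding mp_group_simps by (rule chi_mult)
  show "chi \<one>\<^bsub>mp_group\<^esub> = 1" unfolding mp_group_simps by simp
  have sets: "sets \<mu> = sets borel" using haar by (simp add: haar_measure_def)
  show "{y. minv x \<otimes>\<^bsub>mp_group\<^esub> y \<in> K0_cover} \<in> sets \<mu>" for x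
    unfolding mp_group_simps sets using open_K0_coset[of x] by simp
  have "(\<lambda>g. mp_section (mat 1) \<cdot> g) ` (K0_cover :: 'p metaplectic set) = K0_cover" by (simp add: mp_one)
  then have K: "open (K0_cover :: 'p metaplectic set)"
    using open_K0_coset[of "mp_section (mat 1)"] unfolding coset_eq_image by simp
  show "emeasure \<mu> {y. minv x \<otimes>\<^bsub>mp_group\<^esub> y \<in> K0_cover} = 1" for x
  proof -
    have "emeasure \<mu> ((\<lambda>g. x \<otimes>\<^bsub>mp_group\<^esub> g) ` K0_cover) = emeasure \<mu> K0_cover"
      using haar borel_open[OF K] by (simp add: haar_measure_def)
    then show ?thesis unfolding mp_group_simps coset_eq_image using normalised by simp
  qed
qed

sublocale P: hecke_pair mp_group K0_cover chi \<mu>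
  by (rule hecke_pair_mp)

text \<open>This is a neighbourhood of \<open>x\<close> on which every Hecke function is constant:
  translation on the right by a matrix congruent to 1 modulo p does not change the
  character.\<close>

lemma char_open: "open {y :: 'p metaplectic. minv x \<cdot> y \<in> K0_cover \<and> chi (minv x \<cdot> y) = 1}"
  unfolding open_metaplectic_def
proof (intro ballI exI)
  fix y :: "'p metaplectic" and A :: "'p padic ^ 2 ^ 2"
  assume y: "y \<in> {y. minv x \<cdot> y \<in> K0_cover \<and> chi (minv x \<cdot> y) = 1}" and A: "A \<in> principal_congruence 1"
  have "A $ 2 $ 2 \<in> padic_integers" using principal_congruence_K0[OF A] by (simp add: K0_iff)
  then have "padic_residue (A $ 2 $ 2) = 1"
    using A padic_residue_eq_iff[of "A $ 2 $ 2" 1] by (simp add: principal_congruence_iff)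
  then have "chi (mp_section A) = 1" using principal_congruence_det[OF A] by (simp add: chi_eq)
  then show "y \<cdot> mp_section A \<in> {y. minv x \<cdot> y \<in> K0_cover \<and> chi (minv x \<cdot> y) = 1}"
    using y section_in_K0_cover[OF A] by (simp add: K0_cover_mult chi_mult flip: mp_assoc)
qed

text \<open>Left cosets of \<open>K0_cover\<close> are open, so a compact support meets only
  finitely many. Conversely they are compact and closed, so a finite union of them contains the
  closure of the support; local constancy follows from right equivariance.\<close>

lemma hecke_functions_eq: "hecke_functions \<gamma> = P.hecke_carrier"
proof (rule equalityI; rule subsetI)
  fix f :: "'p metaplectic \<Rightarrow> complex" assume f: "f \<in> hecke_functions \<gamma>"
  let ?C = "\<lambda>x. {y :: 'p metaplectic. minv x \<cdot> y \<in> K0_cover}"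
  have comp: "compact (closure {x. f x \<noteq> 0})" using f by (simp add: hecke_functions_def)
  have self: "minv x \<cdot> x \<in> K0_cover" for x :: "'p metaplectic" by (simp only: mp_inv K0_cover_one)
  then have cover: "closure {x. f x \<noteq> 0} \<subseteq> (\<Union>x\<in>UNIV. ?C x)" by auto
  obtain R where R: "finite R" "closure {x. f x \<noteq> 0} \<subseteq> (\<Union>x\<in>R. ?C x)"
    by (rule compactE_image[OF comp open_K0_coset cover])
  have "{x. f x \<noteq> 0} \<subseteq> (\<Union>x\<in>R. ?C x)" using R(2) closure_subset by (rule order_trans[rotated])
  then have "P.covers R f" using R(1) by (auto simp: P.covers_def mp_group_simps)
  then show "f \<in> P.hecke_carrier"
    using f unfolding hecke_functions_def P.hecke_carrier_def chi_def by blast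
next
  fix f assume f: "f \<in> P.hecke_carrier"
  let ?C = "\<lambda>x. {y :: 'p metaplectic. minv x \<cdot> y \<in> K0_cover}"
  obtain R where R: "P.covers R f" using P.hecke_covers[OF f] by blast
  have "\<exists>U. open U \<and> x \<in> U \<and> (\<forall>y\<in>U. f y = f x)" for x
  proof (intro exI conjI ballI)
    show "open {y. minv x \<cdot> y \<in> K0_cover \<and> chi (minv x \<cdot> y) = 1}" by (rule char_open)
    show "x \<in> {y. minv x \<cdot> y \<in> K0_cover \<and> chi (minv x \<cdot> y) = 1}"
      unfolding mem_Collect_eq mp_inv by (simp add: K0_cover_one)
    fix y assume y: "y \<in> {y. minv x \<cdot> y \<in> K0_cover \<and> chi (minv x \<cdot> y) = 1}"
    then show "f y = f x"
      using P.hecke_right[OF f, of "minv x \<cdot> y" x] by (simp add: mp_group_simps mp_cancel)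
  qed
  moreover have "compact (closure {x. f x \<noteq> 0})"
  proof -
    have fin: "finite R" using R by (simp add: P.covers_def)
    have "{x. f x \<noteq> 0} \<subseteq> (\<Union>r\<in>R. ?C r)" using R by (auto simp: P.covers_def mp_group_simps)
    moreover have "closed (\<Union>r\<in>R. ?C r)" using fin closed_K0_coset by (intro closed_UN) blast+
    ultimately have sub: "closure {x. f x \<noteq> 0} \<subseteq> (\<Union>r\<in>R. ?C r)" by (rule closure_minimal)
    have "compact (\<Union>r\<in>R. ?C r)" using fin compact_K0_coset by (intro compact_UN) blast+
    then have "compact ((\<Union>r\<in>R. ?C r) \<inter> closure {x. f x \<noteq> 0})" by (rule compact_Int_closed) simp
    then show ?thesis using sub by (simp add: Int_absorb1)
  qed
  ultimately show "f \<in> hecke_functions \<gamma>"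
    using f unfolding hecke_functions_def P.hecke_carrier_def chi_def by blast
qed

lemma hecke_algebra_eq: "hecke_algebra \<mu> \<gamma> = P.hecke_ring"
proof -
  have "convolution \<mu> = P.conv" by (intro ext) (simp only: convolution_def P.conv_def)
  moreover have "(\<lambda>x. if x \<in> K0_cover then cnj (genuine_char \<gamma> x) else 0) = P.hecke_one"
    by (intro ext) (simp add: P.hecke_one_def chi_def)
  ultimately show ?thesis
    unfolding hecke_algebra_def P.hecke_ring_def hecke_functions_eq by simp
qed

lemma dihedral_hecke_mp:
  "dihedral_hecke mp_group K0_cover chi \<mu> simple_refl root_subgroup root_rep CARD('p) cell_value cell_char word_elt"
proof (rule dihedral_hecke.intro[OF hecke_pair_mp], rule dihedral_hecke_axioms.intro, unfold mp_group_simps)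
  show "simple_refl i \<cdot> simple_refl i \<in> K0_cover" for i by (rule simple_refl_square)
  show "n \<in> K0_cover" if "n \<in> root_subgroup i" for n :: "'p metaplectic" and i using that by (rule root_subgroup_in_K0)
  show "minv (simple_refl j) \<cdot> n \<cdot> simple_refl j \<in> root_subgroup j" if "i \<noteq> j" "n \<in> root_subgroup i" for i j n
    using that by (rule root_subgroup_conj)
  show "chi (minv (simple_refl i) \<cdot> k \<cdot> simple_refl i) = chi k"
    if "k \<in> K0_cover" "minv (simple_refl i) \<cdot> k \<cdot> simple_refl i \<in> K0_cover" for k i using that by (rule chi_conj)
  show "\<exists>k1 n. k = k1 \<cdot> n \<and> n \<in> root_subgroup i \<and> simple_refl i \<cdot> k1 \<cdot> minv (simple_refl i) \<in> K0_cover"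
    if "k \<in> K0_cover" for k i using that by (rule K0_cover_factor)
  show "root_rep i b \<in> (K0_cover :: 'p metaplectic set)" for i b by (rule root_rep_in_K0)
  show "chi (root_rep i b) = 1" for i b by (cases i) simp_all
  have "mat2 1 0 0 1 = (mat 1 :: 'p padic ^ 2 ^ 2)" by (simp add: mat2_eq_iff[of _ "mat 1"])
  then show "root_rep i 0 = (mp_section (mat 1) :: 'p metaplectic)" for i
    by (cases i) (simp_all add: upper_def lower_def)
  show "\<exists>b<CARD('p). minv (simple_refl i) \<cdot> (minv (root_rep i b) \<cdot> k) \<cdot> simple_refl i \<in> K0_cover"
    if "k \<in> K0_cover" for k i using that by (rule root_rep_cover)
  show "b = b'" if "b < CARD('p)" "b' < CARD('p)"
    "minv (simple_refl i) \<cdot> (minv (root_rep i b) \<cdot> root_rep i b') \<cdot> simple_refl i \<in> (K0_cover :: 'p metaplectic set)" for b b' i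
    using that by (rule root_rep_distinct)
  show "\<exists>k\<in>K0_cover. \<exists>k'\<in>K0_cover. minv (simple_refl i) \<cdot> minv (root_rep i b) \<cdot> simple_refl i = k \<cdot> simple_refl i \<cdot> k' \<and>
      chi k * chi k' = cell_char i b" if "0 < b" "b < CARD('p)" for b i using that by (rule big_cell)
  show "0 < CARD('p)" using CARD_gt_2 by simp
  show "cell_value i \<noteq> 0" for i by (rule cell_value_nonzero)
  show "word_elt [] = (mp_section (mat 1) :: 'p metaplectic)" by simp
  show "word_elt (i # v) = simple_refl i \<cdot> word_elt v" for i v by simp
  show "(word_elt v :: 'p metaplectic) \<notin> K0_cover" if "distinct_adj v" "v \<noteq> []" for v
    using that by (rule word_elt_notin_K0)
  show "S = UNIV" if "mp_section (mat 1) \<in> S" "\<And>k y. k \<in> K0_cover \<Longrightarrow> y \<in> S \<Longrightarrow> k \<cdot> y \<in> S"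
    "\<And>i y. y \<in> S \<Longrightarrow> simple_refl i \<cdot> y \<in> S" for S :: "'p metaplectic set"
    using that by (rule generated_by_reflections)
qed

sublocale D: dihedral_hecke mp_group K0_cover chi \<mu> simple_refl root_subgroup root_rep "CARD('p)" cell_value cell_char word_elt
  by (rule dihedral_hecke_mp)

text \<open>The two conditions prescribe the function on the double coset and off it, so it is
  unique; existence is the independence of the decomposition shown for the abstract
  generator.\<close>

lemma hecke_U_eq: "hecke_U \<gamma> (case i of X0 \<Rightarrow> 0 | X1 \<Rightarrow> 1) = D.U i"
proof -
  let ?n = "(case i of X0 \<Rightarrow> 0 | X1 \<Rightarrow> 1) :: int"
  let ?w = "mp_section (weyl (\<varpi> powi (- ?n))) :: 'p metaplectic"
  have w: "?w = simple_refl i"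
    by (cases i) (simp_all add: simple_refl_def weyl_elt_def power_int_minus)
  have c: "cnj (hecke_d CARD('p) ?n) = cell_value i" by (simp add: cell_value_def)
  show ?thesis
    unfolding hecke_U_def Let_def w c
  proof (rule the_equality, intro conjI ballI allI impI)
    fix k k' :: "'p metaplectic" assume "k \<in> K0_cover" "k' \<in> K0_cover"
    then show "D.U i (k \<otimes>\<^bsub>mp_group\<^esub> simple_refl i \<otimes>\<^bsub>mp_group\<^esub> k') =
        cnj (genuine_char \<gamma> k) * cell_value i * cnj (genuine_char \<gamma> k')"
      using D.U_eq[of k k' i] by (simp add: chi_def)
  next
    fix x :: "'p metaplectic"
    assume "\<nexists>k k'. k \<in> K0_cover \<and> k' \<in> K0_cover \<and> x = k \<otimes>\<^bsub>mp_group\<^esub> simple_refl i \<otimes>\<^bsub>mp_group\<^esub> k'"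
    then have "x \<notin> D.dcos (simple_refl i)" unfolding D.dcos_def by blast
    then show "D.U i x = 0" by (rule D.U_outside)
  next
    fix f :: "'p metaplectic \<Rightarrow> complex"
    assume f: "(\<forall>k\<in>K0_cover. \<forall>k'\<in>K0_cover. f (k \<otimes>\<^bsub>mp_group\<^esub> simple_refl i \<otimes>\<^bsub>mp_group\<^esub> k') =
          cnj (genuine_char \<gamma> k) * cell_value i * cnj (genuine_char \<gamma> k')) \<and>
        (\<forall>x. (\<nexists>k k'. k \<in> K0_cover \<and> k' \<in> K0_cover \<and> x = k \<otimes>\<^bsub>mp_group\<^esub> simple_refl i \<otimes>\<^bsub>mp_group\<^esub> k') \<longrightarrow> f x = 0)"
    show "f = D.U i"
    proof
      fix x
      show "f x = D.U i x"
      proof (cases "x \<in> D.dcos (simple_refl i)")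
        case True
        then obtain k k' where k: "k \<in> K0_cover" "k' \<in> K0_cover" "x = k \<otimes>\<^bsub>mp_group\<^esub> simple_refl i \<otimes>\<^bsub>mp_group\<^esub> k'"
          unfolding D.dcos_def by blast
        then show ?thesis using f D.U_eq[of k k' i] by (simp add: chi_def)
      next
        case False
        then have "f x = 0" using f unfolding D.dcos_def by blast
        then show ?thesis using False D.U_outside by simp
      qed
    qed
  qed
qed

definition quad_coeff :: "hecke_gen \<Rightarrow> complex"
  where "quad_coeff i = cell_value i * (\<Sum>b\<in>{0<..<CARD('p)}. cell_char i b)"

definition quad_const :: "hecke_gen \<Rightarrow> complex"
  where "quad_const i = of_nat CARD('p) * cell_value i ^ 2 * chi (minv (simple_refl i \<cdot> simple_refl i))"

lemma quad_coeff_simps: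
  "quad_coeff X0 = (if \<gamma> = (\<lambda>_. 1) then of_nat CARD('p) - 1 else 0)"
  "quad_coeff X1 = (if \<gamma> = (\<lambda>_. 1) then 0 else eps CARD('p) * (of_nat CARD('p) - 1))"
  by (simp_all add: quad_coeff_def sum_cell_char cell_value_simps del: cell_char.simps)

lemma quad_const_eq:
  "quad_const i = (if \<gamma> = (\<lambda>_. 1) then of_nat CARD('p) else of_int (Legendre (- 1) (int CARD('p))) * of_nat CARD('p))"
proof -
  let ?L = "of_int (Legendre (- 1) (int CARD('p))) :: complex"
  \<comment> \<open>For \<open>X1\<close> the square of \<open>eps\<close> and the sign of s_1^2
    both equal (-1/p); their product is 1.\<close>
  have "(of_int (Legendre (- 1) (int CARD('p)) * Legendre (- 1) (int CARD('p))) :: complex) = 1"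
    unfolding Legendre_minus_1_square by simp
  then have "?L * ?L = 1" by simp
  then have LL': "?L * (?L * z) = z" for z by (simp flip: mult.assoc)
  have "quad_const i = of_nat CARD('p) * \<gamma> (padic_residue (- 1 :: 'p padic))"
    unfolding quad_const_def simple_refl_square(2)
    by (cases i) (simp_all add: cell_value_simps LL')
  moreover have "\<gamma> (padic_residue (- 1 :: 'p padic)) = (if \<gamma> = (\<lambda>_. 1) then 1 else ?L)"
  proof (cases "\<gamma> = (\<lambda>_. 1)")
    case False
    then show ?thesis
      using \<gamma>_quad[OF False padic_units_minus[OF padic_units_1]] by (simp add: quad_char_minus_1)
  qed simp
  ultimately show ?thesis by (simp add: mult.commute)
qed

lemma hecke_U_quadratic:
  "D.U i \<otimes>\<^bsub>P.hecke_ring\<^esub> D.U i =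
    (quad_coeff i \<odot>\<^bsub>P.hecke_ring\<^esub> D.U i) \<oplus>\<^bsub>P.hecke_ring\<^esub> (quad_const i \<odot>\<^bsub>P.hecke_ring\<^esub> \<one>\<^bsub>P.hecke_ring\<^esub>)"
  unfolding P.hecke_ring_simps D.U_quadratic quad_coeff_def quad_const_def mp_group_simps ..

lemma hecke_presented_mp: "presented_by P.hecke_ring D.U (quadratic_relators quad_coeff quad_const)"
proof -
  have "quad_coeff = (\<lambda>i. cell_value i * (\<Sum>b\<in>{0<..<CARD('p)}. cell_char i b))"
    by (rule ext) (rule quad_coeff_def)
  moreover have "quad_const = (\<lambda>i. of_nat CARD('p) * cell_value i ^ 2 *
      chi (inv\<^bsub>mp_group\<^esub> (simple_refl i \<otimes>\<^bsub>mp_group\<^esub> simple_refl i)))"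
    by (rule ext) (simp only: quad_const_def mp_group_simps)
  ultimately show ?thesis using D.hecke_presented by simp
qed

end

lemma range_hecke_gen: "range f = {f X0, f X1}"
proof -
  have "x \<in> {X0, X1}" for x by (cases x) simp_all
  then have UNIV: "UNIV = {X0, X1}" by blast
  show ?thesis unfolding UNIV by simp
qed

theorem theorem2:
  fixes \<mu> :: "'p::prime_card metaplectic measure" and \<gamma> :: "int \<Rightarrow> complex"
  assumes "odd CARD('p)"
    and "haar_measure \<mu>"
    and "emeasure \<mu> K0_cover = 1"
    and "\<gamma> = (\<lambda>_. 1) \<or> \<gamma> = (\<lambda>a. of_int (Legendre a (int CARD('p))))"
  shows "let p = of_nat CARD('p) :: complex;
             L = of_int (Legendre (- 1) (int CARD('p))) :: complex;
             e = eps CARD('p);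
             H = hecke_algebra \<mu> \<gamma>;
             U0 = hecke_U \<gamma> 0;
             U1 = hecke_U \<gamma> 1;
             x0 = free_gen X0;
             x1 = free_gen X1
         in generated_algebra H {U0, U1} = carrier H \<and>
            U0 \<otimes>\<^bsub>H\<^esub> U0 =
              (if \<gamma> = (\<lambda>_. 1) then ((p - 1) \<odot>\<^bsub>H\<^esub> U0) \<oplus>\<^bsub>H\<^esub> (p \<odot>\<^bsub>H\<^esub> \<one>\<^bsub>H\<^esub>)
               else (L * p) \<odot>\<^bsub>H\<^esub> \<one>\<^bsub>H\<^esub>) \<and>
            U1 \<otimes>\<^bsub>H\<^esub> U1 =
              (if \<gamma> = (\<lambda>_. 1) then p \<odot>\<^bsub>H\<^esub> \<one>\<^bsub>H\<^esub>
               else ((e * (p - 1)) \<odot>\<^bsub>H\<^esub> U1) \<oplus>\<^bsub>H\<^esub> ((L * p) \<odot>\<^bsub>H\<^esub> \<one>\<^bsub>H\<^esub>)) \<and>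
            presented_by H (\<lambda>i. case i of X0 \<Rightarrow> U0 | X1 \<Rightarrow> U1)
              {x0 * x0 -
                 (if \<gamma> = (\<lambda>_. 1) then free_const (p - 1) * x0 + free_const p
                  else free_const (L * p)),
               x1 * x1 -
                 (if \<gamma> = (\<lambda>_. 1) then free_const p
                  else free_const (e * (p - 1)) * x1 + free_const (L * p))}"
proof -
  interpret iwahori_hecke "TYPE('p)" \<gamma> \<mu>
    by unfold_locales fact+
  have H: "hecke_algebra \<mu> \<gamma> = P.hecke_ring" by (rule hecke_algebra_eq)
  have U0: "hecke_U \<gamma> 0 = D.U X0" and U1: "hecke_U \<gamma> 1 = D.U X1"
    using hecke_U_eq[of X0] hecke_U_eq[of X1] by simp_all
  have U: "(\<lambda>i. case i of X0 \<Rightarrow> D.U X0 | X1 \<Rightarrow> D.U X1) = D.U"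
    by (rule ext) (simp split: hecke_gen.split)
  \<comment> \<open>The uniform relations carry a linear term for both generators; where it is
    absent its coefficient is 0. This equation and \<open>z\<close> below erase it in the free
    algebra and in the Hecke algebra.\<close>
  have fc0: "free_const 0 = (0 :: hecke_gen free_word \<Rightarrow>\<^sub>0 complex)" by (simp add: free_const_def)
  have gen: "generated_algebra P.hecke_ring {D.U X0, D.U X1} = carrier P.hecke_ring"
    using D.hecke_generated by (simp add: range_hecke_gen P.hecke_ring_simps)
  have z: "(0 \<odot>\<^bsub>P.hecke_ring\<^esub> D.U i) \<oplus>\<^bsub>P.hecke_ring\<^esub> f = f" for i f
    by (simp add: P.hecke_ring_simps)
  have pres: "presented_by P.hecke_ring D.U
    {free_gen X0 * free_gen X0 - (free_const (quad_coeff X0) * free_gen X0 + free_const (quad_const X0)),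
     free_gen X1 * free_gen X1 - (free_const (quad_coeff X1) * free_gen X1 + free_const (quad_const X1))}"
    using hecke_presented_mp unfolding quadratic_relators_def range_hecke_gen .
  note rels = hecke_U_quadratic[of X0] hecke_U_quadratic[of X1] pres
  show ?thesis
  proof (cases "\<gamma> = (\<lambda>_. 1)")
    case True
    show ?thesis
      using gen rels
      unfolding Let_def H U0 U1 U quad_coeff_simps quad_const_eq if_P[OF True] z fc0 mult_zero_left add_0
      by (intro conjI)
  next
    case False
    show ?thesis
      using gen rels
      unfolding Let_def H U0 U1 U quad_coeff_simps quad_const_eq if_not_P[OF False] z fc0 mult_zero_left add_0
      by (intro conjI)
  qed
qed

end
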